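(* Let $\mathscr{P}$ be the Lindelöf property and let $X$ be a metrizable locally-$\mathscr{P}$ space. Then $C_{\mathscr{P}}(X)$ is a Banach subalgebra of $C_b(X)$ isometrically isomorphic to $C_c(Y)$ for some unique (up to homeomorphism) locally compact space $Y$, namely $Y=\lambda_{\mathscr{P}}X$. Moreover: (1) $C_{\mathscr{P}}(X)=\{f\in C_b(X):\mathrm{supp}(f)\text{ has }\mathscr{P}\}$. (2) $C_0(X)\subseteq C_{\mathscr{P}}(X)$, with proper inclusion if $X$ is non-$\mathscr{P}$ (i.e. does not have $\mathscr{P}$). (3) $C_c(Y)=C_0(Y)$. (4) $Y$ is countably compact. (5) $Y$ is non-normal, if $X$ is non-$\mathscr{P}$. (6) $\dim C_{\mathscr{P}}(X)=\ell(X)^{\aleph_0}$.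
   Context: The scalar field is fixed and is either $\mathbb{R}$ or $\mathbb{C}$. Spaces are topological spaces, assumed non-empty. Normal and completely regular spaces are Hausdorff; compact and locally compact spaces are Hausdorff; Lindelöf spaces are regular (Hausdorff). A $\mathscr{P}$-neighborhood of a point (or set) is a neighborhood of it (i.e. a set whose interior contains it) that, as a subspace, has $\mathscr{P}$. $X$ is locally-$\mathscr{P}$ if each of its points has a $\mathscr{P}$-neighborhood in $X$. $C_b(X)$ is the algebra of continuous bounded scalar-valued functions on $X$ with the supremum norm. For $f\in C_b(X)$, $\mathrm{Coz}(f)=\{x\in X: f(x)\neq 0\}$, $\mathrm{supp}(f)=\mathrm{cl}_X\mathrm{Coz}(f)$, and $\mathrm{Coz}(X)=\{\mathrm{Coz}(f):f\in C_b(X)\}$. $C_c(X)$ is the set of $f\in C_b(X)$ with compact support, and $C_0(X)$ is the set of $f\in C_b(X)$ such that $|f|^{-1}([\epsilon,\infty))$ is compact for each $\epsilon>0$ (similarly for $Y$). Define $$C_{\mathscr{P}}(X)=\{f\in C_b(X):\mathrm{supp}(f)\text{ has a }\mathscr{P}\text{-neighborhood in }X\}.$$ For a completely regular space $X$ with Stone–Čech compactification $\beta X$, define the subspace $$\lambda_{\mathscr{P}}X=\bigcup\{\mathrm{int}_{\beta X}\mathrm{cl}_{\beta X}C: C\in\mathrm{Coz}(X)\text{ and }\mathrm{cl}_XC\text{ has }\mathscr{P}\}$$ of $\beta X$. The Lindelöf number is $\ell(X)=\min\{\mathfrak{n}:\text{any open cover of }X\text{ has a subcover of cardinality}\leq\mathfrak{n}\}+\aleph_0$.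 $\dim$ denotes the dimension as a vector space over the scalar field.
   Formalization: Item (6) is stated only for infinite X: for finite nonempty X it is false, since then C_P(X) has finite dimension |X| whereas ℓ(X)^{ℵ₀}=2^{ℵ₀}. *)

theory Defs
  imports "HOL-Analysis.Analysis" "HOL-Library.Function_Algebras"
begin

unbundle cardinal_syntax

text \<open>
  Spaces are abstract topologies \<open>X :: 'a topology\<close>.  The scalar field is a type \<open>'k\<close> of sort
  \<open>{real_normed_field, euclidean_space}\<close>: a finite-dimensional real normed field with a
  multiplicative norm.  By Frobenius' theorem its models are, up to isometric isomorphism,
  exactly \<open>real\<close> and \<open>complex\<close>, and both types are instances.

  A scalar function on \<open>X\<close> is represented by a total function \<open>'a \<Rightarrow> 'k\<close> that vanishes outside
  \<open>topspace X\<close>.  This makes the representation unique, and the pointwise operations of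
  \<^theory>\<open>HOL-Library.Function_Algebras\<close> are the algebra operations.
\<close>


subsection \<open>Spaces of bounded continuous functions\<close>

definition Cb :: "'a topology \<Rightarrow> ('a \<Rightarrow> 'k::real_normed_field) set" where
  "Cb X = {f. continuous_map X euclidean f \<and> bounded (f ` topspace X) \<and>
              (\<forall>x. x \<notin> topspace X \<longrightarrow> f x = 0)}"

definition sup_norm :: "'a topology \<Rightarrow> ('a \<Rightarrow> 'k::real_normed_field) \<Rightarrow> real" where
  "sup_norm X f = (SUP x\<in>topspace X. norm (f x))"

definition fscale :: "'k::field \<Rightarrow> ('a \<Rightarrow> 'k) \<Rightarrow> ('a \<Rightarrow> 'k)" where
  "fscale c f = (\<lambda>x. c * f x)"

global_interpretation funspace: vector_space "fscale :: 'k::field \<Rightarrow> ('a \<Rightarrow> 'k) \<Rightarrow> 'a \<Rightarrow> 'k"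
  by unfold_locales (auto simp: fscale_def fun_eq_iff algebra_simps)

definition Coz :: "'a topology \<Rightarrow> ('a \<Rightarrow> 'k::real_normed_field) \<Rightarrow> 'a set" where
  "Coz X f = {x \<in> topspace X. f x \<noteq> 0}"

definition Supp :: "'a topology \<Rightarrow> ('a \<Rightarrow> 'k::real_normed_field) \<Rightarrow> 'a set" where
  "Supp X f = X closure_of (Coz X f)"

definition Coz_sets :: "'k::real_normed_field itself \<Rightarrow> 'a topology \<Rightarrow> 'a set set" where
  "Coz_sets (_ :: 'k itself) X = {Coz X f | f :: 'a \<Rightarrow> 'k. f \<in> Cb X}"

definition Cc :: "'a topology \<Rightarrow> ('a \<Rightarrow> 'k::real_normed_field) set" where
  "Cc X = {f \<in> Cb X. compactin X (Supp X f)}"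

definition C0 :: "'a topology \<Rightarrow> ('a \<Rightarrow> 'k::real_normed_field) set" where
  "C0 X = {f \<in> Cb X. \<forall>\<epsilon>>0. compactin X {x \<in> topspace X. \<epsilon> \<le> norm (f x)}}"

text \<open>Here and below \<open>P\<close> is a topological property, and a subset \<open>S\<close> of \<open>X\<close> has \<open>P\<close> if
  \<open>P (subtopology X S)\<close>.\<close>

definition nbhd_with :: "('a topology \<Rightarrow> bool) \<Rightarrow> 'a topology \<Rightarrow> 'a set \<Rightarrow> 'a set \<Rightarrow> bool" where
  "nbhd_with P X S N \<longleftrightarrow> N \<subseteq> topspace X \<and> S \<subseteq> X interior_of N \<and> P (subtopology X N)"

definition locally_with :: "('a topology \<Rightarrow> bool) \<Rightarrow> 'a topology \<Rightarrow> bool" where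
  "locally_with P X \<longleftrightarrow> (\<forall>x \<in> topspace X. \<exists>N. nbhd_with P X {x} N)"

definition CP :: "('a topology \<Rightarrow> bool) \<Rightarrow> 'a topology \<Rightarrow> ('a \<Rightarrow> 'k::real_normed_field) set" where
  "CP P X = {f \<in> Cb X. \<exists>N. nbhd_with P X (Supp X f) N}"

definition Lindelof_property :: "'a topology \<Rightarrow> bool" where
  "Lindelof_property X \<longleftrightarrow> Lindelof_space X \<and> regular_space X \<and> Hausdorff_space X"

definition countably_compact_space :: "'a topology \<Rightarrow> bool" where
  "countably_compact_space X \<longleftrightarrow>
     (\<forall>\<U>. countable \<U> \<and> (\<forall>U\<in>\<U>. openin X U) \<and> \<Union>\<U> = topspace X
          \<longrightarrow> (\<exists>\<V>. finite \<V> \<and> \<V> \<subseteq> \<U> \<and> \<Union>\<V> = topspace X))"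


subsection \<open>Banach subalgebras and isometric isomorphisms\<close>

definition Banach_subalgebra_Cb :: "'a topology \<Rightarrow> ('a \<Rightarrow> 'k::real_normed_field) set \<Rightarrow> bool" where
  "Banach_subalgebra_Cb X A \<longleftrightarrow>
     A \<subseteq> Cb X \<and> funspace.subspace A \<and> (\<forall>f\<in>A. \<forall>g\<in>A. f * g \<in> A) \<and>
     (\<forall>F :: nat \<Rightarrow> 'a \<Rightarrow> 'k.
        (\<forall>n. F n \<in> A) \<and> (\<forall>e>0. \<exists>N. \<forall>m\<ge>N. \<forall>n\<ge>N. sup_norm X (F m - F n) < e)
        \<longrightarrow> (\<exists>f\<in>A. (\<lambda>n. sup_norm X (F n - f)) \<longlonglongrightarrow> 0))"

definition isometrically_isomorphic ::
  "'a topology \<Rightarrow> ('a \<Rightarrow> 'k::real_normed_field) set \<Rightarrow> 'b topology \<Rightarrow> ('b \<Rightarrow> 'k) set \<Rightarrow> bool" where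
  "isometrically_isomorphic X A Y B \<longleftrightarrow>
     (\<exists>\<phi>. bij_betw \<phi> A B \<and>
          (\<forall>f\<in>A. \<forall>g\<in>A. \<phi> (f + g) = \<phi> f + \<phi> g) \<and>
          (\<forall>c. \<forall>f\<in>A. \<phi> (fscale c f) = fscale c (\<phi> f)) \<and>
          (\<forall>f\<in>A. \<forall>g\<in>A. \<phi> (f * g) = \<phi> f * \<phi> g) \<and>
          (\<forall>f\<in>A. sup_norm Y (\<phi> f) = sup_norm X f))"


subsection \<open>The Stone--Cech compactification\<close>

text \<open>The closure of the image of \<open>X\<close> under the evaluation map into the Tychonoff cube indexed
  by all continuous functions \<open>X \<rightarrow> [0,1]\<close>.  A subset \<open>C\<close> of \<open>X\<close> is identified with
  \<open>beta_map X ` C\<close>.\<close>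

definition unit_functions :: "'a topology \<Rightarrow> ('a \<Rightarrow> real) set" where
  "unit_functions X = {f \<in> extensional (topspace X). continuous_map X (top_of_set {0..1}) f}"

definition Tychonoff_cube :: "'a topology \<Rightarrow> (('a \<Rightarrow> real) \<Rightarrow> real) topology" where
  "Tychonoff_cube X = product_topology (\<lambda>_. top_of_set {0..1}) (unit_functions X)"

definition beta_map :: "'a topology \<Rightarrow> 'a \<Rightarrow> ('a \<Rightarrow> real) \<Rightarrow> real" where
  "beta_map X x = (\<lambda>f\<in>unit_functions X. f x)"

definition beta :: "'a topology \<Rightarrow> (('a \<Rightarrow> real) \<Rightarrow> real) topology" where
  "beta X = subtopology (Tychonoff_cube X) (Tychonoff_cube X closure_of (beta_map X ` topspace X))"

definition lambda_P ::
  "'k::real_normed_field itself \<Rightarrow> ('a topology \<Rightarrow> bool) \<Rightarrow> 'a topology \<Rightarrow> (('a \<Rightarrow> real) \<Rightarrow> real) topology"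
  where
  "lambda_P K P X = subtopology (beta X)
     (\<Union>{beta X interior_of (beta X closure_of (beta_map X ` C)) | C.
          C \<in> Coz_sets K X \<and> P (subtopology X (X closure_of C))})"

text \<open>Compactness, Hausdorffness, density of \<open>X\<close>, and the extension property that characterizes
  the compactification.\<close>

lemma compact_space_Tychonoff_cube: "compact_space (Tychonoff_cube X)"
  by (simp add: Tychonoff_cube_def compact_space_product_topology compact_space_subtopology)

lemma Hausdorff_space_Tychonoff_cube: "Hausdorff_space (Tychonoff_cube X)"
  by (simp add: Tychonoff_cube_def Hausdorff_space_product_topology Hausdorff_space_subtopology)

lemma compact_space_beta: "compact_space (beta X)"
  unfolding beta_def
  by (simp add: closedin_compact_space compact_space_Tychonoff_cube compact_space_subtopology)

lemma Hausdorff_space_beta: "Hausdorff_space (beta X)"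
  unfolding beta_def by (simp add: Hausdorff_space_subtopology Hausdorff_space_Tychonoff_cube)

lemma beta_map_in_cube: "beta_map X ` topspace X \<subseteq> topspace (Tychonoff_cube X)"
  by (auto simp: beta_map_def Tychonoff_cube_def unit_functions_def continuous_map_def PiE_def Pi_def)

lemma beta_dense: "beta X closure_of (beta_map X ` topspace X) = topspace (beta X)"
proof -
  have "beta_map X ` topspace X \<subseteq> Tychonoff_cube X closure_of (beta_map X ` topspace X)"
    by (simp add: beta_map_in_cube closure_of_subset)
  then show ?thesis
    unfolding beta_def by (auto simp: closure_of_subtopology Int_absorb1 closure_of_subset_topspace
        dest: subsetD[OF closure_of_subset_topspace])
qed

lemma beta_embedding:
  assumes "completely_regular_space X" "Hausdorff_space X"
  shows "embedding_map X (beta X) (beta_map X)"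
proof -
  have "mspace (submetric (cfunspace X euclidean_metric) {f. f \<in> topspace X \<rightarrow> {0..1}}) = unit_functions X"
  proof -
    have "bounded (f ` topspace X)" if "f \<in> topspace X \<rightarrow> {0..1}" for f :: "'a \<Rightarrow> real"
      using that by (intro bounded_subset[OF bounded_closed_interval[of 0 1]]) auto
    then show ?thesis
      unfolding unit_functions_def
      by (intro set_eqI) (simp add: continuous_map_in_subtopology image_subset_iff_funcset, blast)
  qed
  then have "embedding_map X (Tychonoff_cube X) (beta_map X)"
    using completely_regular_space_cube_embedding_explicit[OF assms]
    by (simp add: Tychonoff_cube_def beta_map_def[abs_def])
  then show ?thesis
    unfolding beta_def embedding_map_in_subtopology
    using closure_of_subset[OF beta_map_in_cube, of X] by blast
qed

lemma beta_extension:
  assumes "continuous_map X (top_of_set {0..1::real}) f"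
  shows "\<exists>g. continuous_map (beta X) (top_of_set {0..1}) g \<and>
             (\<forall>x\<in>topspace X. g (beta_map X x) = f x)"
proof -
  define h where "h = restrict f (topspace X)"
  have "continuous_map X (top_of_set {0..1}) h"
    using assms by (rule continuous_map_eq) (simp add: h_def)
  then have h: "h \<in> unit_functions X"
    by (simp add: unit_functions_def h_def)
  have "continuous_map (beta X) (top_of_set {0..1}) (\<lambda>z. z h)"
    unfolding beta_def Tychonoff_cube_def
    by (rule continuous_map_from_subtopology) (rule continuous_map_product_projection[OF h])
  moreover have "\<forall>x\<in>topspace X. beta_map X x h = f x"
    using h by (simp add: beta_map_def h_def)
  ultimately show ?thesis by blast
qed


subsection \<open>Cardinal invariants\<close>

text \<open>A minimum over all cardinals need only be taken over the cardinals represented on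
  \<open>'a set\<close>, because a subcover is a subset of that type; the lemma shows it exists.\<close>

definition covers_reduce_to :: "'a topology \<Rightarrow> 'a set rel \<Rightarrow> bool" where
  "covers_reduce_to X r \<longleftrightarrow>
     (\<forall>\<U>. (\<forall>U\<in>\<U>. openin X U) \<and> \<Union>\<U> = topspace X
          \<longrightarrow> (\<exists>\<V>. \<V> \<subseteq> \<U> \<and> \<Union>\<V> = topspace X \<and> |\<V>| \<le>o r))"

definition is_min_cover_card :: "'a topology \<Rightarrow> 'a set rel \<Rightarrow> bool" where
  "is_min_cover_card X r \<longleftrightarrow>
     Card_order r \<and> covers_reduce_to X r \<and>
     (\<forall>s. Card_order s \<and> covers_reduce_to X s \<longrightarrow> r \<le>o s)"

lemma ex_min_cover_card: "\<exists>r. is_min_cover_card X r"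
proof -
  let ?R = "{r. Card_order r \<and> covers_reduce_to X r}"
  have "|UNIV :: 'a set set| \<in> ?R"
    by (auto simp: covers_reduce_to_def card_of_Card_order intro!: card_of_mono1)
  then have "?R \<noteq> {}" by blast
  then obtain r where "r \<in> ?R" "\<forall>s\<in>?R. r \<le>o s"
    using exists_minim_Card_order[of ?R] by blast
  then show ?thesis
    unfolding is_min_cover_card_def by blast
qed

definition Lindelof_number :: "'a topology \<Rightarrow> ('a set + nat) rel" where
  "Lindelof_number X = (SOME r. is_min_cover_card X r) +c natLeq"

text \<open>The dimension as a cardinal, i.e. the cardinality of a Hamel basis over \<open>'k\<close>.
  (The library function \<open>vector_space.dim\<close> is \<open>0\<close> on infinite-dimensional spaces.)\<close>

definition is_Hamel_basis :: "('a \<Rightarrow> 'k::field) set \<Rightarrow> ('a \<Rightarrow> 'k) set \<Rightarrow> bool" where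
  "is_Hamel_basis V B \<longleftrightarrow> B \<subseteq> V \<and> funspace.independent B \<and> funspace.span B = V"

definition Hamel_dim :: "('a \<Rightarrow> 'k::field) set \<Rightarrow> ('a \<Rightarrow> 'k) rel" where
  "Hamel_dim V = |SOME B. is_Hamel_basis V B|"

lemma ex_Hamel_basis:
  assumes "funspace.subspace V"
  shows "\<exists>B. is_Hamel_basis V B"
proof -
  obtain B where "B \<subseteq> V" "funspace.independent B" "V \<subseteq> funspace.span B"
    using funspace.maximal_independent_subset[of V] by blast
  with assms show ?thesis
    unfolding is_Hamel_basis_def using funspace.span_minimal by blast
qed

end

theory Submission
  imports Defs "HOL-Library.Countable_Set_Type"
begin

text \<open>
  A locally Lindelof metrizable space is a disjoint union of a family \<open>I\<close> of open Lindelof sets.  A Lindelof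
  set meets only countably many members of \<open>I\<close>, so \<open>C\<^sub>P(X)\<close> consists of the functions that vanish off the union
  of some countable \<open>J \<subseteq> I\<close>, and \<open>Y\<close> is the union of the open compact sets \<open>E J\<close>, the closures in \<open>\<beta>X\<close> of these
  unions.  Countable subsets of \<open>Y\<close> lie in a single \<open>E J\<close>, whence countable compactness and \<open>C\<^sub>c(Y) = C\<^sub>0(Y)\<close>;
  restriction to \<open>X\<close> is the isometry.  The space is recovered from the algebra because
  every character of \<open>C\<^sub>c(Y)\<close> is an evaluation.  If \<open>I\<close> is uncountable, a coherent family of
  finite-to-one functions on the countable ordinals yields two closed sets in \<open>Y\<close> that cannot be separated.
  For the dimension, a function in \<open>C\<^sub>P(X)\<close> is determined by a sequence of points in a dense set of size \<open>\<ell>(X)\<close>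
  together with its values there, while almost disjoint countable subsets of \<open>I\<close>
  (or, if \<open>I\<close> is finite, the powers of a distance function) give enough independent functions.
\<close>

subsection \<open>Decomposition of the space\<close>

text \<open>The partition turns topology into combinatorics of subsets of \<open>I\<close>. For
  every \<open>J \<subseteq> I\<close> the indicator of \<open>\<Union>J\<close> is continuous and
  extends to \<open>beta X\<close>; hence disjoint subfamilies have disjoint closures,
  \<open>E\<close> respects the Boolean operations, and every \<open>E J\<close> is clopen. What is
  asked of the algebra then rests on the countable subsets of \<open>I\<close> forming a
  sigma-ideal. Non-normality needs more: for countable \<open>J\<close> the set \<open>E J\<close>
  is compact Hausdorff, hence normal, so the obstruction must be invisible on each of them.
  Therefore the two closed sets are assembled from countable stages that agree only up to finite
  sets, and finite sets leave no trace outside the sets \<open>E {C}\<close>. The coherent family is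
  the one familiar from constructions of Aronszajn trees.\<close>

text \<open>The pieces are the classes of the chain relation generated by \<open>R\<close>.  The radii are chosen such that \<open>R\<close> maps a
  subset of a Lindelof set into a countable union of balls that lie in Lindelof sets.\<close>

lemma (in Metric_space) Lindelof_chain_partition:
  assumes loc: "\<And>x. x \<in> M \<Longrightarrow> \<exists>N \<subseteq> M. x \<in> mtopology interior_of N \<and> Lindelof_space (subtopology mtopology N)"
  shows "\<exists>I. (\<forall>C\<in>I. openin mtopology C \<and> C \<noteq> {} \<and> Lindelof_space (subtopology mtopology C))
             \<and> disjoint I \<and> \<Union>I = M"
proof -
  \<comment> \<open>Containment in a Lindelof set passes to subsets at once; being Lindelof would
    need a further argument.\<close>
  define small where "small S \<longleftrightarrow> (\<exists>L \<subseteq> M. S \<subseteq> L \<and> Lindelof_space (subtopology mtopology L))" for S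
  \<comment> \<open>The factor 4 leaves room for three steps shorter than
    \<open>1 / real (Suc n)\<close>, from \<open>p y\<close> over \<open>y\<close> and
    \<open>s\<close> to \<open>z\<close>, in the proof of \<open>small_R\<close>.\<close>
  define good where "good n x \<longleftrightarrow> x \<in> M \<and> small (mball x (4 / real (Suc n)))" for n x
  \<comment> \<open>Demanding \<open>good n\<close> with the same \<open>n\<close> at both ends
    makes \<open>R\<close> symmetric.\<close>
  define R where "R = {(x, y). \<exists>n. good n x \<and> good n y \<and> d x y < 1 / real (Suc n)}"
  have small_subset: "small S" if "small T" "S \<subseteq> T" for S T
    using that unfolding small_def by blast
  have small_UN: "small (\<Union>s\<in>K. S s)" if "countable K" "\<And>s. s \<in> K \<Longrightarrow> small (S s)" for K :: "'b set" and S
  proof -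
    obtain L where L: "L s \<subseteq> M \<and> S s \<subseteq> L s \<and> Lindelof_space (subtopology mtopology (L s))" if "s \<in> K" for s
      using \<open>\<And>s. s \<in> K \<Longrightarrow> small (S s)\<close> unfolding small_def by metis
    have "Lindelof_space (subtopology mtopology (\<Union>(L ` K)))"
      using that(1) L by (intro Lindelof_space_Union) auto
    with L show ?thesis unfolding small_def by (intro exI[of _ "\<Union>(L ` K)"]) blast
  qed
  have refl: "\<exists>e>0. \<forall>y. y \<in> mball x e \<longrightarrow> (x, y) \<in> R" if x: "x \<in> M" for x
  proof -
    obtain N where N: "N \<subseteq> M" "x \<in> mtopology interior_of N" "Lindelof_space (subtopology mtopology N)"
      using loc[OF x] by blast
    then obtain e where e: "e > 0" "mball x e \<subseteq> N"
      by (metis interior_of_subset openin_interior_of openin_mtopology order_trans)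
    \<comment> \<open>Here 5 is 4 + 1: a ball of radius \<open>4 / real (Suc n)\<close> whose centre
      is within \<open>1 / real (Suc n)\<close> of \<open>x\<close> stays inside
      \<open>mball x e\<close>.\<close>
    obtain n where n: "5 / e < real (Suc n)"
      by (metis lessI less_trans of_nat_less_iff reals_Archimedean2)
    have en: "5 / real (Suc n) < e"
      using n e by (simp add: field_simps)
    have sm: "small (mball x e)" using e N unfolding small_def by blast
    have "(x, y) \<in> R" if y: "y \<in> mball x (1 / real (Suc n))" for y
    proof -
      have "mball y (4 / real (Suc n)) \<subseteq> mball x e"
      proof
        fix z assume z: "z \<in> mball y (4 / real (Suc n))"
        then have "d x z \<le> d x y + d y z" using x y by (intro triangle) auto
        also have "\<dots> < 1 / real (Suc n) + 4 / real (Suc n)" using y z by auto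
        also have "\<dots> < e" using en by (simp flip: add_divide_distrib)
        finally show "z \<in> mball x e" using x z by auto
      qed
      moreover have "mball x (4 / real (Suc n)) \<subseteq> mball x e"
        using en by (intro mball_subset_concentric) (smt (verit) divide_right_mono of_nat_0_le_iff)
      ultimately have "good n x" "good n y"
        using small_subset[OF sm] x y unfolding good_def by auto
      then show ?thesis using y unfolding R_def by auto
    qed
    then show ?thesis by (intro exI[of _ "1 / real (Suc n)"]) auto
  qed
  have small_R: "small (R `` S)" if "small S" for S
  proof -
    obtain L where L: "L \<subseteq> M" "S \<subseteq> L" "Lindelof_space (subtopology mtopology L)"
      using \<open>small S\<close> unfolding small_def by blast
    have "small (\<Union>{mball s (1 / real (Suc n)) |s. s \<in> S \<and> good n s})" for n
    proof -
      let ?\<U> = "(\<lambda>y. mball y (1 / real (Suc n))) ` L"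
      have "\<exists>\<V>. countable \<V> \<and> \<V> \<subseteq> ?\<U> \<and> L \<subseteq> \<Union>\<V>"
      proof -
        have "(\<forall>U\<in>?\<U>. openin mtopology U) \<and> L \<subseteq> \<Union>?\<U>"
          using L(1) by auto
        then show ?thesis
          using L(1,3) Lindelof_space_subtopology_subset[of L mtopology] by (simp only: topspace_mtopology) blast
      qed
      then obtain K where K: "countable K" "K \<subseteq> L" "L \<subseteq> (\<Union>y\<in>K. mball y (1 / real (Suc n)))"
        by (metis countable_subset_image)
      \<comment> \<open>The centres in \<open>K\<close> need not be good points of \<open>S\<close>.
        Each one close to such a point is exchanged for it; the larger ball about \<open>p y\<close>
        is small because \<open>p y\<close> is good.\<close>
      define K' where "K' = {y \<in> K. \<exists>s\<in>S. good n s \<and> d y s < 1 / real (Suc n)}"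
      obtain p where p: "p y \<in> S \<and> good n (p y) \<and> d y (p y) < 1 / real (Suc n)" if "y \<in> K'" for y
      proof -
        have "\<forall>y\<in>K'. \<exists>s. s \<in> S \<and> good n s \<and> d y s < 1 / real (Suc n)"
          unfolding K'_def by auto
        then obtain p where "\<forall>y\<in>K'. p y \<in> S \<and> good n (p y) \<and> d y (p y) < 1 / real (Suc n)"
          by (rule bchoice[THEN exE])
        then show thesis by (intro that[of p]) auto
      qed
      have "\<Union>{mball s (1 / real (Suc n)) |s. s \<in> S \<and> good n s} \<subseteq> (\<Union>y\<in>K'. mball (p y) (4 / real (Suc n)))"
      proof clarify
        fix z s assume zs: "z \<in> mball s (1 / real (Suc n))" "s \<in> S" "good n s"
        then obtain y where y: "y \<in> K" "s \<in> mball y (1 / real (Suc n))"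
          using K L by blast
        then have y': "y \<in> K'" using zs unfolding K'_def by auto
        have M: "s \<in> M" "z \<in> M" "y \<in> M" "p y \<in> M" using zs y p[OF y'] unfolding good_def by auto
        have "d (p y) z \<le> d y (p y) + d y s + d s z"
          using M by (smt (verit) commute triangle)
        also have "\<dots> < 1 / real (Suc n) + 1 / real (Suc n) + 1 / real (Suc n)"
          using zs y p[OF y'] by (auto intro!: add_strict_mono)
        also have "\<dots> \<le> 4 / real (Suc n)" by (simp flip: add_divide_distrib add: divide_right_mono)
        finally show "z \<in> (\<Union>y\<in>K'. mball (p y) (4 / real (Suc n)))"
          using M y' unfolding UN_iff in_mball by blast
      qed
      moreover have "small (\<Union>y\<in>K'. mball (p y) (4 / real (Suc n)))"
        using K(1) p unfolding good_def by (intro small_UN) (auto simp: K'_def)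
      ultimately show ?thesis by (rule small_subset[rotated])
    qed
    then have "small (\<Union>n. \<Union>{mball s (1 / real (Suc n)) |s. s \<in> S \<and> good n s})"
      by (intro small_UN) auto
    moreover have "R `` S \<subseteq> (\<Union>n. \<Union>{mball s (1 / real (Suc n)) |s. s \<in> S \<and> good n s})"
    proof
      fix y assume "y \<in> R `` S"
      then obtain s n where sn: "s \<in> S" "good n s" "good n y" "d s y < 1 / real (Suc n)"
        unfolding R_def by blast
      then have "y \<in> mball s (1 / real (Suc n))" unfolding good_def in_mball by blast
      with sn show "y \<in> (\<Union>n. \<Union>{mball s (1 / real (Suc n)) |s. s \<in> S \<and> good n s})" by blast
    qed
    ultimately show ?thesis by (rule small_subset)
  qed
  have small_iter: "small ((R ^^ n) `` {x})" if "x \<in> M" for n x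
  proof (induction n)
    case 0
    obtain N where N: "N \<subseteq> M" "x \<in> mtopology interior_of N" "Lindelof_space (subtopology mtopology N)"
      using loc[OF \<open>x \<in> M\<close>] by blast
    then have "{x} \<subseteq> N" using interior_of_subset[of mtopology N] by blast
    then show ?case using N unfolding small_def by auto
  next
    case (Suc n)
    have "(R ^^ Suc n) `` {x} = R `` ((R ^^ n) `` {x})" by auto
    then show ?case using small_R[OF Suc] by simp
  qed
  have small_class: "small (R\<^sup>* `` {x})" if "x \<in> M" for x
  proof -
    have "R\<^sup>* `` {x} = (\<Union>n. (R ^^ n) `` {x})"
      by (auto simp: rtrancl_is_UN_relpow)
    then show ?thesis using small_UN[of "UNIV :: nat set"] small_iter[OF that] by simp
  qed
  have RM: "R\<^sup>* `` {x} \<subseteq> M" if "x \<in> M" for x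
  proof -
    have "y \<in> M" if "(x, y) \<in> R\<^sup>*" for y
      using that \<open>x \<in> M\<close> by (induction) (auto simp: R_def good_def)
    then show ?thesis by auto
  qed
  have symR: "sym (R\<^sup>*)"
    by (intro sym_rtrancl symI) (auto simp: R_def commute)
  have op: "openin mtopology (R\<^sup>* `` {x})" if "x \<in> M" for x
    unfolding openin_mtopology
  proof (intro conjI allI impI)
    show "R\<^sup>* `` {x} \<subseteq> M" using RM that by auto
    fix y assume y: "y \<in> R\<^sup>* `` {x}"
    then obtain e where "e > 0" "\<forall>z. z \<in> mball y e \<longrightarrow> (y, z) \<in> R"
      using refl RM[OF \<open>x \<in> M\<close>] by blast
    then show "\<exists>r>0. mball y r \<subseteq> R\<^sup>* `` {x}"
      using y by (intro exI[of _ e]) (auto intro: rtrancl_into_rtrancl)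
  qed
  define I where "I = (\<lambda>x. R\<^sup>* `` {x}) ` M"
  have disj: "disjoint I"
  proof (unfold disjoint_def, intro ballI impI)
    fix A B assume "A \<in> I" "B \<in> I" "A \<noteq> B"
    then obtain x y where xy: "A = R\<^sup>* `` {x}" "B = R\<^sup>* `` {y}" unfolding I_def by auto
    show "A \<inter> B = {}"
    proof (rule ccontr)
      assume "A \<inter> B \<noteq> {}"
      then obtain z where "(x, z) \<in> R\<^sup>*" "(y, z) \<in> R\<^sup>*" using xy by auto
      then have "(x, y) \<in> R\<^sup>*" "(y, x) \<in> R\<^sup>*" using symR by (meson symD rtrancl_trans)+
      then have "A = B" unfolding xy by (auto intro: rtrancl_trans)
      then show False using \<open>A \<noteq> B\<close> by simp
    qed
  qed
  have un: "\<Union>I = M" using RM unfolding I_def by auto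
  have "Lindelof_space (subtopology mtopology C)" if C: "C \<in> I" for C
  proof -
    obtain L where L: "L \<subseteq> M" "C \<subseteq> L" "Lindelof_space (subtopology mtopology L)"
      using small_class C unfolding I_def small_def by blast
    \<comment> \<open>\<open>small\<close> yields only a Lindelof superset \<open>L\<close>. The
      class is closed, its complement being a union of classes, and closed subsets of
      \<open>L\<close> are Lindelof.\<close>
    have "M - C = \<Union>(I - {C})"
      using disj un C unfolding disjoint_def by auto
    moreover have "openin mtopology (\<Union>(I - {C}))"
      using op unfolding I_def by (intro openin_Union) auto
    ultimately have "closedin mtopology C"
      using C un by (auto simp: closedin_def)
    then have "closedin (subtopology mtopology L) C"
      using L(2) closedin_subset_topspace by blast
    from Lindelof_space_closedin_subtopology[OF L(3) this] show ?thesis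
      using L(2) by (simp add: subtopology_subtopology Int_absorb1)
  qed
  then show ?thesis
    using disj un op unfolding I_def by (intro exI[of _ I]) (auto simp: I_def)
qed

lemma locally_Lindelof_metrizable_partition:
  assumes "metrizable_space X" "locally_with Lindelof_property X"
  shows "\<exists>I. (\<forall>C\<in>I. openin X C \<and> C \<noteq> {} \<and> Lindelof_space (subtopology X C)) \<and> disjoint I \<and> \<Union>I = topspace X"
proof -
  obtain M d where Md: "Metric_space M d" "X = Metric_space.mtopology M d"
    using assms(1) unfolding metrizable_space_def by blast
  then interpret Metric_space M d by simp
  show ?thesis
    unfolding Md(2) topspace_mtopology
  proof (rule Lindelof_chain_partition)
    fix x assume "x \<in> M"
    then show "\<exists>N\<subseteq>M. x \<in> mtopology interior_of N \<and> Lindelof_space (subtopology mtopology N)"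
      using assms(2) Md unfolding locally_with_def nbhd_with_def Lindelof_property_def by auto
  qed
qed

subsection \<open>The algebra of functions with Lindelof support\<close>

lemma CbD:
  assumes "f \<in> Cb X"
  shows "continuous_map X euclidean f" "bounded (f ` topspace X)" "x \<notin> topspace X \<Longrightarrow> f x = 0"
  using assms by (auto simp: Cb_def)

lemma Coz_subset: "Coz X f \<subseteq> topspace X"
  by (auto simp: Coz_def)

lemma norm_le_sup_norm:
  fixes f :: "'a \<Rightarrow> 'k::real_normed_field"
  assumes "bounded (f ` topspace X)" "x \<in> topspace X"
  shows "norm (f x) \<le> sup_norm X f"
proof -
  obtain B where "\<forall>x\<in>topspace X. norm (f x) \<le> B"
    using assms(1) by (auto simp: bounded_iff)
  then have "bdd_above ((\<lambda>x. norm (f x)) ` topspace X)" by (auto intro!: bdd_aboveI2)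
  then show ?thesis unfolding sup_norm_def using assms(2) by (intro cSUP_upper)
qed

lemma sup_norm_le:
  assumes "topspace X \<noteq> {}" "\<And>x. x \<in> topspace X \<Longrightarrow> norm (f x) \<le> c"
  shows "sup_norm X f \<le> c"
  unfolding sup_norm_def using assms by (intro cSUP_least) auto

lemma sup_norm_nonneg:
  fixes f :: "'a \<Rightarrow> 'k::real_normed_field"
  assumes "topspace X \<noteq> {}" "bounded (f ` topspace X)"
  shows "0 \<le> sup_norm X f"
  using norm_le_sup_norm[OF assms(2)] assms(1) norm_ge_zero order_trans by blast

lemma bounded_comp_binary:
  fixes f g :: "'a \<Rightarrow> 'k::real_normed_field"
  assumes "bounded (f ` S)" "bounded (g ` S)"
  shows "bounded ((f + g) ` S)" "bounded ((f - g) ` S)" "bounded ((f * g) ` S)"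
proof -
  obtain a b where ab: "\<forall>x\<in>S. norm (f x) \<le> a" "\<forall>x\<in>S. norm (g x) \<le> b"
    using assms by (auto simp: bounded_iff)
  have "norm ((f + g) x) \<le> a + b" if "x \<in> S" for x
    using ab that by (auto intro!: norm_triangle_mono)
  moreover have "norm ((f - g) x) \<le> a + b" if "x \<in> S" for x
    using ab that norm_triangle_ineq4[of "f x" "g x"] by fastforce
  moreover have "norm ((f * g) x) \<le> \<bar>a\<bar> * \<bar>b\<bar>" if "x \<in> S" for x
    using ab that by (auto simp: norm_mult intro!: mult_mono elim: order_trans[rotated])
  ultimately show "bounded ((f + g) ` S)" "bounded ((f - g) ` S)" "bounded ((f * g) ` S)"
    unfolding bounded_iff by blast+
qed

lemma Cb_closed:
  assumes f: "f \<in> Cb X" and g: "g \<in> Cb X"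
  shows "f + g \<in> Cb X" "f - g \<in> Cb X" "f * g \<in> Cb X" "fscale c f \<in> Cb X"
proof -
  have [continuous_intros]: "continuous_map X euclidean f" "continuous_map X euclidean g"
    using f g CbD by auto
  note b = CbD(2)[OF f] CbD(2)[OF g]
  have c: "continuous_map X euclidean (\<lambda>x. f x + g x)" "continuous_map X euclidean (\<lambda>x. f x - g x)"
    "continuous_map X euclidean (\<lambda>x. f x * g x)" "continuous_map X euclidean (\<lambda>x. c * f x)"
    using \<open>continuous_map X euclidean f\<close> \<open>continuous_map X euclidean g\<close>
    by (auto simp: continuous_map_atin limitin_canonical_iff intro: tendsto_intros)
  have "bounded ((\<lambda>x. c * f x) ` topspace X)"
    using bounded_comp_binary(3)[OF _ b(1), of "\<lambda>_. c"] by (simp add: image_constant_conv times_fun_def)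
  then show "f + g \<in> Cb X" "f - g \<in> Cb X" "f * g \<in> Cb X" "fscale c f \<in> Cb X"
    using c bounded_comp_binary[OF b] CbD(3)[OF f] CbD(3)[OF g]
    by (auto simp: Cb_def fscale_def plus_fun_def times_fun_def fun_diff_def)
qed

lemma zero_in_Cb: "0 \<in> Cb X"
  unfolding Cb_def by (auto simp: zero_fun_def image_constant_conv)

text \<open>The partition is a parameter rather than a choice made from \<open>X\<close>, because a
  second partition of the same space, into singletons, is used for the dimension.\<close>

locale Lindelof_partition =
  fixes X :: "'a topology" and I :: "'a set set"
  assumes metrizable: "metrizable_space X"
    and nonempty: "topspace X \<noteq> {}"
    and open_member: "C \<in> I \<Longrightarrow> openin X C"
    and nonempty_member: "C \<in> I \<Longrightarrow> C \<noteq> {}"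
    and Lindelof_member: "C \<in> I \<Longrightarrow> Lindelof_space (subtopology X C)"
    and disjoint_members: "disjoint I"
    and Union_members: "\<Union>I = topspace X"
begin

lemma Hausdorff: "Hausdorff_space X" and regular: "regular_space X"
  and completely_regular: "completely_regular_space X"
  using metrizable metrizable_imp_Hausdorff_space metrizable_imp_regular_space
    metrizable_imp_completely_regular_space by auto

lemma Lindelof_property_iff: "Lindelof_property (subtopology X S) \<longleftrightarrow> Lindelof_space (subtopology X S)"
  unfolding Lindelof_property_def
  using Hausdorff regular Hausdorff_space_subtopology regular_space_subtopology by blast

lemma Lindelof_property_iff': "Lindelof_property X \<longleftrightarrow> Lindelof_space X"
  using Lindelof_property_iff[of "topspace X"] by simp

lemma same_member: "C \<in> I \<Longrightarrow> C' \<in> I \<Longrightarrow> x \<in> C \<Longrightarrow> x \<in> C' \<Longrightarrow> C = C'"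
  using disjoint_members unfolding disjoint_def by blast

lemma Union_subset: "J \<subseteq> I \<Longrightarrow> \<Union>J \<subseteq> topspace X"
  using Union_members by blast

lemma open_Union: "J \<subseteq> I \<Longrightarrow> openin X (\<Union>J)"
  using open_member by (intro openin_Union) auto

lemma Union_Diff: "J \<subseteq> I \<Longrightarrow> K \<subseteq> I \<Longrightarrow> \<Union>(J - K) = \<Union>J - \<Union>K"
  using same_member by fast

lemma Union_Int: "J \<subseteq> I \<Longrightarrow> K \<subseteq> I \<Longrightarrow> \<Union>(J \<inter> K) = \<Union>J \<inter> \<Union>K"
  using same_member by fast

lemma closed_Union:
  assumes "J \<subseteq> I"
  shows "closedin X (\<Union>J)"
proof -
  have "topspace X - \<Union>J = \<Union>(I - J)"
    using Union_Diff[OF subset_refl assms] Union_members by simp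
  then show ?thesis
    using open_Union[of "I - J"] Union_subset[OF assms] by (simp add: closedin_def)
qed

lemma closure_Union: "J \<subseteq> I \<Longrightarrow> X closure_of \<Union>J = \<Union>J"
  by (simp add: closed_Union closure_of_closedin)

lemma Lindelof_Union: "J \<subseteq> I \<Longrightarrow> countable J \<Longrightarrow> Lindelof_space (subtopology X (\<Union>J))"
  by (intro Lindelof_space_Union) (auto intro: Lindelof_member)

text \<open>The members of \<open>I\<close> are themselves an open cover of \<open>S\<close>, and by
  disjointness a subcover must keep every member that meets \<open>S\<close>.\<close>

lemma Lindelof_meets_countably_many:
  assumes S: "S \<subseteq> topspace X" and L: "Lindelof_space (subtopology X S)"
  shows "countable {C \<in> I. C \<inter> S \<noteq> {}}"
proof -
  have "(\<forall>C\<in>I. openin X C) \<and> S \<subseteq> \<Union>I"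
    using open_member S Union_members by auto
  then obtain V where V: "countable V" "V \<subseteq> I" "S \<subseteq> \<Union>V"
    using L[unfolded Lindelof_space_subtopology_subset[OF S], rule_format, of I] by metis
  have "{C \<in> I. C \<inter> S \<noteq> {}} \<subseteq> V"
    using V same_member by blast
  then show ?thesis using V(1) countable_subset by blast
qed

lemma Lindelof_subset_Union:
  assumes S: "S \<subseteq> topspace X" and L: "Lindelof_space (subtopology X S)"
  obtains J where "J \<subseteq> I" "countable J" "S \<subseteq> \<Union>J"
proof (rule that[of "{C \<in> I. C \<inter> S \<noteq> {}}"])
  show "S \<subseteq> \<Union>{C \<in> I. C \<inter> S \<noteq> {}}"
    using S Union_members by fast
qed (use Lindelof_meets_countably_many[OF assms] in auto)

lemma Lindelof_iff_countable: "Lindelof_space X \<longleftrightarrow> countable I"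
proof
  assume L: "Lindelof_space X"
  have "{C \<in> I. C \<inter> topspace X \<noteq> {}} = I" using nonempty_member Union_members by auto
  then show "countable I"
    using Lindelof_meets_countably_many[of "topspace X"] L by simp
next
  assume "countable I"
  then show "Lindelof_space X"
    using Lindelof_Union[of I] Union_members by simp
qed

text \<open>The form in which the algebra is handled from here on. For countable \<open>J\<close>
  the set \<open>\<Union>J\<close> is clopen and Lindelof, so it is itself a neighborhood of every
  support whose cozero set it contains.\<close>

lemma CP_altdef:
  "CP Lindelof_property X = {f \<in> Cb X. \<exists>J\<subseteq>I. countable J \<and> Coz X f \<subseteq> \<Union>J}"
  unfolding CP_def
proof (intro Collect_cong conj_cong refl iffI)
  fix f :: "'a \<Rightarrow> 'k::real_normed_field" assume "f \<in> Cb X"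
  assume "\<exists>N. nbhd_with Lindelof_property X (Supp X f) N"
  then obtain N where N: "N \<subseteq> topspace X" "Supp X f \<subseteq> X interior_of N" "Lindelof_property (subtopology X N)"
    unfolding nbhd_with_def by auto
  then obtain J where J: "J \<subseteq> I" "countable J" "N \<subseteq> \<Union>J"
    using Lindelof_subset_Union[of N] unfolding Lindelof_property_iff by metis
  have "Coz X f \<subseteq> Supp X f" unfolding Supp_def by (simp add: Coz_subset closure_of_subset)
  also have "\<dots> \<subseteq> N" using N(2) interior_of_subset by fastforce
  finally show "\<exists>J\<subseteq>I. countable J \<and> Coz X f \<subseteq> \<Union>J" using J by blast
next
  fix f :: "'a \<Rightarrow> 'k::real_normed_field"
  assume "\<exists>J\<subseteq>I. countable J \<and> Coz X f \<subseteq> \<Union>J"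
  then obtain J where J: "J \<subseteq> I" "countable J" "Coz X f \<subseteq> \<Union>J" by auto
  then have "Supp X f \<subseteq> \<Union>J"
    unfolding Supp_def by (simp add: closed_Union closure_of_minimal)
  then show "\<exists>N. nbhd_with Lindelof_property X (Supp X f) N"
    unfolding nbhd_with_def Lindelof_property_iff using J
    by (intro exI[of _ "\<Union>J"]) (auto simp: Lindelof_Union open_Union interior_of_openin dest: subsetD[OF Union_subset])
qed

lemma CP_E:
  assumes "f \<in> CP Lindelof_property X"
  obtains J where "f \<in> Cb X" "J \<subseteq> I" "countable J" "Coz X f \<subseteq> \<Union>J"
  using assms unfolding CP_altdef by auto

lemma CP_I: "f \<in> Cb X \<Longrightarrow> J \<subseteq> I \<Longrightarrow> countable J \<Longrightarrow> Coz X f \<subseteq> \<Union>J \<Longrightarrow> f \<in> CP Lindelof_property X"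
  unfolding CP_altdef by auto

lemma CP_eq_Lindelof_support:
  "CP Lindelof_property X = {f \<in> Cb X. Lindelof_property (subtopology X (Supp X f))}"
proof (intro set_eqI iffI CollectI conjI)
  fix f :: "'a \<Rightarrow> 'k::real_normed_field" assume "f \<in> CP Lindelof_property X"
  then obtain J where J: "f \<in> Cb X" "J \<subseteq> I" "countable J" "Coz X f \<subseteq> \<Union>J" by (rule CP_E)
  then show "f \<in> Cb X" by simp
  have "Supp X f \<subseteq> \<Union>J"
    unfolding Supp_def using J by (simp add: closed_Union closure_of_minimal)
  moreover have "closedin X (Supp X f)" by (simp add: Supp_def)
  ultimately show "Lindelof_property (subtopology X (Supp X f))"
    using Lindelof_space_closedin_subtopology[OF Lindelof_Union[OF J(2,3)], of "Supp X f"]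
    unfolding Lindelof_property_iff
    by (simp add: subtopology_subtopology Int_absorb1 closedin_subset_topspace)
next
  fix f :: "'a \<Rightarrow> 'k::real_normed_field"
  assume f: "f \<in> {f \<in> Cb X. Lindelof_property (subtopology X (Supp X f))}"
  then obtain J where J: "J \<subseteq> I" "countable J" "Supp X f \<subseteq> \<Union>J"
    using Lindelof_subset_Union[of "Supp X f"] unfolding Lindelof_property_iff
    by (auto simp: Supp_def closure_of_subset_topspace)
  have "Coz X f \<subseteq> Supp X f" unfolding Supp_def by (simp add: Coz_subset closure_of_subset)
  with J(3) have "Coz X f \<subseteq> \<Union>J" by blast
  then show "f \<in> CP Lindelof_property X" using f J by (intro CP_I[of f J]) auto
qed

text \<open>The compact level sets \<open>S n\<close> are Lindelof, and countably many of them
  exhaust the cozero set.\<close>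

lemma C0_subset_CP: "C0 X \<subseteq> (CP Lindelof_property X :: ('a \<Rightarrow> 'k::real_normed_field) set)"
proof
  fix f :: "'a \<Rightarrow> 'k" assume f: "f \<in> C0 X"
  define S where "S n = {x \<in> topspace X. 1 / real (Suc n) \<le> norm (f x)}" for n
  have "\<exists>J\<subseteq>I. countable J \<and> S n \<subseteq> \<Union>J" for n
  proof -
    have "compactin X (S n)" using f unfolding C0_def S_def by auto
    then have "S n \<subseteq> topspace X" "Lindelof_space (subtopology X (S n))"
      by (auto simp: compactin_subspace compact_imp_Lindelof_space)
    then show ?thesis using Lindelof_subset_Union by metis
  qed
  then obtain J where J: "J n \<subseteq> I \<and> countable (J n) \<and> S n \<subseteq> \<Union>(J n)" for n by metis
  have "Coz X f \<subseteq> \<Union>(\<Union>n. J n)"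
  proof
    fix x assume x: "x \<in> Coz X f"
    then have "0 < norm (f x)" by (auto simp: Coz_def)
    then obtain n where "1 / real (Suc n) < norm (f x)"
      by (metis nat_approx_posE)
    then have "x \<in> S n" using x by (auto simp: S_def Coz_def)
    then show "x \<in> \<Union>(\<Union>n. J n)" using J[of n] by (metis UN_I UNIV_I Union_iff subsetD)
  qed
  then show "f \<in> CP Lindelof_property X"
    using f J by (intro CP_I[of f "\<Union>n. J n"]) (auto simp: C0_def)
qed

text \<open>The scalar type is left open because the same indicators serve as elements of the
  algebra and, real-valued, to separate closures in \<open>beta X\<close>.\<close>

definition ind :: "'a set set \<Rightarrow> 'a \<Rightarrow> 'k::real_normed_field" where
  "ind J x = (if x \<in> \<Union>J then 1 else 0)"

lemma Coz_ind: "J \<subseteq> I \<Longrightarrow> Coz X (ind J) = \<Union>J"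
  unfolding Coz_def ind_def using Union_subset by auto

lemma continuous_map_ind:
  assumes "J \<subseteq> I"
  shows "continuous_map X euclidean (ind J :: 'a \<Rightarrow> 'b::real_normed_field)"
  unfolding continuous_map_openin_preimage_eq
proof (intro conjI allI impI)
  fix U :: "'b set"
  have "topspace X \<inter> ind J -` U \<in> {topspace X, \<Union>J, topspace X - \<Union>J, {}}"
  proof -
    have "topspace X \<inter> ind J -` U = (if 1 \<in> U then \<Union>J else {}) \<union> (if 0 \<in> U then topspace X - \<Union>J else {})"
      unfolding ind_def using Union_subset[OF assms] by (auto split: if_splits)
    moreover have "\<Union>J \<union> (topspace X - \<Union>J) = topspace X" using Union_subset[OF assms] by blast
    ultimately show ?thesis by simp
  qed
  then show "openin X (topspace X \<inter> ind J -` U)"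
    using open_Union[OF assms] openin_diff[OF openin_topspace closed_Union[OF assms]] by auto
qed auto

lemma ind_in_Cb:
  assumes "J \<subseteq> I"
  shows "ind J \<in> Cb X"
  unfolding Cb_def
proof (intro CollectI conjI allI impI)
  have "ind J ` topspace X \<subseteq> {0, 1}" by (auto simp: ind_def)
  then show "bounded (ind J ` topspace X)" by (meson bounded_subset finite.emptyI finite_imp_bounded finite_insert)
qed (use continuous_map_ind[OF assms] Union_subset[OF assms] in \<open>auto simp: ind_def\<close>)

lemma ind_in_CP: "J \<subseteq> I \<Longrightarrow> countable J \<Longrightarrow> ind J \<in> CP Lindelof_property X"
  by (intro CP_I[of _ J] ind_in_Cb) (auto simp: Coz_ind)

text \<open>The witness is the indicator of \<open>\<Union>J\<close> for a countably infinite
  \<open>J\<close>: its level set at 1 is covered by infinitely many disjoint nonempty open members,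
  so it is not compact.\<close>

lemma C0_psubset_CP:
  assumes "\<not> Lindelof_property X"
  shows "C0 X \<subset> (CP Lindelof_property X :: ('a \<Rightarrow> 'k::real_normed_field) set)"
proof -
  have "infinite I" using assms Lindelof_iff_countable countable_finite unfolding Lindelof_property_iff' by blast
  then obtain J where J: "J \<subseteq> I" "countable J" "infinite J"
    by (meson infinite_countable_subset')
  have "(ind J :: 'a \<Rightarrow> 'k) \<notin> C0 X"
  proof
    assume "(ind J :: 'a \<Rightarrow> 'k) \<in> C0 X"
    then have "compactin X {x \<in> topspace X. 1 \<le> norm (ind J x :: 'k)}"
      unfolding C0_def by (elim CollectE conjE allE[of _ 1]) simp
    moreover have "{x \<in> topspace X. 1 \<le> norm (ind J x :: 'k)} = \<Union>J"
      using Union_subset[OF J(1)] by (auto simp: ind_def split: if_splits)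
    ultimately have "compactin X (\<Union>J)" by simp
    then obtain F where F: "finite F" "F \<subseteq> J" "\<Union>J \<subseteq> \<Union>F"
      using open_member J(1) unfolding compactin_def by (metis order_refl subsetD)
    have "J \<subseteq> F"
    proof
      fix C assume C: "C \<in> J"
      then obtain x where "x \<in> C" using nonempty_member J by blast
      then show "C \<in> F" using F C J same_member by (metis Union_iff subsetD)
    qed
    then show False using F J finite_subset by auto
  qed
  then show ?thesis using C0_subset_CP ind_in_CP[OF J(1,2)] by blast
qed

lemma subspace_CP: "funspace.subspace (CP Lindelof_property X :: ('a \<Rightarrow> 'k::real_normed_field) set)"
proof (rule funspace.subspaceI)
  show "(0 :: 'a \<Rightarrow> 'k) \<in> CP Lindelof_property X"
    by (intro CP_I[of _ "{}"] zero_in_Cb) (auto simp: Coz_def)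
next
  fix f g :: "'a \<Rightarrow> 'k" assume "f \<in> CP Lindelof_property X" "g \<in> CP Lindelof_property X"
  then obtain J K where "f \<in> Cb X" "J \<subseteq> I" "countable J" "Coz X f \<subseteq> \<Union>J"
      "g \<in> Cb X" "K \<subseteq> I" "countable K" "Coz X g \<subseteq> \<Union>K"
    by (meson CP_E)
  moreover have "Coz X (f + g) \<subseteq> Coz X f \<union> Coz X g" by (auto simp: Coz_def)
  ultimately show "f + g \<in> CP Lindelof_property X"
    by (intro CP_I[of _ "J \<union> K"] Cb_closed) auto
next
  fix c and f :: "'a \<Rightarrow> 'k" assume "f \<in> CP Lindelof_property X"
  then obtain J where "f \<in> Cb X" "J \<subseteq> I" "countable J" "Coz X f \<subseteq> \<Union>J"
    by (meson CP_E)
  then show "fscale c f \<in> CP Lindelof_property X"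
    by (intro CP_I[of _ J] Cb_closed) (auto simp: Coz_def fscale_def)
qed

lemma mult_CP:
  fixes f g :: "'a \<Rightarrow> 'k::real_normed_field"
  assumes "f \<in> CP Lindelof_property X" "g \<in> CP Lindelof_property X"
  shows "f * g \<in> CP Lindelof_property X"
proof -
  obtain J where "f \<in> Cb X" "J \<subseteq> I" "countable J" "Coz X f \<subseteq> \<Union>J"
    using assms(1) by (meson CP_E)
  moreover have "g \<in> Cb X" using assms(2) CP_E by auto
  ultimately show ?thesis
    by (intro CP_I[of _ J] Cb_closed) (auto simp: Coz_def)
qed

lemma Banach_subalgebra_CP:
  "Banach_subalgebra_Cb X (CP Lindelof_property X :: ('a \<Rightarrow> 'k::{real_normed_field,euclidean_space}) set)"
  unfolding Banach_subalgebra_Cb_def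
proof (intro conjI ballI allI impI subspace_CP mult_CP)
  show "(CP Lindelof_property X :: ('a \<Rightarrow> 'k) set) \<subseteq> Cb X" by (auto simp: CP_def)
next
  fix F :: "nat \<Rightarrow> 'a \<Rightarrow> 'k"
  assume asm: "(\<forall>n. F n \<in> CP Lindelof_property X) \<and>
     (\<forall>e>0. \<exists>N. \<forall>m\<ge>N. \<forall>n\<ge>N. sup_norm X (F m - F n) < e)"
  then have F: "F n \<in> CP Lindelof_property X" "F n \<in> Cb X" for n by (auto simp: CP_def)
  have le: "norm (F m x - F n x) \<le> sup_norm X (F m - F n)" if "x \<in> topspace X" for m n x
    using norm_le_sup_norm[OF CbD(2)[OF Cb_closed(2)[OF F(2) F(2)]] that] by simp
  have cau: "\<exists>N. \<forall>m\<ge>N. \<forall>n\<ge>N. \<forall>x\<in>topspace X. norm (F m x - F n x) < e" if "e > 0" for e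
    using asm le that by (meson le_less_trans)
  have "convergent (\<lambda>n. F n x)" if "x \<in> topspace X" for x
    unfolding Cauchy_convergent_iff[symmetric] Cauchy_def dist_norm using cau that by meson
  then obtain g where g: "(\<lambda>n. F n x) \<longlonglongrightarrow> g x" if "x \<in> topspace X" for x
    unfolding convergent_def by metis
  define f where "f x = (if x \<in> topspace X then g x else 0)" for x
  have f: "(\<lambda>n. F n x) \<longlonglongrightarrow> f x" if "x \<in> topspace X" for x
    using g that by (simp add: f_def)
  have unif: "\<exists>N. \<forall>n\<ge>N. \<forall>x\<in>topspace X. norm (F n x - f x) \<le> e" if e: "e > 0" for e
  proof -
    obtain N where N: "\<forall>m\<ge>N. \<forall>n\<ge>N. \<forall>x\<in>topspace X. norm (F m x - F n x) < e" using cau[OF e] by auto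
    have "norm (F n x - f x) \<le> e" if "n \<ge> N" "x \<in> topspace X" for n x
    proof (rule tendsto_upperbound)
      show "(\<lambda>m. norm (F n x - F m x)) \<longlonglongrightarrow> norm (F n x - f x)"
        by (intro tendsto_intros f that)
      show "\<forall>\<^sub>F m in sequentially. norm (F n x - F m x) \<le> e"
        unfolding eventually_sequentially using N that by (intro exI[of _ N]) (auto intro: less_imp_le)
    qed simp
    then show ?thesis by blast
  qed
  have cont: "continuous_map X euclidean f"
  proof -
    have "continuous_map X Met_TC.mtopology f"
    proof (rule Met_TC.continuous_map_uniform_limit[where F = sequentially and f = F])
      show "\<forall>\<^sub>F n in sequentially. continuous_map X Met_TC.mtopology (F n)"
        using CbD(1)[OF F(2)] by simp
      show "\<forall>\<^sub>F n in sequentially. \<forall>x\<in>topspace X. f x \<in> UNIV \<and> dist (F n x) (f x) < e" if "e > 0" for e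
        using unif[of "e / 2"] that unfolding eventually_sequentially dist_norm
        by (metis (no_types, opaque_lifting) UNIV_I field_sum_of_halves half_gt_zero less_add_same_cancel1 order_le_less_trans)
    qed auto
    then show ?thesis by simp
  qed
  obtain N where N: "\<forall>n\<ge>N. \<forall>x\<in>topspace X. norm (F n x - f x) \<le> 1" using unif[of 1] by auto
  have "norm (f x) \<le> 1 + sup_norm X (F N)" if "x \<in> topspace X" for x
  proof -
    have "norm (f x) \<le> norm (F N x - f x) + norm (F N x)"
      by (metis add.commute norm_minus_commute norm_triangle_sub)
    then show ?thesis
      using N that norm_le_sup_norm[OF CbD(2)[OF F(2)] that, of N] by (smt (verit) order_refl)
  qed
  then have "bounded (f ` topspace X)" unfolding bounded_iff by blast
  then have fCb: "f \<in> Cb X" using cont by (auto simp: Cb_def f_def)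
  \<comment> \<open>The limit vanishes wherever all \<open>F n\<close> vanish, so it lives on the
    union of the countably many countable families \<open>J n\<close>.\<close>
  obtain J where J: "\<And>n. J n \<subseteq> I \<and> countable (J n) \<and> Coz X (F n) \<subseteq> \<Union>(J n)"
    using F(1) unfolding CP_altdef mem_Collect_eq by metis
  have "Coz X f \<subseteq> \<Union>(\<Union>n. J n)"
  proof
    fix x assume x: "x \<in> Coz X f"
    show "x \<in> \<Union>(\<Union>n. J n)"
    proof (rule ccontr)
      assume "x \<notin> \<Union>(\<Union>n. J n)"
      then have "F n x = 0" for n
        using J[of n] x by (auto simp: Coz_def)
      then have "f x = 0" using f[of x] x by (simp add: Coz_def LIMSEQ_const_iff)
      then show False using x by (simp add: Coz_def)
    qed
  qed
  then have "f \<in> CP Lindelof_property X"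
    using J by (intro CP_I[of f "\<Union>n. J n"] fCb) auto
  moreover have "(\<lambda>n. sup_norm X (F n - f)) \<longlonglongrightarrow> 0"
  proof (rule LIMSEQ_I)
    fix e :: real assume "e > 0"
    then obtain N where N: "\<forall>n\<ge>N. \<forall>x\<in>topspace X. norm (F n x - f x) \<le> e / 2" using unif[of "e/2"] by auto
    have "norm (sup_norm X (F n - f) - 0) < e" if "n \<ge> N" for n
    proof -
      have "sup_norm X (F n - f) \<le> e / 2" using N that by (intro sup_norm_le nonempty) auto
      moreover have "0 \<le> sup_norm X (F n - f)"
        by (intro sup_norm_nonneg nonempty CbD(2)[OF Cb_closed(2)] F(2) fCb)
      ultimately show ?thesis using \<open>e > 0\<close> by auto
    qed
    then show "\<exists>N. \<forall>n\<ge>N. norm (sup_norm X (F n - f) - 0) < e" by blast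
  qed
  ultimately show "\<exists>f\<in>CP Lindelof_property X. (\<lambda>n. sup_norm X (F n - f)) \<longlonglongrightarrow> 0" by blast
qed

end

subsection \<open>The representing space\<close>

lemma beta_map_in_beta: "x \<in> topspace X \<Longrightarrow> beta_map X x \<in> topspace (beta X)"
  using closure_of_subset[OF beta_map_in_cube, of X] beta_map_in_cube[of X]
  by (auto simp: beta_def)

lemma continuous_map_eq_on_dense:
  assumes "continuous_map X Z f" "continuous_map X Z g" "Hausdorff_space Z"
    and "X closure_of S = topspace X" "\<And>x. x \<in> S \<Longrightarrow> f x = g x" "x \<in> topspace X"
  shows "f x = g x"
proof -
  have "closedin X {x \<in> topspace X. f x = g x}"
    using closedin_continuous_maps_eq[OF assms(3,1,2)] .
  then have "X closure_of (topspace X \<inter> S) \<subseteq> {x \<in> topspace X. f x = g x}"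
    using assms(5) by (intro closure_of_minimal) auto
  then show ?thesis using assms(4,6) closure_of_restrict[of X S] by auto
qed

lemma beta_extension_real:
  fixes f :: "'a \<Rightarrow> real"
  assumes c: "continuous_map X euclidean f" and b: "bounded (f ` topspace X)"
  shows "\<exists>g. continuous_map (beta X) euclidean g \<and> (\<forall>x\<in>topspace X. g (beta_map X x) = f x)"
proof -
  obtain B where B: "B > 0" "\<forall>x\<in>topspace X. \<bar>f x\<bar> \<le> B"
    using b by (auto simp: bounded_pos)
  \<comment> \<open>The affine map from \<open>[-B, B]\<close> onto \<open>[0, 1]\<close>; it is
    undone by \<open>2 * B * g z - B\<close>.\<close>
  have "continuous_map X euclidean (\<lambda>x. (f x + B) / (2 * B))"
    using c by (auto simp: continuous_map_atin limitin_canonical_iff intro!: tendsto_intros) (use B in auto)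
  moreover have "(f x + B) / (2 * B) \<in> {0..1}" if "x \<in> topspace X" for x
    using B(2)[rule_format, OF that] B(1) by (auto simp: field_simps abs_le_iff)
  ultimately have "continuous_map X (top_of_set {0..1}) (\<lambda>x. (f x + B) / (2 * B))"
    by (auto simp: continuous_map_in_subtopology)
  then obtain g where g: "continuous_map (beta X) (top_of_set {0..1}) g"
      "\<forall>x\<in>topspace X. g (beta_map X x) = (f x + B) / (2 * B)"
    using beta_extension by blast
  then have "continuous_map (beta X) euclidean g" by (simp add: continuous_map_in_subtopology)
  then have "continuous_map (beta X) euclidean (\<lambda>z. 2 * B * g z - B)"
    by (auto simp: continuous_map_atin limitin_canonical_iff intro!: tendsto_intros)
  then show ?thesis using g(2) B(1) by (intro exI[of _ "\<lambda>z. 2 * B * g z - B"]) auto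
qed

text \<open>The scalar type is not concretely real or complex, so coordinates with respect to
  \<open>Basis\<close> replace the real and imaginary parts.\<close>

lemma beta_extension_euclidean:
  fixes f :: "'a \<Rightarrow> 'k::euclidean_space"
  assumes c: "continuous_map X euclidean f" and b: "bounded (f ` topspace X)"
  shows "\<exists>g. continuous_map (beta X) euclidean g \<and> (\<forall>x\<in>topspace X. g (beta_map X x) = f x)"
proof -
  have "\<exists>g. continuous_map (beta X) euclidean g \<and> (\<forall>x\<in>topspace X. g (beta_map X x) = f x \<bullet> i)" for i
  proof (rule beta_extension_real)
    show "continuous_map X euclidean (\<lambda>x. f x \<bullet> i)"
      using c by (auto simp: continuous_map_atin limitin_canonical_iff intro!: tendsto_intros)
    have "bounded ((\<lambda>z. z \<bullet> i) ` f ` topspace X)"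
      by (intro bounded_linear_image b bounded_linear_inner_left)
    then show "bounded ((\<lambda>x. f x \<bullet> i) ` topspace X)" by (simp add: image_image)
  qed
  then obtain g where g: "\<And>i. continuous_map (beta X) euclidean (g i)"
      "\<And>i x. x \<in> topspace X \<Longrightarrow> g i (beta_map X x) = f x \<bullet> i" by metis
  have "continuous_map (beta X) euclidean (\<lambda>z. \<Sum>i\<in>Basis. g i z *\<^sub>R i)"
    using g(1) by (auto simp: continuous_map_atin limitin_canonical_iff intro!: tendsto_intros)
  then show ?thesis using g(2) by (intro exI[of _ "\<lambda>z. \<Sum>i\<in>Basis. g i z *\<^sub>R i"]) (auto simp: euclidean_representation)
qed

section \<open>Clopen subsets of \<open>beta X\<close> indexed by subsets of
  \<open>I\<close>\<close>

context Lindelof_partition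
begin

text \<open>On subsets of \<open>I\<close> this is a Boolean homomorphism into the clopen sets of
  \<open>beta X\<close>; \<open>E_disjoint\<close> is the one analytic step, and the rest is set
  algebra.\<close>

definition E :: "'a set set \<Rightarrow> (('a \<Rightarrow> real) \<Rightarrow> real) set" where
  "E J = beta X closure_of (beta_map X ` \<Union>J)"

lemma E_subset: "E J \<subseteq> topspace (beta X)"
  by (simp add: E_def closure_of_subset_topspace)

lemma E_mono: "J \<subseteq> K \<Longrightarrow> E J \<subseteq> E K"
  unfolding E_def by (intro closure_of_mono) auto

lemma E_Un: "E (J \<union> K) = E J \<union> E K"
  unfolding E_def by (simp add: image_Un closure_of_Un)

lemma E_empty: "E {} = {}"
  unfolding E_def by simp

lemma E_I: "E I = topspace (beta X)"
  unfolding E_def Union_members by (rule beta_dense)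

lemma closed_E: "closedin (beta X) (E J)"
  unfolding E_def by simp

lemma compact_E: "compactin (beta X) (E J)"
  using closed_E compact_space_beta closedin_compact_space by blast

text \<open>Disjoint open sets may share limit points. Here the indicator of
  \<open>\<Union>J\<close> is continuous, and its extension to \<open>beta X\<close> is 1 on
  \<open>E J\<close> and 0 on \<open>E K\<close>.\<close>

lemma E_disjoint:
  assumes "J \<subseteq> I" "K \<subseteq> I" "J \<inter> K = {}"
  shows "E J \<inter> E K = {}"
proof -
  obtain g where g: "continuous_map (beta X) euclidean g" "\<And>x. x \<in> topspace X \<Longrightarrow> g (beta_map X x) = (ind J x :: real)"
    using beta_extension_real[of X "ind J"] CbD(1,2)[OF ind_in_Cb[OF assms(1)]] by blast
  have cl: "closedin (beta X) {z \<in> topspace (beta X). g z = c}" for c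
    using closedin_continuous_map_preimage[OF g(1), of "{c}"] by simp
  have "E J \<subseteq> {z \<in> topspace (beta X). g z = 1}"
    unfolding E_def
  proof (intro closure_of_minimal cl image_subsetI CollectI conjI)
    fix x assume x: "x \<in> \<Union>J"
    then have "x \<in> topspace X" using Union_subset[OF assms(1)] by (rule rev_subsetD)
    with x show "beta_map X x \<in> topspace (beta X)" "g (beta_map X x) = 1"
      using g(2) by (simp_all only: beta_map_in_beta ind_def if_True)
  qed
  moreover have "ind J x = (0::real)" if "x \<in> \<Union>K" for x
    using that assms Union_Int[of J K] by (auto simp: ind_def)
  then have "E K \<subseteq> {z \<in> topspace (beta X). g z = 0}"
    unfolding E_def using g(2) Union_subset[OF assms(2)]
    by (intro closure_of_minimal cl image_subsetI CollectI conjI) (metis beta_map_in_beta subsetD)+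
  ultimately show ?thesis by fastforce
qed

lemma E_Diff:
  assumes "J \<subseteq> I" "K \<subseteq> I"
  shows "E (J - K) = E J - E K"
proof -
  have "E J = E (J - K) \<union> E (J \<inter> K)" by (metis E_Un Un_Diff_Int)
  moreover have "E (J \<inter> K) \<subseteq> E K" by (intro E_mono) auto
  moreover have "E (J - K) \<inter> E K = {}" using assms by (intro E_disjoint) auto
  ultimately show ?thesis by auto
qed

lemma E_Int:
  assumes "J \<subseteq> I" "K \<subseteq> I"
  shows "E (J \<inter> K) = E J \<inter> E K"
  using E_Diff[of J "J - K"] E_Diff[OF assms] assms E_subset[of J]
  by (metis Diff_Diff_Int Diff_subset order_trans)

lemma open_E:
  assumes "J \<subseteq> I"
  shows "openin (beta X) (E J)"
proof -
  have "E J = topspace (beta X) - E (I - J)"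
    using E_Diff[of I "I - J"] assms E_I by (simp add: double_diff)
  then show ?thesis using closed_E by (simp add: openin_diff)
qed

text \<open>Taking closures adds no point of \<open>X\<close>, since a point outside
  \<open>\<Union>J\<close> is sent into \<open>E (I - J)\<close>, which is disjoint from
  \<open>E J\<close>.\<close>

lemma beta_map_in_E:
  assumes "J \<subseteq> I" "x \<in> topspace X"
  shows "beta_map X x \<in> E J \<longleftrightarrow> x \<in> \<Union>J"
proof -
  have *: "beta_map X x \<in> E K" if "x \<in> \<Union>K" "K \<subseteq> I" for K
  proof -
    have "beta_map X ` \<Union>K \<subseteq> topspace (beta X)"
    proof (rule image_subsetI)
      fix x assume "x \<in> \<Union>K"
      with Union_subset[OF that(2)] have "x \<in> topspace X" by (rule subsetD)
      then show "beta_map X x \<in> topspace (beta X)" by (rule beta_map_in_beta)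
    qed
    from closure_of_subset[OF this] show ?thesis using that(1) unfolding E_def by blast
  qed
  show ?thesis
  proof
    assume "beta_map X x \<in> E J"
    then have "beta_map X x \<notin> E (I - J)" using E_Diff[OF subset_refl assms(1)] by auto
    then have "x \<notin> \<Union>(I - J)" using *[of "I - J"] by blast
    then show "x \<in> \<Union>J" using assms(2) Union_members by blast
  qed (use * assms in auto)
qed

definition Yset :: "(('a \<Rightarrow> real) \<Rightarrow> real) set" where
  "Yset = (\<Union>{E J |J. J \<subseteq> I \<and> countable J})"

lemma Yset_iff: "y \<in> Yset \<longleftrightarrow> (\<exists>J\<subseteq>I. countable J \<and> y \<in> E J)"
  unfolding Yset_def by auto

lemma E_subset_Yset: "J \<subseteq> I \<Longrightarrow> countable J \<Longrightarrow> E J \<subseteq> Yset"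
  unfolding Yset_def by auto

lemma Yset_subset: "Yset \<subseteq> topspace (beta X)"
  unfolding Yset_def using E_subset by auto

text \<open>Each set in the defining union lies in some \<open>E J\<close>, as a Lindelof closure
  meets countably many members. Conversely \<open>\<Union>J\<close> is the cozero set of its
  indicator, and \<open>E J\<close> is open, hence its own interior. The right-hand side shows that
  the space does not depend on the scalar field.\<close>

lemma lambda_eq: "lambda_P TYPE('k::real_normed_field) Lindelof_property X = subtopology (beta X) Yset"
proof -
  have "\<Union>{beta X interior_of (beta X closure_of (beta_map X ` C)) | C.
          C \<in> Coz_sets TYPE('k) X \<and> Lindelof_property (subtopology X (X closure_of C))} = Yset" (is "\<Union>?L = _")
  proof (intro equalityI subsetI)
    fix y assume "y \<in> \<Union>?L"
    then obtain f :: "'a \<Rightarrow> 'k" where C: "y \<in> beta X interior_of (beta X closure_of (beta_map X ` Coz X f))"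
      "Lindelof_space (subtopology X (X closure_of Coz X f))"
      unfolding Lindelof_property_iff by (auto simp: Coz_sets_def)
    obtain J where J: "J \<subseteq> I" "countable J" "X closure_of Coz X f \<subseteq> \<Union>J"
      using Lindelof_subset_Union[OF closure_of_subset_topspace C(2)] by auto
    have "Coz X f \<subseteq> \<Union>J" using J(3) closure_of_subset[OF Coz_subset] by fast
    then have "beta X closure_of (beta_map X ` Coz X f) \<subseteq> E J"
      unfolding E_def by (intro closure_of_mono) auto
    then have "y \<in> E J" using C(1) interior_of_subset by fastforce
    then show "y \<in> Yset" using J Yset_iff by auto
  next
    fix y assume "y \<in> Yset"
    then obtain J where J: "J \<subseteq> I" "countable J" "y \<in> E J" using Yset_iff by auto
    have "E J = beta X interior_of (beta X closure_of (beta_map X ` \<Union>J))"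
      using open_E[OF J(1)] by (simp add: E_def interior_of_openin)
    moreover have "\<Union>J \<in> Coz_sets TYPE('k) X"
      unfolding Coz_sets_def using Coz_ind[OF J(1), where ?'b = 'k, symmetric] ind_in_Cb[OF J(1)] by blast
    moreover have "Lindelof_property (subtopology X (X closure_of \<Union>J))"
      unfolding Lindelof_property_iff closure_Union[OF J(1)] using Lindelof_Union J by auto
    ultimately show "y \<in> \<Union>?L" using J(3) by blast
  qed
  then show ?thesis unfolding lambda_P_def by simp
qed

section \<open>Topology of the representing space\<close>

definition Y :: "(('a \<Rightarrow> real) \<Rightarrow> real) topology" where
  "Y = subtopology (beta X) Yset"

lemma topspace_Y: "topspace Y = Yset"
  unfolding Y_def using Yset_subset by auto

lemma open_Yset: "openin (beta X) Yset"
  unfolding Yset_def using open_E by (intro openin_Union) auto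

lemma beta_map_in_Y: "x \<in> topspace X \<Longrightarrow> beta_map X x \<in> Yset"
proof -
  assume x: "x \<in> topspace X"
  then obtain C where "C \<in> I" "x \<in> C" using Union_members by auto
  then have "beta_map X x \<in> E {C}" using x by (subst beta_map_in_E) auto
  then show ?thesis using \<open>C \<in> I\<close> Yset_iff[of "beta_map X x"] by (metis bot.extremum countable_empty countable_insert insert_subset)
qed

lemma Y_nonempty: "topspace Y \<noteq> {}"
  using beta_map_in_Y nonempty topspace_Y by blast

lemma Hausdorff_Y: "Hausdorff_space Y"
  unfolding Y_def by (simp add: Hausdorff_space_beta Hausdorff_space_subtopology)

lemma locally_compact_Y: "locally_compact_space Y"
  unfolding Y_def
proof (rule locally_compact_space_open_subset[OF _ _ open_Yset])
  show "locally_compact_space (beta X)"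
    using compact_space_beta[of X] unfolding compact_space_def locally_compact_space_def by blast
qed (simp add: Hausdorff_space_beta)

lemma E_in_Y:
  assumes "J \<subseteq> I" "countable J"
  shows "openin Y (E J)" "closedin Y (E J)" "compactin Y (E J)"
proof -
  have s: "E J \<subseteq> Yset" using assms by (rule E_subset_Yset)
  show "openin Y (E J)" unfolding Y_def using open_E[OF assms(1)] s openin_open_subtopology[OF open_Yset] by blast
  show "compactin Y (E J)" unfolding Y_def using compact_E s by (simp add: compactin_subtopology)
  show "closedin Y (E J)" unfolding Y_def using closed_E s closedin_subset_topspace by blast
qed

lemma Y_dense: "Y closure_of (beta_map X ` topspace X) = topspace Y"
proof -
  have "beta_map X ` topspace X \<subseteq> Yset" using beta_map_in_Y by auto
  then show ?thesis
    unfolding Y_def using beta_dense[of X] Yset_subset by (simp add: closure_of_subtopology Int_absorb1 Int_absorb2)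
qed

text \<open>The open sets \<open>E J\<close> with countable \<open>J\<close> are directed upwards,
  so a finite subcover collapses to a single one.\<close>

lemma compactin_Y_subset:
  assumes "compactin Y K"
  obtains J where "J \<subseteq> I" "countable J" "K \<subseteq> E J"
proof -
  have K: "K \<subseteq> Yset" using assms compactin_subset_topspace topspace_Y by blast
  then have "K \<subseteq> \<Union>(E ` {J. J \<subseteq> I \<and> countable J})" unfolding Yset_def by blast
  moreover have "\<forall>U \<in> E ` {J. J \<subseteq> I \<and> countable J}. openin Y U" using E_in_Y(1) by auto
  ultimately obtain F where F: "finite F" "F \<subseteq> E ` {J. J \<subseteq> I \<and> countable J}" "K \<subseteq> \<Union>F"
    using assms unfolding compactin_def by meson
  then obtain G where G: "finite G" "G \<subseteq> {J. J \<subseteq> I \<and> countable J}" "F = E ` G"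
    by (meson finite_subset_image)
  have "K \<subseteq> E (\<Union>G)" using F(3) unfolding G(3) by (rule order_trans) (auto intro: subsetD[OF E_mono, rotated])
  then show thesis using G countable_UN[OF countable_finite[OF G(1)], of "\<lambda>J. J"] by (intro that[of "\<Union>G"]) auto
qed

lemma countable_subset_E:
  assumes "countable S" "S \<subseteq> Yset"
  obtains J where "J \<subseteq> I" "countable J" "S \<subseteq> E J"
proof -
  obtain J where J: "J y \<subseteq> I \<and> countable (J y) \<and> y \<in> E (J y)" if "y \<in> S" for y
    using assms(2) Yset_iff by (metis subsetD)
  have "S \<subseteq> E (\<Union>y\<in>S. J y)"
  proof
    fix y assume y: "y \<in> S"
    then have "J y \<subseteq> (\<Union>y\<in>S. J y)" by blast
    from E_mono[OF this] J[OF y] show "y \<in> E (\<Union>y\<in>S. J y)" by blast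
  qed
  then show thesis using J assms(1) by (intro that[of "\<Union>y\<in>S. J y"]) auto
qed

text \<open>A countable cover has only countably many finite subfamilies. If each misses a point,
  the missed points lie in one compact \<open>E J\<close>, and a finite subfamily covering
  \<open>E J\<close> covers the very point it should miss.\<close>

lemma countably_compact_Y: "countably_compact_space Y"
  unfolding countably_compact_space_def
proof (intro allI impI, elim conjE)
  fix \<U> assume U: "countable \<U>" "\<forall>U\<in>\<U>. openin Y U" "\<Union>\<U> = topspace Y"
  show "\<exists>\<V>. finite \<V> \<and> \<V> \<subseteq> \<U> \<and> \<Union>\<V> = topspace Y"
  proof (rule ccontr)
    assume "\<not> ?thesis"
    then have no: "\<exists>y. y \<in> topspace Y \<and> y \<notin> \<Union>\<V>" if "finite \<V>" "\<V> \<subseteq> \<U>" for \<V>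
      using that U(3) by (metis Union_mono subsetI subset_antisym)
    obtain p where p: "p \<V> \<in> topspace Y \<and> p \<V> \<notin> \<Union>\<V>" if "finite \<V>" "\<V> \<subseteq> \<U>" for \<V>
      using no by metis
    define S where "S = p ` {\<V>. finite \<V> \<and> \<V> \<subseteq> \<U>}"
    have "countable S" "S \<subseteq> Yset"
      unfolding S_def using U(1) p topspace_Y by (auto simp: countable_Collect_finite_subset)
    then obtain J where J: "J \<subseteq> I" "countable J" "S \<subseteq> E J" by (rule countable_subset_E)
    have "E J \<subseteq> \<Union>\<U>" using U(3) E_subset_Yset[OF J(1,2)] topspace_Y by simp
    then obtain F where F: "finite F" "F \<subseteq> \<U>" "E J \<subseteq> \<Union>F"
      using E_in_Y(3)[OF J(1,2)] U(2) unfolding compactin_def by meson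
    then show False using p[OF F(1,2)] J(3) unfolding S_def by blast
  qed
qed

lemma Cc_Y_E:
  fixes g :: "(('a \<Rightarrow> real) \<Rightarrow> real) \<Rightarrow> 'k::real_normed_field"
  assumes "g \<in> Cc Y"
  obtains J where "J \<subseteq> I" "countable J" "Coz Y g \<subseteq> E J"
proof -
  have "compactin Y (Supp Y g)" using assms by (simp add: Cc_def)
  then obtain J where "J \<subseteq> I" "countable J" "Supp Y g \<subseteq> E J" by (rule compactin_Y_subset)
  moreover have "Coz Y g \<subseteq> Supp Y g" by (simp add: Supp_def Coz_subset closure_of_subset)
  ultimately show thesis using that by blast
qed

lemma Cc_Y_I:
  fixes g :: "(('a \<Rightarrow> real) \<Rightarrow> real) \<Rightarrow> 'k::real_normed_field"
  assumes "g \<in> Cb Y" "J \<subseteq> I" "countable J" "Coz Y g \<subseteq> E J"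
  shows "g \<in> Cc Y"
proof -
  have "Supp Y g \<subseteq> E J" unfolding Supp_def using assms E_in_Y(2) by (intro closure_of_minimal) auto
  then have "compactin Y (Supp Y g)"
    by (intro closed_compactin[OF E_in_Y(3)[OF assms(2,3)]]) (auto simp: Supp_def)
  then show ?thesis using assms(1) by (simp add: Cc_def)
qed

text \<open>In the direction from \<open>C0\<close> each level set is compact and so lies in some
  \<open>E (J n)\<close>; the set \<open>E\<close> of the union of all \<open>J n\<close> is still
  compact and contains the whole cozero set.\<close>

lemma Cc_eq_C0_Y: "(Cc Y :: ((('a \<Rightarrow> real) \<Rightarrow> real) \<Rightarrow> 'k::real_normed_field) set) = C0 Y"
proof (intro equalityI subsetI)
  fix g :: "(('a \<Rightarrow> real) \<Rightarrow> real) \<Rightarrow> 'k" assume g: "g \<in> Cc Y"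
  show "g \<in> C0 Y"
    unfolding C0_def
  proof (intro CollectI conjI allI impI)
    show "g \<in> Cb Y" using g by (simp add: Cc_def)
    fix e :: real assume e: "e > 0"
    have "continuous_map Y euclidean (\<lambda>y. norm (g y))"
      using CbD(1)[OF \<open>g \<in> Cb Y\<close>] by (rule continuous_map_norm)
    from closedin_continuous_map_preimage[OF this, of "{e..}"]
    have "closedin Y {x \<in> topspace Y. e \<le> norm (g x)}" by simp
    moreover have "{x \<in> topspace Y. e \<le> norm (g x)} \<subseteq> Coz Y g" using e by (auto simp: Coz_def)
    then have "{x \<in> topspace Y. e \<le> norm (g x)} \<subseteq> Supp Y g"
      unfolding Supp_def by (rule order_trans) (rule closure_of_subset[OF Coz_subset])
    ultimately show "compactin Y {x \<in> topspace Y. e \<le> norm (g x)}"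
      using g closed_compactin unfolding Cc_def by blast
  qed
next
  fix g :: "(('a \<Rightarrow> real) \<Rightarrow> real) \<Rightarrow> 'k" assume g: "g \<in> C0 Y"
  define S where "S n = {x \<in> topspace Y. 1 / real (Suc n) \<le> norm (g x)}" for n
  have "compactin Y (S n)" for n using g unfolding C0_def S_def by auto
  then have "\<exists>J\<subseteq>I. countable J \<and> S n \<subseteq> E J" for n using compactin_Y_subset[of "S n"] by metis
  then obtain J where J: "J n \<subseteq> I \<and> countable (J n) \<and> S n \<subseteq> E (J n)" for n by metis
  have "Coz Y g \<subseteq> E (\<Union>n. J n)"
  proof
    fix x assume x: "x \<in> Coz Y g"
    then have "0 < norm (g x)" by (auto simp: Coz_def)
    then obtain n where "1 / real (Suc n) < norm (g x)"
      by (metis nat_approx_posE)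
    then have "x \<in> S n" using x by (auto simp: S_def Coz_def)
    then show "x \<in> E (\<Union>n. J n)" using J[of n] E_mono[of "J n" "\<Union>n. J n"] by blast
  qed
  then show "g \<in> Cc Y"
    using g J by (intro Cc_Y_I[of g "\<Union>n. J n"]) (auto simp: C0_def)
qed

section \<open>Restriction from \<open>Y\<close> to \<open>X\<close>\<close>

definition res :: "((('a \<Rightarrow> real) \<Rightarrow> real) \<Rightarrow> 'k) \<Rightarrow> 'a \<Rightarrow> 'k::real_normed_field" where
  "res g x = (if x \<in> topspace X then g (beta_map X x) else 0)"

lemma continuous_beta_map_Y: "continuous_map X Y (beta_map X)"
proof -
  have "continuous_map X (beta X) (beta_map X)"
    using beta_embedding[OF completely_regular Hausdorff] 
    unfolding embedding_map_def using continuous_map_in_subtopology homeomorphic_imp_continuous_map by blast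
  then show ?thesis unfolding Y_def using beta_map_in_Y by (auto simp: continuous_map_in_subtopology)
qed

lemma res_in_CP:
  fixes g :: "(('a \<Rightarrow> real) \<Rightarrow> real) \<Rightarrow> 'k::real_normed_field"
  assumes g: "g \<in> Cc Y"
  shows "res g \<in> CP Lindelof_property X"
proof -
  have gb: "g \<in> Cb Y" using g by (simp add: Cc_def)
  obtain J where J: "J \<subseteq> I" "countable J" "Coz Y g \<subseteq> E J" using g by (rule Cc_Y_E)
  have "continuous_map X euclidean (g \<circ> beta_map X)"
    using continuous_beta_map_Y CbD(1)[OF gb] by (rule continuous_map_compose)
  then have c: "continuous_map X euclidean (res g)"
    by (rule continuous_map_eq) (simp add: res_def)
  have "res g ` topspace X \<subseteq> g ` topspace Y"
    using beta_map_in_Y topspace_Y by (auto simp: res_def)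
  then have "bounded (res g ` topspace X)" using CbD(2)[OF gb] bounded_subset by blast
  with c have "res g \<in> Cb X" unfolding Cb_def by (auto simp: res_def)
  moreover have "Coz X (res g) \<subseteq> \<Union>J"
  proof
    fix x assume x: "x \<in> Coz X (res g)"
    then have "beta_map X x \<in> Coz Y g" using beta_map_in_Y topspace_Y by (auto simp: Coz_def res_def)
    then have "beta_map X x \<in> E J" using J(3) by blast
    then show "x \<in> \<Union>J" using beta_map_in_E[OF J(1)] x by (auto simp: Coz_def)
  qed
  ultimately show ?thesis using J by (intro CP_I[of _ J]) auto
qed

lemma res_eq_imp_eq:
  fixes g h :: "(('a \<Rightarrow> real) \<Rightarrow> real) \<Rightarrow> 'k::real_normed_field"
  assumes "g \<in> Cb Y" "h \<in> Cb Y" "res g = res h"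
  shows "g = h"
proof
  fix y show "g y = h y"
  proof (cases "y \<in> topspace Y")
    case True
    show ?thesis
    proof (rule continuous_map_eq_on_dense[OF CbD(1)[OF assms(1)] CbD(1)[OF assms(2)] _ Y_dense _ True])
      fix z assume "z \<in> beta_map X ` topspace X"
      then obtain x where "x \<in> topspace X" "z = beta_map X x" by auto
      then show "g z = h z" using fun_cong[OF assms(3), of x] by (simp add: res_def)
    qed simp
  qed (use CbD(3) assms in metis)
qed

lemma sup_norm_res:
  fixes g :: "(('a \<Rightarrow> real) \<Rightarrow> real) \<Rightarrow> 'k::real_normed_field"
  assumes "g \<in> Cc Y"
  shows "sup_norm X (res g) = sup_norm Y g"
proof (rule antisym)
  have gb: "g \<in> Cb Y" using assms by (simp add: Cc_def)
  show "sup_norm X (res g) \<le> sup_norm Y g"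
  proof (rule sup_norm_le[OF nonempty])
    fix x assume "x \<in> topspace X"
    then show "norm (res g x) \<le> sup_norm Y g"
      using norm_le_sup_norm[OF CbD(2)[OF gb], of "beta_map X x"] beta_map_in_Y topspace_Y by (auto simp: res_def)
  qed
  have rb: "bounded (res g ` topspace X)" using res_in_CP[OF assms] CbD(2) by (auto simp: CP_def)
  show "sup_norm Y g \<le> sup_norm X (res g)"
  proof (rule sup_norm_le[OF Y_nonempty])
    fix y assume y: "y \<in> topspace Y"
    have "continuous_map Y euclidean (\<lambda>y. norm (g y))"
      using CbD(1)[OF gb] by (rule continuous_map_norm)
    from closedin_continuous_map_preimage[OF this, of "{..sup_norm X (res g)}"]
    have "closedin Y {y \<in> topspace Y. norm (g y) \<le> sup_norm X (res g)}" by simp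
    moreover have "norm (g (beta_map X x)) \<le> sup_norm X (res g)" if "x \<in> topspace X" for x
      using norm_le_sup_norm[OF rb that] that by (simp add: res_def)
    ultimately have "Y closure_of (beta_map X ` topspace X) \<subseteq> {y \<in> topspace Y. norm (g y) \<le> sup_norm X (res g)}"
      using beta_map_in_Y topspace_Y by (intro closure_of_minimal) auto
    then show "norm (g y) \<le> sup_norm X (res g)" using Y_dense y by auto
  qed
qed

text \<open>The extension of \<open>f\<close> to \<open>beta X\<close> vanishes on
  \<open>E (I - J)\<close>, because \<open>f\<close> vanishes on \<open>\<Union>(I - J)\<close>. Its
  part on \<open>Y\<close> is therefore supported in the compact set \<open>E J\<close>.\<close>

lemma res_surj:
  fixes f :: "'a \<Rightarrow> 'k::{real_normed_field,euclidean_space}"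
  assumes "f \<in> CP Lindelof_property X"
  shows "\<exists>g\<in>Cc Y. res g = f"
proof -
  obtain J where J: "f \<in> Cb X" "J \<subseteq> I" "countable J" "Coz X f \<subseteq> \<Union>J" using assms by (rule CP_E)
  obtain F where F: "continuous_map (beta X) euclidean F" "\<forall>x\<in>topspace X. F (beta_map X x) = f x"
    using beta_extension_euclidean[OF CbD(1,2)[OF J(1)]] by auto
  define g where "g y = (if y \<in> Yset then F y else 0)" for y
  have "continuous_map Y euclidean F" unfolding Y_def using F(1) by (rule continuous_map_from_subtopology)
  then have c: "continuous_map Y euclidean g" by (rule continuous_map_eq) (simp add: g_def topspace_Y)
  have "compactin euclidean (F ` topspace (beta X))"
    using image_compactin[OF _ F(1)] compact_space_beta compact_space_def by blast
  then have "bounded (F ` topspace (beta X))" by (simp add: compact_imp_bounded)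
  then have "bounded (g ` topspace Y)"
    by (rule bounded_subset) (use Yset_subset in \<open>auto simp: g_def topspace_Y\<close>)
  then have gb: "g \<in> Cb Y" using c by (auto simp: Cb_def g_def topspace_Y)
  have "closedin (beta X) {z \<in> topspace (beta X). F z = 0}"
    using closedin_continuous_map_preimage[OF F(1), of "{0}"] by simp
  moreover have "F (beta_map X x) = 0" if "x \<in> \<Union>(I - J)" for x
    using that F(2) J(4) Union_Diff[OF subset_refl J(2)] Union_members by (auto simp: Coz_def)
  moreover have "\<Union>(I - J) \<subseteq> topspace X" using Union_members by auto
  ultimately have "E (I - J) \<subseteq> {z \<in> topspace (beta X). F z = 0}"
    unfolding E_def using beta_map_in_beta[of _ X] by (intro closure_of_minimal) blast+
  then have "Coz Y g \<subseteq> E J"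
    using E_Diff[OF subset_refl J(2)] E_I Yset_subset by (auto simp: Coz_def g_def topspace_Y)
  then have "g \<in> Cc Y" using Cc_Y_I[OF gb J(2,3)] by simp
  moreover have "res g = f"
    using F(2) CbD(3)[OF J(1)] beta_map_in_Y by (auto simp: res_def g_def)
  ultimately show ?thesis by blast
qed

lemma bij_res: "bij_betw res (Cc Y) (CP Lindelof_property X :: ('a \<Rightarrow> 'k::{real_normed_field,euclidean_space}) set)"
proof -
  have "Cc Y \<subseteq> (Cb Y :: ((('a \<Rightarrow> real) \<Rightarrow> real) \<Rightarrow> 'k) set)" by (auto simp: Cc_def)
  then have "inj_on res (Cc Y :: ((('a \<Rightarrow> real) \<Rightarrow> real) \<Rightarrow> 'k) set)" by (meson inj_onI res_eq_imp_eq subsetD)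
  moreover have "res ` (Cc Y :: ((('a \<Rightarrow> real) \<Rightarrow> real) \<Rightarrow> 'k) set) = CP Lindelof_property X"
    using res_in_CP res_surj by (auto simp: image_iff)
  ultimately show ?thesis by (simp add: bij_betw_def)
qed

end

subsection \<open>Non-normality\<close>

text \<open>This is the first uncountable ordinal, taken as \<open>cardSuc natLeq\<close>, whose
  field consists of sets of naturals. The last clause says that it is the least uncountable
  cardinal, so that it embeds into any uncountable partition.\<close>

lemma ex_uncountable_wf_countable_segments:
  "\<exists>(W :: nat set set) lt. wf lt \<and> lt \<subseteq> W \<times> W \<and>
     (\<forall>x\<in>W. \<forall>y\<in>W. x \<noteq> y \<longrightarrow> (x, y) \<in> lt \<or> (y, x) \<in> lt) \<and>
     uncountable W \<and> (\<forall>x. countable {z. (z, x) \<in> lt}) \<and>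
     (\<forall>I :: 'b set. uncountable I \<longrightarrow> |W| \<le>o |I| )"
proof -
  define r where "r = cardSuc natLeq"
  have co: "Card_order r" unfolding r_def by (simp add: cardSuc_Card_order natLeq_Card_order)
  then have "Well_order r" by (rule Card_order_wo_rel[unfolded wo_rel_def])
  then have wo: "wf (r - Id)" "Total r"
    unfolding well_order_on_def linear_order_on_def partial_order_on_def preorder_on_def by auto
  have iso: "|Field r| =o r" using co by (rule card_of_Field_ordIso)
  have unc: "uncountable (Field r)"
  proof
    assume "countable (Field r)"
    then have "|Field r| \<le>o natLeq"
      by (simp add: countable_card_le_natLeq[symmetric])
    then have "r \<le>o natLeq" using iso ordIso_symmetric ordIso_ordLeq_trans by blast
    then show False
      unfolding r_def using cardSuc_greater[OF natLeq_Card_order] not_ordLess_ordLeq by blast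
  qed
  have cnt: "countable {z. (z, x) \<in> r - Id}" for x
  proof (cases "x \<in> Field r")
    case True
    have "|underS r x| <o r" using co True by (rule card_of_underS)
    then have "|underS r x| \<le>o natLeq"
      unfolding r_def using cardSuc_ordLess_ordLeq cardSuc_ordLeq_ordLess[OF natLeq_Card_order card_of_Card_order] by blast
    then have "countable (underS r x)"
      by (simp add: countable_card_le_natLeq[symmetric])
    then show ?thesis by (rule countable_subset[rotated]) (auto simp: underS_def)
  next
    case False
    then have "{z. (z, x) \<in> r - Id} = {}" by (auto simp: Field_def)
    then show ?thesis by (simp only: countable_empty)
  qed
  have le: "|Field r| \<le>o |I|" if "uncountable I" for I :: "'b set"
  proof -
    have "\<not> |I| \<le>o natLeq"
      using that by (simp add: countable_card_le_natLeq[symmetric])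
    then have "natLeq <o |I|"
      using not_ordLeq_iff_ordLess natLeq_Well_order card_of_Well_order by blast
    then have "r \<le>o |I|" unfolding r_def using cardSuc_ordLess_ordLeq natLeq_Card_order card_of_Card_order by blast
    then show ?thesis using iso ordIso_ordLeq_trans by blast
  qed
  have sub: "r - Id \<subseteq> Field r \<times> Field r" by (auto simp: Field_def)
  have tot: "\<forall>x\<in>Field r. \<forall>y\<in>Field r. x \<noteq> y \<longrightarrow> (x, y) \<in> r - Id \<or> (y, x) \<in> r - Id"
    using wo(2) unfolding total_on_def by auto
  show ?thesis
    using wo(1) sub tot unc cnt le by (intro exI[of _ "Field r"] exI[of _ "r - Id"] conjI allI impI) auto
qed

text \<open>At stage \<open>x\<close> the countable segment below \<open>x\<close> is cut into blocks, block \<open>n\<close> consisting of the \<open>z \<le> s n\<close>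
  that lie in no earlier block.  Copying the earlier function of \<open>s n\<close> on block \<open>n\<close> gives coherence,
  and raising it to at least \<open>n\<close> there, a finite change, keeps the result finite-to-one.\<close>

lemma ex_coherent_finite_to_one:
  fixes lt :: "'w rel"
  assumes wf: "wf lt" and sub: "lt \<subseteq> W \<times> W"
    and tot: "\<And>x y. x \<in> W \<Longrightarrow> y \<in> W \<Longrightarrow> x \<noteq> y \<Longrightarrow> (x, y) \<in> lt \<or> (y, x) \<in> lt"
    and cnt: "\<And>x. countable {z. (z, x) \<in> lt}"
  shows "\<exists>e :: 'w \<Rightarrow> 'w \<Rightarrow> nat. \<forall>x. (\<forall>k. finite {z. (z, x) \<in> lt \<and> e x z \<le> k}) \<and>
           (\<forall>y. (y, x) \<in> lt \<longrightarrow> finite {z. (z, y) \<in> lt \<and> e y z \<noteq> e x z})"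
proof (rule dependent_wf_choice[OF wf])
  fix f g :: "'w \<Rightarrow> 'w \<Rightarrow> nat" and x r
  assume "\<And>z. (z, x) \<in> lt \<Longrightarrow> f z = g z"
  then show "((\<forall>k. finite {z. (z, x) \<in> lt \<and> r z \<le> k}) \<and>
           (\<forall>y. (y, x) \<in> lt \<longrightarrow> finite {z. (z, y) \<in> lt \<and> f y z \<noteq> r z})) =
        ((\<forall>k. finite {z. (z, x) \<in> lt \<and> r z \<le> k}) \<and>
           (\<forall>y. (y, x) \<in> lt \<longrightarrow> finite {z. (z, y) \<in> lt \<and> g y z \<noteq> r z}))" by simp
next
  fix x and f :: "'w \<Rightarrow> 'w \<Rightarrow> nat"
  assume IH: "\<And>y. (y, x) \<in> lt \<Longrightarrow> (\<forall>k. finite {z. (z, y) \<in> lt \<and> f y z \<le> k}) \<and>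
           (\<forall>u. (u, y) \<in> lt \<longrightarrow> finite {z. (z, u) \<in> lt \<and> f u z \<noteq> f y z})"
  define S where "S = {z. (z, x) \<in> lt}"
  show "\<exists>r. (\<forall>k. finite {z. (z, x) \<in> lt \<and> r z \<le> k}) \<and>
           (\<forall>y. (y, x) \<in> lt \<longrightarrow> finite {z. (z, y) \<in> lt \<and> f y z \<noteq> r z})"
  proof (cases "S = {}")
    case True
    then show ?thesis by (auto simp: S_def)
  next
    case False
    \<comment> \<open>The enumeration repeats elements if \<open>S\<close> is finite; this does no
      harm, because blocks are formed with the least index.\<close>
    define s where "s = from_nat_into S"
    have s: "range s = S" unfolding s_def using False cnt by (simp add: S_def range_from_nat_into)
    have sx: "(s m, x) \<in> lt" for m using s unfolding S_def by auto
    define n where "n z = (LEAST n. z = s n \<or> (z, s n) \<in> lt)" for z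
    have n: "z = s (n z) \<or> (z, s (n z)) \<in> lt" if "z = s m \<or> (z, s m) \<in> lt" for z m
      unfolding n_def using that by (rule LeastI)
    have nle: "n z \<le> m" if "z = s m \<or> (z, s m) \<in> lt" for z m
      unfolding n_def using that by (rule Least_le)
    \<comment> \<open>The value 0 concerns only \<open>z = s (n z)\<close>, the top of its block,
      where the earlier function of \<open>s (n z)\<close> is not controlled. There is at most one
      such point in each block.\<close>
    define r where "r z = max (n z) (if (z, s (n z)) \<in> lt then f (s (n z)) z else 0)" for z
    have fin: "finite {z. (z, s m) \<in> lt \<and> f (s m) z \<le> k}" for m k using IH[OF sx] by blast
    have "finite {z. (z, x) \<in> lt \<and> r z \<le> k}" for k
    proof (rule finite_subset)
      \<comment> \<open>Since \<open>r z\<close> is at least \<open>n z\<close>, only the blocks up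
        to \<open>k\<close> contribute.\<close>
      show "{z. (z, x) \<in> lt \<and> r z \<le> k} \<subseteq> (\<Union>m\<le>k. {s m} \<union> {z. (z, s m) \<in> lt \<and> f (s m) z \<le> k})"
      proof clarify
        fix z assume z: "(z, x) \<in> lt" "r z \<le> k"
        then obtain m where "z = s m" using s unfolding S_def by auto
        then have "z = s (n z) \<or> (z, s (n z)) \<in> lt" using n by blast
        moreover have "n z \<le> k" using z(2) unfolding r_def by simp
        moreover have "(z, s (n z)) \<in> lt \<longrightarrow> f (s (n z)) z \<le> k" using z(2) unfolding r_def by (simp split: if_splits)
        ultimately show "z \<in> (\<Union>m\<le>k. {s m} \<union> {z. (z, s m) \<in> lt \<and> f (s m) z \<le> k})" by blast
      qed
    qed (use fin in auto)
    moreover have "finite {z. (z, y) \<in> lt \<and> f y z \<noteq> r z}" if y: "(y, x) \<in> lt" for y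
    proof -
      obtain m where m: "y = s m" using y s unfolding S_def by auto
      \<comment> \<open>In block \<open>i\<close> there are three sources of disagreement with
        \<open>f y\<close>: the top point, values raised to \<open>i\<close>, and places where
        \<open>s i\<close> and \<open>y\<close> already disagree. Each accounts for finitely many
        points.\<close>
      let ?T = "\<lambda>i. {s i} \<union> {z. (z, s i) \<in> lt \<and> f (s i) z \<le> i} \<union>
                       {z. (z, s i) \<in> lt \<and> (z, y) \<in> lt \<and> f (s i) z \<noteq> f y z}"
      have "{z. (z, y) \<in> lt \<and> f y z \<noteq> r z} \<subseteq> (\<Union>i\<le>m. ?T i)"
      proof clarify
        fix z assume z: "(z, y) \<in> lt" "f y z \<noteq> r z"
        have 1: "n z \<le> m" using nle z(1) unfolding m by blast
        have 2: "z = s (n z) \<or> (z, s (n z)) \<in> lt" using n z(1) unfolding m by blast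
        have "z \<in> ?T (n z)"
        proof (cases "z = s (n z)")
          case False
          then have l: "(z, s (n z)) \<in> lt" using 2 by simp
          then have "r z = max (n z) (f (s (n z)) z)" unfolding r_def by simp
          then show ?thesis using z l by (cases "f (s (n z)) z \<le> n z") auto
        qed simp
        then show "z \<in> (\<Union>i\<le>m. ?T i)" using 1 by blast
      qed
      moreover have "finite {z. (z, s i) \<in> lt \<and> (z, y) \<in> lt \<and> f (s i) z \<noteq> f y z}" for i
      proof -
        have "s i \<in> W" "y \<in> W" using sx[of i] y sub by auto
        then consider "s i = y" | "(s i, y) \<in> lt" | "(y, s i) \<in> lt" using tot by blast
        then show ?thesis
        proof cases
          case 1
          then show ?thesis by simp
        next
          case 2
          then have "finite {z. (z, s i) \<in> lt \<and> f (s i) z \<noteq> f y z}" using IH[OF y] by blast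
          then show ?thesis by (rule finite_subset[rotated]) auto
        next
          case 3
          then have "finite {z. (z, y) \<in> lt \<and> f y z \<noteq> f (s i) z}" using IH[OF sx] by blast
          then show ?thesis by (rule finite_subset[rotated]) auto
        qed
      qed
      then have "finite (\<Union>i\<le>m. ?T i)" using fin by auto
      ultimately show ?thesis by (rule finite_subset)
    qed
    ultimately show ?thesis by (intro exI[of _ r]) auto
  qed
qed

section \<open>Limit points outside the closures of single members\<close>

context Lindelof_partition
begin

text \<open>Outside this open set finite changes of \<open>J\<close> cannot be seen in
  \<open>E J\<close>, which is why coherence up to finite sets suffices.\<close>

definition Oset :: "(('a \<Rightarrow> real) \<Rightarrow> real) set" where
  "Oset = (\<Union>C\<in>I. E {C})"

lemma open_Oset: "openin (beta X) Oset"
  unfolding Oset_def using open_E by (intro openin_Union) auto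

lemma E_finite_subset_Oset: "finite S \<Longrightarrow> S \<subseteq> I \<Longrightarrow> E S \<subseteq> Oset"
proof (induction S rule: finite_induct)
  case (insert C S)
  have "E (insert C S) = E {C} \<union> E S" using E_Un[of "{C}" S] by simp
  then show ?case using insert by (auto simp: Oset_def)
qed (simp add: E_empty)

text \<open>Otherwise compactness would cover the closure of the chosen points by finitely many sets
  \<open>E {C}\<close>, but each of these contains the chosen point of its own \<open>C\<close>
  only.\<close>

lemma ex_accumulation_point:
  assumes S: "S \<subseteq> I" "infinite S" and b: "\<And>C. C \<in> I \<Longrightarrow> b C \<in> C"
  shows "\<exists>y. y \<in> E S - Oset \<and> y \<in> beta X closure_of (beta_map X ` b ` S)"
proof (rule ccontr)
  let ?P = "beta_map X ` b ` S"
  have "b ` S \<subseteq> \<Union>S" using b S(1) by blast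
  then have "beta X closure_of ?P \<subseteq> E S" unfolding E_def by (intro closure_of_mono image_mono)
  moreover assume "\<not> ?thesis"
  ultimately have "beta X closure_of ?P \<subseteq> \<Union>((\<lambda>C. E {C}) ` I)" unfolding Oset_def by blast
  moreover have "\<forall>U \<in> (\<lambda>C. E {C}) ` I. openin (beta X) U" using open_E by auto
  moreover have "compactin (beta X) (beta X closure_of ?P)"
    using compact_space_beta closedin_compact_space closedin_closure_of by metis
  ultimately obtain \<V> where V: "finite \<V>" "\<V> \<subseteq> (\<lambda>C. E {C}) ` I" "beta X closure_of ?P \<subseteq> \<Union>\<V>"
    unfolding compactin_def by meson
  then obtain F where F: "finite F" "F \<subseteq> I" "beta X closure_of ?P \<subseteq> (\<Union>C\<in>F. E {C})"
    by (metis finite_subset_image)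
  have bX: "b C \<in> topspace X" if "C \<in> I" for C using b[OF that] that Union_members by blast
  have "?P \<subseteq> topspace (beta X)" 
    using bX S(1) by (auto intro!: beta_map_in_beta)
  then have sub: "?P \<subseteq> (\<Union>C\<in>F. E {C})" using closure_of_subset F(3) by (metis order_trans)
  have "S \<subseteq> F"
  proof
    fix C assume C: "C \<in> S"
    then have CI: "C \<in> I" using S by blast
    obtain D where D: "D \<in> F" "beta_map X (b C) \<in> E {D}" using sub C by blast
    then have "b C \<in> D" using beta_map_in_E[of "{D}" "b C"] bX[OF CI] F(2) by auto
    then show "C \<in> F" using same_member[OF CI _ b[OF CI]] D(1) F(2) by blast
  qed
  then show False using F(1) S(2) finite_subset by blast
qed

text \<open>\<open>A \<alpha>\<close> and \<open>B \<alpha>\<close> are the parts of the segment \<open>\<alpha> \<times> \<nat>\<close> (copied into \<open>I\<close> by \<open>c\<close>) under and above the graph of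
  the \<open>\<alpha>\<close>-th function of the coherent family.  Coherence makes their limit sets, the \<open>E (A \<alpha>)\<close> and the \<open>E (B \<alpha>)\<close>
  outside all the \<open>E {C}\<close>, closed and disjoint.  An open set separating these would give a function on \<open>W\<close>
  which on each segment dominates the family up to finitely many places; being constant on an uncountable
  set, it contradicts that the family is finite-to-one.\<close>

lemma not_normal_Y:
  assumes unc: "uncountable I"
  shows "\<not> normal_space Y"
proof
  assume normal: "normal_space Y"
  obtain W :: "nat set set" and lt where wf: "wf lt" and sub: "lt \<subseteq> W \<times> W"
    and tot: "\<And>x y. x \<in> W \<Longrightarrow> y \<in> W \<Longrightarrow> x \<noteq> y \<Longrightarrow> (x, y) \<in> lt \<or> (y, x) \<in> lt"
    and uncW: "uncountable W" and cnt: "\<And>x. countable {z. (z, x) \<in> lt}"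
    and WI: "|W| \<le>o |I|"
    using ex_uncountable_wf_countable_segments[where ?'b = "'a set"] unc by metis
  obtain e :: "nat set \<Rightarrow> nat set \<Rightarrow> nat" where e: "\<And>x k. finite {z. (z, x) \<in> lt \<and> e x z \<le> k}"
      "\<And>x y. (y, x) \<in> lt \<Longrightarrow> finite {z. (z, y) \<in> lt \<and> e y z \<noteq> e x z}"
    using ex_coherent_finite_to_one[OF wf sub tot cnt] by blast
  have "|W \<times> (UNIV :: nat set)| \<le>o |W|"
  proof -
    have "infinite W" using uncW countable_finite by blast
    moreover have "|UNIV :: nat set| \<le>o |W|" using \<open>infinite W\<close> infinite_iff_card_of_nat by blast
    ultimately show ?thesis using card_of_Times_infinite_simps(1) ordIso_iff_ordLeq by blast
  qed
  then have "|W \<times> (UNIV :: nat set)| \<le>o |I|" using WI ordLeq_transitive by blast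
  then obtain c :: "nat set \<times> nat \<Rightarrow> 'a set" where c: "inj_on c (W \<times> UNIV)" "c ` (W \<times> UNIV) \<subseteq> I"
    unfolding card_of_ordLeq[symmetric] by blast
  have coh: "finite {z. (z, x) \<in> lt \<and> (z, y) \<in> lt \<and> e x z \<noteq> e y z}" if "x \<in> W" "y \<in> W" for x y
  proof -
    consider "x = y" | "(x, y) \<in> lt" | "(y, x) \<in> lt" 
      using tot \<open>x \<in> W\<close> \<open>y \<in> W\<close> by blast
    then show ?thesis
    proof cases
      case 2
      show ?thesis by (rule finite_subset[OF _ e(2)[OF 2]]) auto
    next
      case 3
      show ?thesis by (rule finite_subset[OF _ e(2)[OF 3]]) auto
    qed simp
  qed
  \<comment> \<open>Uncountable cofinality: without a bound, \<open>W\<close> would be a countable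
    union of countable segments.\<close>
  have bound: "\<exists>\<alpha>\<in>W. \<forall>\<xi>\<in>S. (\<xi>, \<alpha>) \<in> lt" if S: "countable S" "S \<subseteq> W" for S
  proof (rule ccontr)
    assume no: "\<not> ?thesis"
    have "W \<subseteq> (\<Union>\<xi>\<in>S. insert \<xi> {z. (z, \<xi>) \<in> lt})"
    proof
      fix \<alpha> assume "\<alpha> \<in> W"
      then obtain \<xi> where "\<xi> \<in> S" "(\<xi>, \<alpha>) \<notin> lt" using no by blast
      then show "\<alpha> \<in> (\<Union>\<xi>\<in>S. insert \<xi> {z. (z, \<xi>) \<in> lt})" using tot[of \<xi> \<alpha>] \<open>\<alpha> \<in> W\<close> S(2) by blast
    qed
    moreover have "countable (\<Union>\<xi>\<in>S. insert \<xi> {z. (z, \<xi>) \<in> lt})" using S(1) cnt by auto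
    ultimately show False using uncW countable_subset by blast
  qed
  define K where "K \<alpha> = c ` ({\<xi>. (\<xi>, \<alpha>) \<in> lt} \<times> UNIV)" for \<alpha>
  define A where "A \<alpha> = c ` {(\<xi>, n). (\<xi>, \<alpha>) \<in> lt \<and> n \<le> e \<alpha> \<xi>}" for \<alpha>
  define B where "B \<alpha> = c ` {(\<xi>, n). (\<xi>, \<alpha>) \<in> lt \<and> e \<alpha> \<xi> < n}" for \<alpha>
  have AK: "A \<alpha> \<subseteq> K \<alpha>" and BK: "B \<alpha> \<subseteq> K \<alpha>" for \<alpha> unfolding A_def B_def K_def by auto
  have KI: "K \<alpha> \<subseteq> I" for \<alpha> using c(2) sub unfolding K_def by blast
  have cK: "countable (K \<alpha>)" for \<alpha> unfolding K_def using cnt by auto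
  have ABdisj: "A \<alpha> \<inter> B \<alpha> = {}" for \<alpha>
  proof -
    have "{(\<xi>, n). (\<xi>, \<alpha>) \<in> lt \<and> n \<le> e \<alpha> \<xi>} \<subseteq> W \<times> UNIV" "{(\<xi>, n). (\<xi>, \<alpha>) \<in> lt \<and> e \<alpha> \<xi> < n} \<subseteq> W \<times> UNIV"
      using sub by auto
    from inj_on_image_Int[OF c(1) this]
    have "A \<alpha> \<inter> B \<alpha> = c ` ({(\<xi>, n). (\<xi>, \<alpha>) \<in> lt \<and> n \<le> e \<alpha> \<xi>} \<inter> {(\<xi>, n). (\<xi>, \<alpha>) \<in> lt \<and> e \<alpha> \<xi> < n})"
      unfolding A_def B_def by simp
    also have "\<dots> = {}" by auto
    finally show ?thesis .
  qed
  have diff: "finite {(\<xi>, n). (\<xi>, \<alpha>) \<in> lt \<and> (\<xi>, \<gamma>) \<in> lt \<and> n \<le> e \<alpha> \<xi> \<and> e \<gamma> \<xi> < n}" if "\<alpha> \<in> W" "\<gamma> \<in> W" for \<alpha> \<gamma>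
  proof (rule finite_subset)
    show "{(\<xi>, n). (\<xi>, \<alpha>) \<in> lt \<and> (\<xi>, \<gamma>) \<in> lt \<and> n \<le> e \<alpha> \<xi> \<and> e \<gamma> \<xi> < n}
        \<subseteq> Sigma {\<xi>. (\<xi>, \<alpha>) \<in> lt \<and> (\<xi>, \<gamma>) \<in> lt \<and> e \<alpha> \<xi> \<noteq> e \<gamma> \<xi>} (\<lambda>\<xi>. {..e \<alpha> \<xi>})" by auto
  qed (intro finite_SigmaI coh that, simp)
  have cinj: "p = q" if "c p = c q" "fst p \<in> W" "fst q \<in> W" for p q
    using inj_onD[OF c(1) that(1)] that(2,3) by (cases p; cases q) auto
  have ltW: "\<xi> \<in> W" if "(\<xi>, \<alpha>) \<in> lt" for \<xi> \<alpha> using that sub by auto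
  have finA: "finite (A \<gamma> \<inter> K \<alpha> - A \<alpha>)" if "\<alpha> \<in> W" "\<gamma> \<in> W" for \<alpha> \<gamma>
  proof (rule finite_subset[OF _ finite_imageI[OF diff[OF that(2,1)]]])
    show "A \<gamma> \<inter> K \<alpha> - A \<alpha> \<subseteq> c ` {(\<xi>, n). (\<xi>, \<gamma>) \<in> lt \<and> (\<xi>, \<alpha>) \<in> lt \<and> n \<le> e \<gamma> \<xi> \<and> e \<alpha> \<xi> < n}"
    proof
      fix C assume C: "C \<in> A \<gamma> \<inter> K \<alpha> - A \<alpha>"
      then obtain \<xi> n where 1: "C = c (\<xi>, n)" "(\<xi>, \<gamma>) \<in> lt" "n \<le> e \<gamma> \<xi>" unfolding A_def by auto
      obtain \<xi>' n' where 2: "C = c (\<xi>', n')" "(\<xi>', \<alpha>) \<in> lt" using C unfolding K_def by auto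
      have eq: "\<xi>' = \<xi>" "n' = n" using cinj[of "(\<xi>', n')" "(\<xi>, n)"] 1 2 ltW by auto
      have "\<not> n \<le> e \<alpha> \<xi>" using C 1(1) 2(2) eq unfolding A_def by blast
      then show "C \<in> c ` {(\<xi>, n). (\<xi>, \<gamma>) \<in> lt \<and> (\<xi>, \<alpha>) \<in> lt \<and> n \<le> e \<gamma> \<xi> \<and> e \<alpha> \<xi> < n}"
        using 1 2 eq by auto
    qed
  qed
  have finB: "finite (B \<gamma> \<inter> K \<alpha> - B \<alpha>)" if "\<alpha> \<in> W" "\<gamma> \<in> W" for \<alpha> \<gamma>
  proof (rule finite_subset[OF _ finite_imageI[OF diff[OF that]]])
    show "B \<gamma> \<inter> K \<alpha> - B \<alpha> \<subseteq> c ` {(\<xi>, n). (\<xi>, \<alpha>) \<in> lt \<and> (\<xi>, \<gamma>) \<in> lt \<and> n \<le> e \<alpha> \<xi> \<and> e \<gamma> \<xi> < n}"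
    proof
      fix C assume C: "C \<in> B \<gamma> \<inter> K \<alpha> - B \<alpha>"
      then obtain \<xi> n where 1: "C = c (\<xi>, n)" "(\<xi>, \<gamma>) \<in> lt" "e \<gamma> \<xi> < n" unfolding B_def by auto
      obtain \<xi>' n' where 2: "C = c (\<xi>', n')" "(\<xi>', \<alpha>) \<in> lt" using C unfolding K_def by auto
      have eq: "\<xi>' = \<xi>" "n' = n" using cinj[of "(\<xi>', n')" "(\<xi>, n)"] 1 2 ltW by auto
      have "\<not> e \<alpha> \<xi> < n" using C 1(1) 2(2) eq unfolding B_def by blast
      then show "C \<in> c ` {(\<xi>, n). (\<xi>, \<alpha>) \<in> lt \<and> (\<xi>, \<gamma>) \<in> lt \<and> n \<le> e \<alpha> \<xi> \<and> e \<gamma> \<xi> < n}"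
        using 1 2 eq by auto
    qed
  qed
  define lim where "lim T = (\<Union>\<gamma>\<in>W. E (T \<gamma>)) - Oset" for T :: "nat set \<Rightarrow> 'a set set"
  \<comment> \<open>Only countably many first coordinates occur in \<open>J\<close>, and a single
    \<open>\<alpha>\<close> lies above all of them.\<close>
  have cover: "\<exists>\<alpha>\<in>W. \<forall>\<gamma>\<in>W. J \<inter> K \<gamma> \<subseteq> K \<alpha>" if J: "countable J" for J
  proof -
    let ?S = "{\<xi> \<in> W. \<exists>n. c (\<xi>, n) \<in> J}"
    have "?S \<subseteq> fst ` (the_inv_into (W \<times> UNIV) c) ` J"
    proof
      fix \<xi> assume "\<xi> \<in> ?S"
      then obtain n where "\<xi> \<in> W" "c (\<xi>, n) \<in> J" by blast
      moreover from this have "the_inv_into (W \<times> UNIV) c (c (\<xi>, n)) = (\<xi>, n)"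
        using the_inv_into_f_f[OF c(1)] by simp
      ultimately show "\<xi> \<in> fst ` (the_inv_into (W \<times> UNIV) c) ` J" by (metis fst_conv imageI)
    qed
    then have "countable ?S" using J by (meson countable_image countable_subset)
    then obtain \<alpha> where a: "\<alpha> \<in> W" "\<forall>\<xi>\<in>?S. (\<xi>, \<alpha>) \<in> lt" using bound[of ?S] by auto
    have "J \<inter> K \<gamma> \<subseteq> K \<alpha>" if "\<gamma> \<in> W" for \<gamma>
    proof
      fix C assume C: "C \<in> J \<inter> K \<gamma>"
      then obtain \<xi> n where 1: "C = c (\<xi>, n)" "(\<xi>, \<gamma>) \<in> lt" unfolding K_def by auto
      then have "\<xi> \<in> ?S" using C ltW by auto
      then show "C \<in> K \<alpha>" using a(2) 1 unfolding K_def by auto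
    qed
    then show ?thesis using a(1) by blast
  qed
  \<comment> \<open>Inside \<open>E J\<close> the uncountable union in \<open>lim T\<close> reduces
    to one stage: every other \<open>T \<gamma>\<close> exceeds \<open>T \<alpha>\<close> there by a
    finite set, which \<open>Oset\<close> absorbs. Closedness and disjointness of the limit sets can
    thus be checked at one stage.\<close>
  have limE: "lim T \<inter> E J = E (T \<alpha> \<inter> J) - Oset"
    if J: "J \<subseteq> I" and T: "\<And>\<gamma>. T \<gamma> \<subseteq> K \<gamma>" "\<And>\<gamma>. \<gamma> \<in> W \<Longrightarrow> finite (T \<gamma> \<inter> K \<alpha> - T \<alpha>)"
      and a: "\<alpha> \<in> W" "\<And>\<gamma>. \<gamma> \<in> W \<Longrightarrow> J \<inter> K \<gamma> \<subseteq> K \<alpha>" for T J \<alpha>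
  proof (intro equalityI subsetI)
    fix y assume "y \<in> lim T \<inter> E J"
    then obtain \<gamma> where y: "\<gamma> \<in> W" "y \<in> E (T \<gamma>)" "y \<in> E J" "y \<notin> Oset" unfolding lim_def by blast
    have TI: "T \<gamma> \<subseteq> I" using T(1) KI by blast
    have "y \<in> E (T \<gamma> \<inter> J)" using y E_Int[OF TI J] by blast
    moreover have "T \<gamma> \<inter> J \<subseteq> (T \<alpha> \<inter> J) \<union> (T \<gamma> \<inter> K \<alpha> - T \<alpha>)" using a(2)[OF y(1)] T(1) by blast
    ultimately have "y \<in> E (T \<alpha> \<inter> J) \<union> E (T \<gamma> \<inter> K \<alpha> - T \<alpha>)" using E_mono E_Un by blast
    moreover have "E (T \<gamma> \<inter> K \<alpha> - T \<alpha>) \<subseteq> Oset" using T(2)[OF y(1)] TI by (intro E_finite_subset_Oset) auto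
    ultimately show "y \<in> E (T \<alpha> \<inter> J) - Oset" using y(4) by blast
  next
    fix y assume y: "y \<in> E (T \<alpha> \<inter> J) - Oset"
    then have "y \<in> E (T \<alpha>)" "y \<in> E J" using E_mono[of "T \<alpha> \<inter> J" "T \<alpha>"] E_mono[of "T \<alpha> \<inter> J" J] by auto
    then show "y \<in> lim T \<inter> E J" using y a(1) unfolding lim_def by blast
  qed
  have lim_sub: "lim T \<subseteq> topspace Y" if T: "\<And>\<gamma>. T \<gamma> \<subseteq> K \<gamma>" for T
    unfolding lim_def topspace_Y
  proof clarify
    fix y \<gamma> assume "y \<in> E (T \<gamma>)"
    moreover have "E (T \<gamma>) \<subseteq> Yset" using T[of \<gamma>] KI cK[of \<gamma>] countable_subset by (intro E_subset_Yset) auto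
    ultimately show "y \<in> Yset" by blast
  qed
  have lim_closed: "closedin Y (lim T)"
    if T: "\<And>\<gamma>. T \<gamma> \<subseteq> K \<gamma>" "\<And>\<alpha> \<gamma>. \<alpha> \<in> W \<Longrightarrow> \<gamma> \<in> W \<Longrightarrow> finite (T \<gamma> \<inter> K \<alpha> - T \<alpha>)" for T
    unfolding closedin_def
  proof (intro conjI lim_sub T(1), subst openin_subopen, intro ballI)
    fix y assume y: "y \<in> topspace Y - lim T"
    then have "y \<in> Yset" using topspace_Y by blast
    then obtain J where J: "J \<subseteq> I" "countable J" "y \<in> E J" unfolding Yset_iff by blast
    obtain \<alpha> where a: "\<alpha> \<in> W" "\<And>\<gamma>. \<gamma> \<in> W \<Longrightarrow> J \<inter> K \<gamma> \<subseteq> K \<alpha>" using cover[OF J(2)] by blast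
    have eq: "lim T \<inter> E J = E (T \<alpha> \<inter> J) - Oset" using limE[OF J(1) T(1) T(2)[OF a(1)] a] .
    let ?N = "(E J - E (T \<alpha> \<inter> J)) \<union> (E J \<inter> Oset)"
    have EJ: "E J \<subseteq> Yset" using J E_subset_Yset by blast
    have "openin (beta X) ?N" using open_E[OF J(1)] closed_E open_Oset by (intro openin_Un openin_diff openin_Int)
    then have "openin Y ?N" unfolding Y_def using EJ openin_open_subtopology[OF open_Yset] by blast
    moreover have "y \<in> ?N" using y J(3) eq by blast
    moreover have "?N \<subseteq> topspace Y - lim T" using eq EJ topspace_Y by blast
    ultimately show "\<exists>N. openin Y N \<and> y \<in> N \<and> N \<subseteq> topspace Y - lim T" by blast
  qed
  have disj: "disjnt (lim A) (lim B)"
    unfolding disjnt_iff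
  proof (intro allI notI, elim conjE)
    fix y assume y: "y \<in> lim A" "y \<in> lim B"
    then have "y \<in> Yset" using lim_sub[OF AK] topspace_Y by blast
    then obtain J where J: "J \<subseteq> I" "countable J" "y \<in> E J" unfolding Yset_iff by blast
    obtain \<alpha> where a: "\<alpha> \<in> W" "\<And>\<gamma>. \<gamma> \<in> W \<Longrightarrow> J \<inter> K \<gamma> \<subseteq> K \<alpha>" using cover[OF J(2)] by blast
    have "lim A \<inter> E J = E (A \<alpha> \<inter> J) - Oset" using limE[OF J(1) AK finA[OF a(1)] a] .
    moreover have "lim B \<inter> E J = E (B \<alpha> \<inter> J) - Oset" using limE[OF J(1) BK finB[OF a(1)] a] .
    moreover have "E (A \<alpha> \<inter> J) \<inter> E (B \<alpha> \<inter> J) = {}" using ABdisj J(1) by (intro E_disjoint) blast+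
    ultimately show False using y J(3) by blast
  qed
  obtain U V where UV: "openin Y U" "openin Y V" "lim A \<subseteq> U" "lim B \<subseteq> V" "disjnt U V"
    using normal lim_closed[OF AK finA] lim_closed[OF BK finB] disj unfolding normal_space_def by meson
  have Uo: "openin (beta X) U" and Vo: "openin (beta X) V"
    using UV(1,2) unfolding Y_def openin_open_subtopology[OF open_Yset] by auto
  obtain b where b: "\<And>C. C \<in> I \<Longrightarrow> b C \<in> C" using nonempty_member by (metis ex_in_conv)
  let ?b = "\<lambda>C. beta_map X (b C)"
  \<comment> \<open>If \<open>G\<close> missed the test points \<open>?b C\<close> of an infinite
    \<open>S\<close>, it would miss their accumulation point outside \<open>Oset\<close>, which
    belongs to \<open>lim T\<close>.\<close>
  have acc: "\<exists>C\<in>S. ?b C \<in> G" if h: "S \<subseteq> T \<alpha>" "T \<alpha> \<subseteq> I" "infinite S" "\<alpha> \<in> W" "lim T \<subseteq> G" "openin (beta X) G" for S T \<alpha> G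
  proof -
    obtain y where y: "y \<in> E S - Oset" "y \<in> beta X closure_of (beta_map X ` b ` S)"
      using ex_accumulation_point[of S b] h(1-3) b by blast
    then have "y \<in> lim T" using E_mono[OF h(1)] h(4) unfolding lim_def by blast
    then have "y \<in> G" using h(5) by blast
    then show ?thesis using y(2) h(6) unfolding in_closure_of by blast
  qed
  have Afin: "finite {C \<in> A \<alpha>. ?b C \<notin> U}" if "\<alpha> \<in> W" for \<alpha>
    using acc[of "{C \<in> A \<alpha>. ?b C \<notin> U}" A \<alpha> U] that UV(3) Uo AK KI by blast
  have Bfin: "finite {C \<in> B \<alpha>. ?b C \<in> U}" if "\<alpha> \<in> W" for \<alpha>
    using acc[of "{C \<in> B \<alpha>. ?b C \<in> U}" B \<alpha> V] that UV(4,5) Vo BK KI unfolding disjnt_iff by blast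
  \<comment> \<open>For \<open>\<alpha>\<close> above \<open>\<xi>\<close> the column over
    \<open>\<xi>\<close> lies in \<open>B \<alpha>\<close> beyond height
    \<open>e \<alpha> \<xi>\<close>, so only finitely many of its test points are in
    \<open>U\<close>. The threshold \<open>N \<xi>\<close> does not refer to
    \<open>\<alpha>\<close>.\<close>
  have "\<exists>N. \<forall>n\<ge>N. ?b (c (\<xi>, n)) \<notin> U" if xi: "\<xi> \<in> W" for \<xi>
  proof -
    obtain \<alpha> where a: "\<alpha> \<in> W" "(\<xi>, \<alpha>) \<in> lt" using bound[of "{\<xi>}"] xi by auto
    let ?S = "{n. e \<alpha> \<xi> < n \<and> ?b (c (\<xi>, n)) \<in> U}"
    have "(\<lambda>n. c (\<xi>, n)) ` ?S \<subseteq> {C \<in> B \<alpha>. ?b C \<in> U}" using a(2) unfolding B_def by auto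
    moreover have "inj_on (\<lambda>n. c (\<xi>, n)) ?S" using cinj xi by (intro inj_onI) fastforce
    ultimately have "finite ?S" using Bfin[OF a(1)] by (meson finite_imageD finite_subset)
    then obtain M where M: "\<forall>n\<in>?S. n \<le> M" using finite_nat_set_iff_bounded_le by auto
    have "\<forall>n\<ge>Suc (M + e \<alpha> \<xi>). ?b (c (\<xi>, n)) \<notin> U"
    proof (intro allI impI notI)
      fix n assume "Suc (M + e \<alpha> \<xi>) \<le> n" "?b (c (\<xi>, n)) \<in> U"
      then show False using M[rule_format, of n] by auto
    qed
    then show ?thesis by blast
  qed
  then obtain N where N: "\<And>\<xi> n. \<xi> \<in> W \<Longrightarrow> N \<xi> \<le> n \<Longrightarrow> ?b (c (\<xi>, n)) \<notin> U" by metis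
  have "\<exists>k. uncountable {\<xi> \<in> W. N \<xi> = k}"
  proof (rule ccontr)
    assume "\<not> ?thesis"
    then have "countable (\<Union>k. {\<xi> \<in> W. N \<xi> = k})" by auto
    moreover have "(\<Union>k. {\<xi> \<in> W. N \<xi> = k}) = W" by auto
    ultimately show False using uncW by simp
  qed
  then obtain k where "infinite {\<xi> \<in> W. N \<xi> = k}" using countable_finite by blast
  then obtain S where S: "S \<subseteq> {\<xi> \<in> W. N \<xi> = k}" "countable S" "infinite S"
    by (meson infinite_countable_subset')
  obtain \<alpha> where a: "\<alpha> \<in> W" "\<forall>\<xi>\<in>S. (\<xi>, \<alpha>) \<in> lt" using bound[OF S(2)] S(1) by blast
  \<comment> \<open>For \<open>\<xi> \<in> S\<close> with \<open>k \<le> e \<alpha> \<xi>\<close>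
    the point of the graph over \<open>\<xi>\<close> belongs to \<open>A \<alpha>\<close>, yet its
    test point is outside \<open>U\<close>; this happens finitely often. The remaining
    \<open>\<xi>\<close> are finitely many because \<open>e \<alpha>\<close> is finite-to-one, so
    the infinite \<open>S\<close> would be finite.\<close>
  have "S \<subseteq> {z. (z, \<alpha>) \<in> lt \<and> e \<alpha> z \<le> k} \<union> {\<xi> \<in> S. k \<le> e \<alpha> \<xi>}" using a(2) by auto
  moreover have "finite {\<xi> \<in> S. k \<le> e \<alpha> \<xi>}"
  proof (rule finite_imageD)
    have "(\<lambda>\<xi>. c (\<xi>, e \<alpha> \<xi>)) ` {\<xi> \<in> S. k \<le> e \<alpha> \<xi>} \<subseteq> {C \<in> A \<alpha>. ?b C \<notin> U}"
      using a(2) N S(1) unfolding A_def by auto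
    then show "finite ((\<lambda>\<xi>. c (\<xi>, e \<alpha> \<xi>)) ` {\<xi> \<in> S. k \<le> e \<alpha> \<xi>})" using Afin[OF a(1)] finite_subset by blast
    show "inj_on (\<lambda>\<xi>. c (\<xi>, e \<alpha> \<xi>)) {\<xi> \<in> S. k \<le> e \<alpha> \<xi>}" 
    proof (rule inj_onI)
      fix x y assume "x \<in> {\<xi> \<in> S. k \<le> e \<alpha> \<xi>}" "y \<in> {\<xi> \<in> S. k \<le> e \<alpha> \<xi>}" "c (x, e \<alpha> x) = c (y, e \<alpha> y)"
      then show "x = y" using cinj[of "(x, e \<alpha> x)" "(y, e \<alpha> y)"] S(1) by auto
    qed
  qed
  ultimately show False using e(1)[of \<alpha> k] S(3) by (meson finite_UnI finite_subset)
qed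

end

subsection \<open>Uniqueness of the representing space\<close>

definition cj :: "'k::real_normed_field \<Rightarrow> 'k" where
  "cj t = of_real (norm t ^ 2) / t"

lemma cj_mult: "t * cj t = of_real (norm t ^ 2)"
  unfolding cj_def by simp

lemma norm_cj: "norm (cj t) = norm t"
  unfolding cj_def by (simp add: norm_divide norm_power power2_eq_square norm_mult)

text \<open>At 0, where total division gives the value 0, continuity follows from
  \<open>norm_cj\<close>; elsewhere \<open>cj\<close> is a quotient of continuous functions.\<close>

lemma continuous_cj: "continuous_on UNIV (cj :: 'k::real_normed_field \<Rightarrow> 'k)"
  unfolding continuous_on_eq_continuous_at[OF open_UNIV]
proof
  fix t :: 'k
  show "isCont cj t"
  proof (cases "t = 0")
    case True
    have "(cj \<longlongrightarrow> (0::'k)) (at 0)"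
      by (rule tendsto_norm_zero_cancel) (simp add: norm_cj tendsto_norm_zero)
    then show ?thesis using True by (simp add: isCont_def cj_def)
  next
    case False
    then show ?thesis unfolding cj_def by (intro continuous_intros) auto
  qed
qed

lemma Cc_I:
  assumes "f \<in> Cb Y" "Coz Y f \<subseteq> K" "closedin Y K" "compactin Y K"
  shows "f \<in> Cc Y"
  unfolding Cc_def
proof (intro CollectI conjI assms(1))
  have "Supp Y f \<subseteq> K" unfolding Supp_def using assms by (intro closure_of_minimal)
  then show "compactin Y (Supp Y f)" by (intro closed_compactin[OF assms(4)]) (auto simp: Supp_def)
qed

lemma Coz_subset_Supp: "Coz Y f \<subseteq> Supp Y f"
  by (simp add: Supp_def Coz_subset closure_of_subset)

lemma Cc_mult:
  assumes "f \<in> Cc Y" "g \<in> Cb Y"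
  shows "f * g \<in> Cc Y"
proof (rule Cc_I[of _ _ "Supp Y f"])
  show "f * g \<in> Cb Y" using assms by (intro Cb_closed) (auto simp: Cc_def)
  have "Coz Y (f * g) \<subseteq> Coz Y f" by (auto simp: Coz_def)
  then show "Coz Y (f * g) \<subseteq> Supp Y f" using Coz_subset_Supp[of Y f] by blast
qed (use assms in \<open>auto simp: Supp_def Cc_def\<close>)

lemma subspace_Cc: "funspace.subspace (Cc Y :: ('a \<Rightarrow> 'k::real_normed_field) set)"
proof (rule funspace.subspaceI)
  show "(0 :: 'a \<Rightarrow> 'k) \<in> Cc Y"
    by (rule Cc_I[of _ _ "{}"]) (auto simp: zero_in_Cb Coz_def)
next
  fix f g :: "'a \<Rightarrow> 'k" assume fg: "f \<in> Cc Y" "g \<in> Cc Y"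
  show "f + g \<in> Cc Y"
  proof (rule Cc_I[of _ _ "Supp Y f \<union> Supp Y g"])
    show "f + g \<in> Cb Y" using fg by (intro Cb_closed) (auto simp: Cc_def)
    have "Coz Y (f + g) \<subseteq> Coz Y f \<union> Coz Y g" by (auto simp: Coz_def)
    then show "Coz Y (f + g) \<subseteq> Supp Y f \<union> Supp Y g"
      using Coz_subset_Supp[of Y f] Coz_subset_Supp[of Y g] by blast
  qed (use fg in \<open>auto simp: Supp_def Cc_def intro: compactin_Un\<close>)
next
  fix c and f :: "'a \<Rightarrow> 'k" assume f: "f \<in> Cc Y"
  show "fscale c f \<in> Cc Y"
  proof (rule Cc_I[of _ _ "Supp Y f"])
    show "fscale c f \<in> Cb Y" using f by (intro Cb_closed) (auto simp: Cc_def)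
    have "Coz Y (fscale c f) \<subseteq> Coz Y f" by (auto simp: Coz_def fscale_def)
    then show "Coz Y (fscale c f) \<subseteq> Supp Y f" using Coz_subset_Supp[of Y f] by blast
  qed (use f in \<open>auto simp: Supp_def Cc_def\<close>)
qed

lemmas Cc_add = funspace.subspace_add[OF subspace_Cc]
lemmas Cc_scale = funspace.subspace_scale[OF subspace_Cc]

lemma Cc_cj:
  assumes "f \<in> Cc Y"
  shows "cj \<circ> f \<in> Cc Y"
proof (rule Cc_I[of _ _ "Supp Y f"])
  have f: "f \<in> Cb Y" using assms by (simp add: Cc_def)
  have "continuous_map Y euclidean (cj \<circ> f)"
    using CbD(1)[OF f] continuous_cj by (intro continuous_map_compose[of _ euclidean]) auto
  moreover have "bounded ((cj \<circ> f) ` topspace Y)"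
    using CbD(2)[OF f] by (auto simp: bounded_iff norm_cj)
  ultimately show "cj \<circ> f \<in> Cb Y" using CbD(3)[OF f] by (auto simp: Cb_def cj_def)
  have "Coz Y (cj \<circ> f) \<subseteq> Coz Y f" by (auto simp: Coz_def cj_def)
  then show "Coz Y (cj \<circ> f) \<subseteq> Supp Y f" using Coz_subset_Supp[of Y f] by blast
qed (use assms in \<open>auto simp: Supp_def Cc_def\<close>)

lemma open_Coz:
  assumes "f \<in> Cb Y"
  shows "openin Y (Coz Y f)"
  using openin_continuous_map_preimage[OF CbD(1)[OF assms], of "- {0}"] by (simp add: Coz_def open_Compl)

text \<open>Compact support comes from shrinking \<open>U\<close> by a neighborhood \<open>V\<close>
  that lies in a compact set. Complete regularity gives an \<open>h\<close> that is 0 at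
  \<open>y\<close> and 1 off \<open>U \<inter> V\<close>, and \<open>1 - h\<close> is the
  bump.\<close>

lemma Cc_bump:
  assumes lc: "locally_compact_space Y" and H: "Hausdorff_space Y"
    and U: "openin Y U" "y \<in> U"
  shows "\<exists>f\<in>Cc Y. f y = (1::'k::real_normed_field) \<and> Coz Y f \<subseteq> U"
proof -
  have y: "y \<in> topspace Y" using U openin_subset by blast
  obtain V K where VK: "openin Y V" "compactin Y K" "y \<in> V" "V \<subseteq> K"
    using lc y unfolding locally_compact_space_def by blast
  have "completely_regular_space Y"
    using lc H by (simp add: locally_compact_regular_imp_completely_regular_space locally_compact_Hausdorff_imp_regular_space)
  moreover have "closedin Y (topspace Y - U \<inter> V)" using U(1) VK(1) by blast
  moreover have "y \<in> topspace Y - (topspace Y - U \<inter> V)" using U(2) VK(3) y by blast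
  ultimately obtain h :: "'a \<Rightarrow> real" where h: "continuous_map Y (top_of_set {0..1}) h" "h y = 0"
      "h \<in> (topspace Y - U \<inter> V) \<rightarrow> {1}"
    unfolding completely_regular_space_def image_subset_iff_funcset by meson
  define f :: "'a \<Rightarrow> 'k" where "f x = (if x \<in> topspace Y then of_real (1 - h x) else 0)" for x
  have hc: "continuous_map Y euclidean h" and h01: "\<And>x. x \<in> topspace Y \<Longrightarrow> h x \<in> {0..1}"
    using h(1) by (auto simp: continuous_map_in_subtopology)
  have "continuous_map Y euclidean (\<lambda>x. of_real (1 - h x) :: 'k)"
    using hc by (auto simp: continuous_map_atin limitin_canonical_iff intro!: tendsto_intros)
  then have "continuous_map Y euclidean f"
    by (rule continuous_map_eq) (simp add: f_def)
  moreover have "norm (f x) \<le> 1" if "x \<in> topspace Y" for x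
    using h01[OF that] that by (simp add: f_def flip: of_real_diff)
  then have "bounded (f ` topspace Y)" unfolding bounded_iff by blast
  ultimately have fb: "f \<in> Cb Y" by (auto simp: Cb_def f_def)
  have sub: "Coz Y f \<subseteq> U \<inter> V" using h(3) by (auto simp: Coz_def f_def)
  have "f \<in> Cc Y" using fb sub VK compactin_imp_closedin[OF H VK(2)] by (intro Cc_I[of f Y K]) auto
  then show ?thesis using h(2) y sub by (intro bexI[of _ f]) (auto simp: f_def)
qed

text \<open>If the kernel of \<open>\<theta>\<close> had no common zero, then by compactness it would contain some \<open>h\<close> that is positive on the
  support of \<open>u\<^sub>0\<close>, and so the multiple \<open>u\<^sub>0\<close> of \<open>h\<close>.  The function \<open>cj\<close> is complex conjugation expressed in the
  operations that the scalar field provides.\<close>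

lemma Cc_character_eq_evaluation:
  fixes \<theta> :: "('b \<Rightarrow> 'k::real_normed_field) \<Rightarrow> 'k"
  assumes lc: "locally_compact_space Y" and H: "Hausdorff_space Y"
    and add: "\<And>f g. f \<in> Cc Y \<Longrightarrow> g \<in> Cc Y \<Longrightarrow> \<theta> (f + g) = \<theta> f + \<theta> g"
    and scale: "\<And>c f. f \<in> Cc Y \<Longrightarrow> \<theta> (fscale c f) = c * \<theta> f"
    and mult: "\<And>f g. f \<in> Cc Y \<Longrightarrow> g \<in> Cc Y \<Longrightarrow> \<theta> (f * g) = \<theta> f * \<theta> g"
    and nz: "u\<^sub>0 \<in> Cc Y" "\<theta> u\<^sub>0 \<noteq> 0"
  shows "\<exists>y\<in>topspace Y. \<forall>f\<in>Cc Y. \<theta> f = f y"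
proof -
  have "\<exists>y\<in>topspace Y. \<forall>f\<in>Cc Y. \<theta> f = 0 \<longrightarrow> f y = 0"
  proof (rule ccontr)
    assume "\<not> ?thesis"
    then obtain F where F: "\<And>y. y \<in> topspace Y \<Longrightarrow> F y \<in> Cc Y \<and> \<theta> (F y) = 0 \<and> F y y \<noteq> 0" by metis
    let ?K = "Supp Y u\<^sub>0"
    have K: "compactin Y ?K" using nz(1) by (simp add: Cc_def)
    then have Ksub: "?K \<subseteq> topspace Y" by (rule compactin_subset_topspace)
    have "?K \<subseteq> \<Union>((\<lambda>y. Coz Y (F y)) ` topspace Y)" using Ksub F by (fastforce simp: Coz_def)
    moreover have "\<forall>U \<in> (\<lambda>y. Coz Y (F y)) ` topspace Y. openin Y U"
      using F open_Coz unfolding Cc_def by blast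
    ultimately obtain \<V> where V: "finite \<V>" "\<V> \<subseteq> (\<lambda>y. Coz Y (F y)) ` topspace Y" "?K \<subseteq> \<Union>\<V>"
      using K unfolding compactin_def by meson
    then obtain D where D: "finite D" "D \<subseteq> topspace Y" "?K \<subseteq> (\<Union>y\<in>D. Coz Y (F y))"
      by (metis finite_subset_image)
    define h where "h = (\<Sum>y\<in>D. F y * (cj \<circ> F y))"
    have "h \<in> Cc Y \<and> \<theta> h = 0"
      using D(1,2) unfolding h_def
    proof (induction D)
      case empty
      have "\<theta> (fscale 0 u\<^sub>0) = 0" using scale[OF nz(1), of 0] by simp
      moreover have "fscale 0 u\<^sub>0 = 0" by (simp add: fscale_def zero_fun_def)
      ultimately show ?case using funspace.subspace_0[OF subspace_Cc] unfolding sum.empty by metis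
    next
      case (insert y D)
      then have Fy: "F y \<in> Cc Y" "\<theta> (F y) = 0" "cj \<circ> F y \<in> Cc Y" using F Cc_cj by auto
      have 1: "F y * (cj \<circ> F y) \<in> Cc Y" using Fy by (intro Cc_mult) (auto simp: Cc_def)
      have 2: "\<theta> (F y * (cj \<circ> F y)) = 0" unfolding mult[OF Fy(1,3)] Fy(2) by simp
      have S: "(\<Sum>y\<in>D. F y * (cj \<circ> F y)) \<in> Cc Y" "\<theta> (\<Sum>y\<in>D. F y * (cj \<circ> F y)) = 0"
        using insert by blast+
      have "\<theta> (F y * (cj \<circ> F y) + (\<Sum>y\<in>D. F y * (cj \<circ> F y))) = 0"
        unfolding add[OF 1 S(1)] 2 S(2) by simp
      then show ?case unfolding sum.insert[OF insert.hyps] using Cc_add[OF 1 S(1)] by blast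
    qed
    then have h: "h \<in> Cc Y" "\<theta> h = 0" by auto
    define s where "s x = (\<Sum>y\<in>D. norm (F y x) ^ 2)" for x
    have hs: "h x = of_real (s x)" for x
      unfolding h_def s_def by (induction D rule: infinite_finite_induct) (auto simp: cj_mult)
    have scont: "continuous_map Y euclidean s"
    proof -
      have "continuous_map Y euclidean (\<lambda>x. norm (h x))"
        using h(1) CbD(1) by (intro continuous_map_norm) (auto simp: Cc_def)
      moreover have "norm (h x) = s x" for x
        unfolding hs norm_of_real by (simp add: s_def sum_nonneg)
      ultimately show ?thesis by simp
    qed
    have spos: "s x > 0" if x: "x \<in> ?K" for x
    proof -
      obtain y where y: "y \<in> D" "F y x \<noteq> 0" using D(3) x by (auto simp: Coz_def)
      then have "0 < norm (F y x) ^ 2" by simp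
      also have "\<dots> \<le> s x" unfolding s_def using D(1) y(1) by (intro member_le_sum) auto
      finally show ?thesis .
    qed
    obtain m where m: "m > 0" "\<And>x. x \<in> ?K \<Longrightarrow> m \<le> s x"
    proof (cases "?K = {}")
      case True
      then show thesis using that[of 1] by auto
    next
      case False
      have "compact (s ` ?K)" using image_compactin[OF K scont] by simp
      then obtain m where "m \<in> s ` ?K" "\<forall>t\<in>s ` ?K. m \<le> t"
        using False compact_attains_inf by (metis image_is_empty)
      then show thesis using that[of m] spos by auto
    qed
    have u0b: "u\<^sub>0 \<in> Cb Y" using nz(1) by (simp add: Cc_def)
    \<comment> \<open>The maximum with \<open>m\<close> keeps the denominator away from 0 everywhere
      and changes nothing on \<open>?K\<close>, where \<open>m \<le> s x\<close>.\<close>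
    define q where "q x = u\<^sub>0 x / of_real (max (s x) m)" for x
    have "continuous_map Y euclidean q"
      unfolding q_def using scont CbD(1)[OF u0b] m(1)
      by (auto simp: continuous_map_atin limitin_canonical_iff intro!: tendsto_intros)
    moreover obtain B where B: "\<forall>x\<in>topspace Y. norm (u\<^sub>0 x) \<le> B"
      using CbD(2)[OF u0b] by (auto simp: bounded_iff)
    have "norm (q x) \<le> B / m" if "x \<in> topspace Y" for x
      unfolding q_def norm_divide norm_of_real using B that m(1)
      by (intro frac_le) (auto intro: order_trans[OF norm_ge_zero])
    then have "bounded (q ` topspace Y)" unfolding bounded_iff by blast
    ultimately have qb: "q \<in> Cb Y" using CbD(3)[OF u0b] by (auto simp: Cb_def q_def)
    have qc: "q \<in> Cc Y"
    proof (rule Cc_I[OF qb _ _ K])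
      have "Coz Y q \<subseteq> Coz Y u\<^sub>0" by (auto simp: Coz_def q_def)
      then show "Coz Y q \<subseteq> ?K" using Coz_subset_Supp[of Y u\<^sub>0] by blast
    qed (simp add: Supp_def)
    have "q * h = u\<^sub>0"
    proof
      fix x show "(q * h) x = u\<^sub>0 x"
      proof (cases "x \<in> ?K")
        case True
        then have "max (s x) m = s x" "s x \<noteq> 0" using m(2) spos by fastforce+
        then show ?thesis by (simp add: q_def hs)
      next
        case False
        then have "u\<^sub>0 x = 0" using Coz_subset_Supp[of Y u\<^sub>0] CbD(3)[OF u0b] by (auto simp: Coz_def)
        then show ?thesis by (simp add: q_def)
      qed
    qed
    then have "\<theta> u\<^sub>0 = 0" using mult[OF qc h(1)] h(2) by simp
    then show False using nz(2) by simp
  qed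
  then obtain y where y: "y \<in> topspace Y" "\<And>f. f \<in> Cc Y \<Longrightarrow> \<theta> f = 0 \<Longrightarrow> f y = 0" by blast
  \<comment> \<open>Kernel inclusion makes evaluation at \<open>y\<close> the multiple
    \<open>u y\<close> of \<open>\<theta>\<close>. The bump \<open>b\<close> shows that this factor
    is nonzero, and evaluating \<open>u * u\<close> shows that it equals its square, so it is
    1.\<close>
  define u where "u = fscale (1 / \<theta> u\<^sub>0) u\<^sub>0"
  have u: "u \<in> Cc Y" "\<theta> u = 1" using nz scale[OF nz(1)] Cc_scale[OF nz(1)] by (auto simp: u_def)
  have ev: "f y = \<theta> f * u y" if f: "f \<in> Cc Y" for f
  proof -
    have "f + fscale (- \<theta> f) u \<in> Cc Y" using f u Cc_add Cc_scale by blast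
    moreover have "\<theta> (f + fscale (- \<theta> f) u) = 0"
      unfolding add[OF f Cc_scale[OF u(1)]] scale[OF u(1)] u(2) by simp
    ultimately have "(f + fscale (- \<theta> f) u) y = 0" by (rule y(2))
    then show ?thesis by (simp add: fscale_def)
  qed
  obtain b :: "'b \<Rightarrow> 'k" where b: "b \<in> Cc Y" "b y = 1"
    using Cc_bump[OF lc H openin_topspace y(1)] by blast
  have "u y \<noteq> 0" using ev[OF b(1)] b(2) by auto
  moreover have "u * u \<in> Cc Y" using u by (intro Cc_mult) (auto simp: Cc_def)
  from ev[OF this] have "u y * u y = u y" using mult[OF u(1) u(1)] u(2) by simp
  ultimately have "u y = 1" by simp
  then show ?thesis using ev y(1) by (intro bexI[of _ y]) auto
qed

text \<open>The identities for the inverse arise by cancelling the map on sums, products and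
  multiples of elements of \<open>A\<close>; these must therefore stay in \<open>A\<close>.\<close>

lemma isometrically_isomorphic_sym:
  assumes iso: "isometrically_isomorphic X A Y B"
    and A: "funspace.subspace A" "\<And>f g. f \<in> A \<Longrightarrow> g \<in> A \<Longrightarrow> f * g \<in> A"
  shows "isometrically_isomorphic Y B X A"
proof -
  obtain \<phi> where p: "bij_betw \<phi> A B" "\<forall>f\<in>A. \<forall>g\<in>A. \<phi> (f + g) = \<phi> f + \<phi> g"
    "\<forall>c. \<forall>f\<in>A. \<phi> (fscale c f) = fscale c (\<phi> f)" "\<forall>f\<in>A. \<forall>g\<in>A. \<phi> (f * g) = \<phi> f * \<phi> g"
    "\<forall>f\<in>A. sup_norm Y (\<phi> f) = sup_norm X f"
    using iso unfolding isometrically_isomorphic_def by auto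
  let ?i = "inv_into A \<phi>"
  have i: "?i f \<in> A" "\<phi> (?i f) = f" if "f \<in> B" for f
    using p(1) that by (auto simp: bij_betw_def inv_into_into f_inv_into_f)
  have j: "?i (\<phi> f) = f" if "f \<in> A" for f using p(1) that by (simp add: bij_betw_inv_into_left)
  note cl = funspace.subspace_add[OF A(1)] funspace.subspace_scale[OF A(1)]
  have "?i (f + g) = ?i f + ?i g" if "f \<in> B" "g \<in> B" for f g
    using j[OF cl(1)[OF i(1)[OF that(1)] i(1)[OF that(2)]]] p(2) i that by metis
  moreover have "?i (f * g) = ?i f * ?i g" if "f \<in> B" "g \<in> B" for f g
    using j[OF A(2)[OF i(1)[OF that(1)] i(1)[OF that(2)]]] p(4) i that by metis
  moreover have "?i (fscale c f) = fscale c (?i f)" if "f \<in> B" for f c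
    using j[OF cl(2)[OF i(1)[OF that]]] p(3) i that by metis
  moreover have "sup_norm X (?i f) = sup_norm Y f" if "f \<in> B" for f
    using p(5) i that by metis
  ultimately show ?thesis
    unfolding isometrically_isomorphic_def using bij_betw_inv_into[OF p(1)] by (intro exI[of _ ?i]) blast
qed

lemma isometrically_isomorphic_trans:
  assumes "isometrically_isomorphic X A Y B" "isometrically_isomorphic Y B Z C"
  shows "isometrically_isomorphic X A Z C"
proof -
  obtain \<phi> where p: "bij_betw \<phi> A B" "\<forall>f\<in>A. \<forall>g\<in>A. \<phi> (f + g) = \<phi> f + \<phi> g"
    "\<forall>c. \<forall>f\<in>A. \<phi> (fscale c f) = fscale c (\<phi> f)" "\<forall>f\<in>A. \<forall>g\<in>A. \<phi> (f * g) = \<phi> f * \<phi> g"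
    "\<forall>f\<in>A. sup_norm Y (\<phi> f) = sup_norm X f"
    using assms(1) unfolding isometrically_isomorphic_def by auto
  obtain \<psi> where q: "bij_betw \<psi> B C" "\<forall>f\<in>B. \<forall>g\<in>B. \<psi> (f + g) = \<psi> f + \<psi> g"
    "\<forall>c. \<forall>f\<in>B. \<psi> (fscale c f) = fscale c (\<psi> f)" "\<forall>f\<in>B. \<forall>g\<in>B. \<psi> (f * g) = \<psi> f * \<psi> g"
    "\<forall>f\<in>B. sup_norm Z (\<psi> f) = sup_norm Y f"
    using assms(2) unfolding isometrically_isomorphic_def by auto
  have "\<phi> f \<in> B" if "f \<in> A" for f using p(1) that by (auto simp: bij_betw_def)
  then show ?thesis
    unfolding isometrically_isomorphic_def using p q bij_betw_trans[OF p(1) q(1)]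
    by (intro exI[of _ "\<psi> \<circ> \<phi>"]) simp
qed

text \<open>Evaluation at \<open>z\<close> after \<open>\<Phi>\<close> is a nonzero character, hence
  evaluation at some \<open>\<tau> z\<close>. For continuity, the preimage of \<open>U\<close>
  contains around each of its points the cozero set of \<open>\<Phi> f\<close> for a bump
  \<open>f\<close> inside \<open>U\<close>.\<close>

lemma Cc_iso_point_map:
  fixes \<Phi> :: "('a \<Rightarrow> 'k::real_normed_field) \<Rightarrow> 'b \<Rightarrow> 'k"
  assumes Y: "locally_compact_space Y" "Hausdorff_space Y"
    and Z: "locally_compact_space Z" "Hausdorff_space Z"
    and im: "\<Phi> ` Cc Y = Cc Z"
    and add: "\<forall>f\<in>Cc Y. \<forall>g\<in>Cc Y. \<Phi> (f + g) = \<Phi> f + \<Phi> g"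
    and scale: "\<forall>c. \<forall>f\<in>Cc Y. \<Phi> (fscale c f) = fscale c (\<Phi> f)"
    and mult: "\<forall>f\<in>Cc Y. \<forall>g\<in>Cc Y. \<Phi> (f * g) = \<Phi> f * \<Phi> g"
  shows "\<exists>\<tau>. continuous_map Z Y \<tau> \<and> (\<forall>z\<in>topspace Z. \<forall>f\<in>Cc Y. \<Phi> f z = f (\<tau> z))"
proof -
  have "\<exists>y\<in>topspace Y. \<forall>f\<in>Cc Y. \<Phi> f z = f y" if z: "z \<in> topspace Z" for z
  proof -
    obtain b :: "'b \<Rightarrow> 'k" where b: "b \<in> Cc Z" "b z = 1"
      using Cc_bump[OF Z openin_topspace z] by blast
    then obtain u where "u \<in> Cc Y" "\<Phi> u = b" using im by (metis imageE)
    then show ?thesis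
      using add scale mult b by (intro Cc_character_eq_evaluation[OF Y, of "\<lambda>f. \<Phi> f z" u]) (auto simp: fscale_def)
  qed
  then obtain \<tau> where t: "\<And>z. z \<in> topspace Z \<Longrightarrow> \<tau> z \<in> topspace Y"
      "\<And>z f. z \<in> topspace Z \<Longrightarrow> f \<in> Cc Y \<Longrightarrow> \<Phi> f z = f (\<tau> z)" by metis
  have "openin Z {z \<in> topspace Z. \<tau> z \<in> U}" if U: "openin Y U" for U
  proof (subst openin_subopen, intro ballI)
    fix z assume z: "z \<in> {z \<in> topspace Z. \<tau> z \<in> U}"
    then obtain f :: "'a \<Rightarrow> 'k" where f: "f \<in> Cc Y" "f (\<tau> z) = 1" "Coz Y f \<subseteq> U"
      using Cc_bump[OF Y U] by blast
    have "\<Phi> f \<in> Cc Z" using f(1) im by (metis imageI)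
    then have "openin Z (Coz Z (\<Phi> f))" by (intro open_Coz) (simp add: Cc_def)
    moreover have "z \<in> Coz Z (\<Phi> f)" using z t f by (auto simp: Coz_def)
    moreover have "Coz Z (\<Phi> f) \<subseteq> {z \<in> topspace Z. \<tau> z \<in> U}"
      using t f(1,3) by (auto simp: Coz_def)
    ultimately show "\<exists>T. openin Z T \<and> z \<in> T \<and> T \<subseteq> {z \<in> topspace Z. \<tau> z \<in> U}" by blast
  qed
  then have "continuous_map Z Y \<tau>" using t(1) by (auto simp: continuous_map_def)
  then show ?thesis using t(2) by blast
qed

lemma Cc_separates_points:
  assumes "locally_compact_space Y" "Hausdorff_space Y" "y \<in> topspace Y" "y' \<in> topspace Y"
    and "\<And>f :: 'a \<Rightarrow> 'k::real_normed_field. f \<in> Cc Y \<Longrightarrow> f y = f y'"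
  shows "y = y'"
proof (rule ccontr)
  assume "y \<noteq> y'"
  have "openin Y (topspace Y - {y'})"
    using assms(2,4) by (simp add: closedin_Hausdorff_singleton openin_diff)
  then obtain f :: "'a \<Rightarrow> 'k" where "f \<in> Cc Y" "f y = 1" "Coz Y f \<subseteq> topspace Y - {y'}"
    using Cc_bump[OF assms(1,2), of _ y] \<open>y \<noteq> y'\<close> assms(3) by (metis Diff_iff singletonD)
  moreover have "f y' \<noteq> 0" using assms(5)[OF \<open>f \<in> Cc Y\<close>] \<open>f y = 1\<close> by simp
  ultimately show False using assms(4) by (auto simp: Coz_def)
qed

text \<open>A Banach-Stone argument: the point maps of the isomorphism and of its inverse undo each
  other, because compactly supported functions separate points.\<close>

theorem isometrically_isomorphic_Cc_imp_homeomorphic: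
  assumes Y: "locally_compact_space Y" "Hausdorff_space Y"
    and Z: "locally_compact_space Z" "Hausdorff_space Z"
    and iso: "isometrically_isomorphic Y (Cc Y :: ('a \<Rightarrow> 'k::real_normed_field) set) Z (Cc Z)"
  shows "Y homeomorphic_space Z"
proof -
  obtain \<Phi> :: "('a \<Rightarrow> 'k) \<Rightarrow> 'b \<Rightarrow> 'k" where p: "bij_betw \<Phi> (Cc Y) (Cc Z)"
    "\<forall>f\<in>Cc Y. \<forall>g\<in>Cc Y. \<Phi> (f + g) = \<Phi> f + \<Phi> g"
    "\<forall>c. \<forall>f\<in>Cc Y. \<Phi> (fscale c f) = fscale c (\<Phi> f)" "\<forall>f\<in>Cc Y. \<forall>g\<in>Cc Y. \<Phi> (f * g) = \<Phi> f * \<Phi> g"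
    using iso unfolding isometrically_isomorphic_def by auto
  let ?\<Psi> = "inv_into (Cc Y) \<Phi>"
  have i: "?\<Psi> f \<in> Cc Y" "\<Phi> (?\<Psi> f) = f" if "f \<in> Cc Z" for f
    using p(1) that by (auto simp: bij_betw_def inv_into_into f_inv_into_f)
  have j: "?\<Psi> (\<Phi> f) = f" if "f \<in> Cc Y" for f using p(1) that by (simp add: bij_betw_inv_into_left)
  have pim: "\<Phi> f \<in> Cc Z" if "f \<in> Cc Y" for f using p(1) that by (auto simp: bij_betw_def)
  have mY: "f * g \<in> Cc Y" if "f \<in> Cc Y" "g \<in> Cc Y" for f g :: "'a \<Rightarrow> 'k"
    using that by (intro Cc_mult) (auto simp: Cc_def)
  have "?\<Psi> (f + g) = ?\<Psi> f + ?\<Psi> g" if "f \<in> Cc Z" "g \<in> Cc Z" for f g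
    using j[OF Cc_add[OF i(1)[OF that(1)] i(1)[OF that(2)]]] p(2) i that by metis
  moreover have "?\<Psi> (f * g) = ?\<Psi> f * ?\<Psi> g" if "f \<in> Cc Z" "g \<in> Cc Z" for f g
    using j[OF mY[OF i(1)[OF that(1)] i(1)[OF that(2)]]] p(4) i that by metis
  moreover have "?\<Psi> (fscale c f) = fscale c (?\<Psi> f)" if "f \<in> Cc Z" for f c
    using j[OF Cc_scale[OF i(1)[OF that]]] p(3) i that by metis
  moreover have "?\<Psi> ` Cc Z = Cc Y" using bij_betw_inv_into[OF p(1)] by (simp add: bij_betw_def)
  ultimately obtain \<sigma> where s: "continuous_map Y Z \<sigma>" "\<forall>y\<in>topspace Y. \<forall>f\<in>Cc Z. ?\<Psi> f y = f (\<sigma> y)"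
    using Cc_iso_point_map[OF Z Y, of ?\<Psi>] by auto
  obtain \<tau> where t: "continuous_map Z Y \<tau>" "\<forall>z\<in>topspace Z. \<forall>f\<in>Cc Y. \<Phi> f z = f (\<tau> z)"
    using Cc_iso_point_map[OF Y Z _ p(2-4)] p(1) by (auto simp: bij_betw_def)
  have sm: "\<sigma> y \<in> topspace Z" if "y \<in> topspace Y" for y using s(1) that by (auto simp: continuous_map_def)
  have tm: "\<tau> z \<in> topspace Y" if "z \<in> topspace Z" for z using t(1) that by (auto simp: continuous_map_def)
  have "\<tau> (\<sigma> y) = y" if y: "y \<in> topspace Y" for y
  proof (rule Cc_separates_points[OF Y tm[OF sm[OF y]] y])
    fix f :: "'a \<Rightarrow> 'k" assume f: "f \<in> Cc Y"
    then show "f (\<tau> (\<sigma> y)) = f y" using s(2) t(2) y sm[OF y] j pim by metis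
  qed
  moreover have "\<sigma> (\<tau> z) = z" if z: "z \<in> topspace Z" for z
  proof (rule Cc_separates_points[OF Z sm[OF tm[OF z]] z])
    fix f :: "'b \<Rightarrow> 'k" assume f: "f \<in> Cc Z"
    then show "f (\<sigma> (\<tau> z)) = f z" using s(2) t(2) z tm[OF z] i by metis
  qed
  ultimately have "homeomorphic_maps Y Z \<sigma> \<tau>"
    unfolding homeomorphic_maps_def using s(1) t(1) by blast
  then show ?thesis unfolding homeomorphic_space_def by blast
qed

context Lindelof_partition
begin

lemma isometrically_isomorphic_CP:
  "isometrically_isomorphic X (CP Lindelof_property X :: ('a \<Rightarrow> 'k::{real_normed_field,euclidean_space}) set) Y (Cc Y)"
proof (rule isometrically_isomorphic_sym)
  show "isometrically_isomorphic Y (Cc Y :: (_ \<Rightarrow> 'k) set) X (CP Lindelof_property X)"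
    unfolding isometrically_isomorphic_def
    using bij_res sup_norm_res by (intro exI[of _ res]) (auto simp: res_def fscale_def fun_eq_iff)
qed (auto intro!: subspace_Cc Cc_mult, simp add: Cc_def)

end

subsection \<open>Dimension\<close>

lemma card_of_lists_infinite:
  assumes "infinite B"
  shows "|lists B| \<le>o |B|"
proof -
  have n: "|{xs \<in> lists B. length xs = n}| \<le>o |B|" for n
  proof (induction n)
    case 0
    have "{xs \<in> lists B. length xs = 0} = {[]}" by auto
    then show ?case using assms by (metis card_of_ordLeq_finite card_of_Well_order finite.emptyI finite.insertI ordLeq_total)
  next
    case (Suc n)
    have "{xs \<in> lists B. length xs = Suc n} \<subseteq> (\<lambda>(x, xs). x # xs) ` (B \<times> {xs \<in> lists B. length xs = n})"
      by (auto simp: length_Suc_conv image_iff)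
    then have "|{xs \<in> lists B. length xs = Suc n}| \<le>o |B \<times> {xs \<in> lists B. length xs = n}|"
      by (meson card_of_image card_of_mono1 ordLeq_transitive)
    also have "|B \<times> {xs \<in> lists B. length xs = n}| \<le>o |B|"
      using assms Suc card_of_mono1[OF subset_refl, of B]
      by (intro card_of_Sigma_ordLeq_infinite ballI) auto
    finally show ?case .
  qed
  have "lists B = (\<Union>n. {xs \<in> lists B. length xs = n})" by auto
  moreover have "|\<Union>n. {xs \<in> lists B. length xs = n}| \<le>o |B|"
    using assms n infinite_iff_card_of_nat by (intro card_of_UNION_ordLeq_infinite) auto
  ultimately show ?thesis by simp
qed

text \<open>Every element of \<open>L\<close> lies in the span of a finite list from
  \<open>B\<close>, each such span contains finitely many elements of \<open>L\<close>, and there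
  are at most \<open>|B|\<close> lists.\<close>

lemma card_of_independent_le_spanning:
  fixes L B :: "('a \<Rightarrow> 'k::field) set"
  assumes L: "funspace.independent L" "infinite L" "L \<subseteq> funspace.span B"
  shows "|L| \<le>o |B|"
proof -
  have B: "infinite B"
    using funspace.independent_span_bound[OF _ L(1,3)] L(2) by blast
  have "L \<subseteq> (\<Union>xs\<in>lists B. L \<inter> funspace.span (set xs))"
  proof
    fix l assume l: "l \<in> L"
    then obtain t r where t: "l = (\<Sum>a\<in>t. fscale (r a) a)" "finite t" "t \<subseteq> B"
      using L(3) unfolding funspace.span_explicit by blast
    obtain xs where xs: "set xs = t" using t(2) finite_list by blast
    have "l \<in> funspace.span (set xs)"
      unfolding t(1) xs by (intro funspace.span_sum funspace.span_scale funspace.span_base)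
    then show "l \<in> (\<Union>xs\<in>lists B. L \<inter> funspace.span (set xs))" using l t(3) xs by auto
  qed
  then have "|L| \<le>o |\<Union>xs\<in>lists B. L \<inter> funspace.span (set xs)|" by (rule card_of_mono1)
  also have "|\<Union>xs\<in>lists B. L \<inter> funspace.span (set xs)| \<le>o |B|"
  proof (rule card_of_UNION_ordLeq_infinite[OF B card_of_lists_infinite[OF B]], rule ballI)
    fix xs
    have "funspace.independent (L \<inter> funspace.span (set xs))"
      using L(1) funspace.independent_mono by blast
    then have "finite (L \<inter> funspace.span (set xs))"
      using funspace.independent_span_bound[of "set xs"] by blast
    then show "|L \<inter> funspace.span (set xs)| \<le>o |B|"
      using B by (metis card_of_Well_order card_of_ordLeq_finite ordLeq_total)
  qed
  finally show ?thesis .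
qed

lemma sum_fscale_apply: "(\<Sum>v\<in>F. fscale (c v) (h v)) x = (\<Sum>v\<in>F. c v * h v x)"
  by (induction F rule: infinite_finite_induct) (auto simp: fscale_def)

lemma independent_family:
  fixes w :: "'i \<Rightarrow> 'a \<Rightarrow> 'k::field"
  assumes ind: "\<And>F c. finite F \<Longrightarrow> F \<subseteq> S \<Longrightarrow> (\<And>x. (\<Sum>s\<in>F. c s * w s x) = 0) \<Longrightarrow> \<forall>s\<in>F. c s = 0"
  shows "inj_on w S" "funspace.independent (w ` S)"
proof -
  show inj: "inj_on w S"
  proof (rule inj_onI, rule ccontr)
    fix s t assume st: "s \<in> S" "t \<in> S" "w s = w t" "s \<noteq> t"
    have "\<forall>i\<in>{s, t}. (if i = s then 1 else - 1 :: 'k) = 0"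
      using st by (intro ind) auto
    then show False by simp
  qed
  show "funspace.independent (w ` S)"
    unfolding funspace.independent_explicit_finite_subsets
  proof (intro allI impI)
    fix T u assume T: "T \<subseteq> w ` S" "finite T" "(\<Sum>v\<in>T. fscale (u v) v) = 0"
    then obtain F where F: "F \<subseteq> S" "finite F" "T = w ` F" by (meson finite_subset_image)
    have "(\<Sum>s\<in>F. u (w s) * w s x) = 0" for x
    proof -
      have "(\<Sum>v\<in>T. fscale (u v) v) x = 0" using T(3) by simp
      then have "(\<Sum>v\<in>T. u v * v x) = 0" unfolding sum_fscale_apply .
      then show ?thesis unfolding F(3) using inj_on_subset[OF inj F(1)] by (simp add: sum.reindex)
    qed
    then have "\<forall>s\<in>F. u (w s) = 0" by (intro ind F)
    then show "\<forall>v\<in>T. u v = 0" using F(3) by auto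
  qed
qed

text \<open>Divide by the power with the smallest exponent whose coefficient is nonzero and pass to
  the limit: only that coefficient survives.\<close>

lemma powr_independent:
  fixes c :: "real \<Rightarrow> 'k::real_normed_field" and v :: "nat \<Rightarrow> real"
  assumes F: "finite F" and v: "\<And>n. v n > 0" "v \<longlonglongrightarrow> 0"
    and z: "\<And>n. (\<Sum>s\<in>F. c s * of_real (v n powr s)) = 0"
  shows "\<forall>s\<in>F. c s = 0"
proof (rule ccontr)
  define T where "T = {s \<in> F. c s \<noteq> 0}"
  assume "\<not> ?thesis"
  then have T: "finite T" "T \<noteq> {}" using F by (auto simp: T_def)
  define s0 where "s0 = Min T"
  have s0: "s0 \<in> T" "\<And>s. s \<in> T \<Longrightarrow> s0 \<le> s" unfolding s0_def using T by auto
  have zero: "(\<Sum>s\<in>T. c s * of_real (v n powr (s - s0))) = 0" for n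
  proof -
    have "(\<Sum>s\<in>T. c s * of_real (v n powr s)) = (\<Sum>s\<in>F. c s * of_real (v n powr s))"
      unfolding T_def using F by (intro sum.mono_neutral_left) auto
    then have "of_real (v n powr (- s0)) * (\<Sum>s\<in>T. c s * of_real (v n powr s)) = 0" using z by simp
    then show ?thesis
      unfolding sum_distrib_left using v(1)[of n]
      by (simp add: mult.left_commute powr_add[symmetric] add.commute flip: of_real_mult)
  qed
  have "(\<lambda>n. \<Sum>s\<in>T. c s * of_real (v n powr (s - s0))) \<longlonglongrightarrow> (\<Sum>s\<in>T. if s = s0 then c s else 0)"
  proof (rule tendsto_sum)
    fix s assume s: "s \<in> T"
    show "(\<lambda>n. c s * of_real (v n powr (s - s0))) \<longlonglongrightarrow> (if s = s0 then c s else 0)"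
    proof (cases "s = s0")
      case True
      then show ?thesis using v(1) by (simp add: less_imp_neq[THEN not_sym])
    next
      case False
      then have "s - s0 > 0" using s0(2)[OF s] by simp
      then have "(\<lambda>n. v n powr (s - s0)) \<longlonglongrightarrow> 0" 
        using v(2) less_imp_le[OF v(1)] by (intro tendsto_zero_powrI always_eventually allI) auto
      then have "(\<lambda>n. c s * of_real (v n powr (s - s0))) \<longlonglongrightarrow> c s * of_real 0"
        by (intro tendsto_intros)
      then show ?thesis using False by simp
    qed
  qed
  then have "(\<Sum>s\<in>T. if s = s0 then c s else 0) = 0"
    unfolding zero using LIMSEQ_unique tendsto_const by blast
  then have "c s0 = 0" using T(1) s0(1) by simp
  then show False using s0(1) by (simp add: T_def)
qed

lemma card_of_nat_exp: "natLeq ^c natLeq = |UNIV :: (nat \<Rightarrow> nat) set|"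
  unfolding cexp_def by (simp add: Field_natLeq Func_def)

lemma card_of_exp_nat: "|D| ^c natLeq = |{s :: nat \<Rightarrow> 'b. range s \<subseteq> D}|"
  unfolding cexp_def by (simp add: Field_natLeq Field_card_of Func_def image_subset_iff)

text \<open>A function is coded by its graph, a set of naturals via \<open>prod_encode\<close>; such
  sets are equinumerous with the reals.\<close>

lemma nat_exp_le_real_interval: "natLeq ^c natLeq \<le>o |{0<..<1::real}|"
proof -
  have "inj (\<lambda>f :: nat \<Rightarrow> nat. range (\<lambda>n. prod_encode (n, f n)))"
  proof (rule injI, rule ext)
    fix f g :: "nat \<Rightarrow> nat" and n
    assume "range (\<lambda>n. prod_encode (n, f n)) = range (\<lambda>n. prod_encode (n, g n))"
    then have "prod_encode (n, f n) \<in> range (\<lambda>n. prod_encode (n, g n))" by blast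
    then show "f n = g n" by (auto simp: prod_encode_eq)
  qed
  then have "|UNIV :: (nat \<Rightarrow> nat) set| \<le>o |UNIV :: nat set set|"
    using card_of_ordLeq by blast
  moreover have "(UNIV :: nat set set) \<lesssim> {0<..<1::real}"
    using nat_sets_eqpoll_reals open_interval_eqpoll_reals[of 0 1]
    by (meson eqpoll_imp_lepoll eqpoll_sym lepoll_trans zero_less_one)
  then have "|UNIV :: nat set set| \<le>o |{0<..<1::real}|"
    unfolding lepoll_def using card_of_ordLeq by blast
  ultimately show ?thesis unfolding card_of_nat_exp by (rule ordLeq_transitive)
qed

text \<open>With a countable base, a sequence is determined by recording which term lies in which
  basic set.\<close>

lemma card_of_scalar_sequences: "|UNIV :: (nat \<Rightarrow> 'k::euclidean_space) set| \<le>o natLeq ^c natLeq"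
proof -
  obtain B :: "nat \<Rightarrow> 'k set"
    where B: "inj B" "\<And>n. open (B n)" "\<And>S. open S \<Longrightarrow> \<exists>k. S = \<Union>{B n |n. n \<in> k}"
    by (rule univ_second_countable_sequence[where ?'a = 'k], rule that) auto
  define h :: "(nat \<Rightarrow> 'k) \<Rightarrow> nat \<Rightarrow> nat" where
    "h v m = (case prod_decode m of (n, i) \<Rightarrow> if v n \<in> B i then 1 else 0)" for v m
  have "inj h"
  proof (rule injI, rule ext, rule ccontr)
    fix v w :: "nat \<Rightarrow> 'k" and n assume h: "h v = h w" and ne: "v n \<noteq> w n"
    obtain S where "open S" "v n \<in> S" "w n \<notin> S" using ne t1_space by blast
    then obtain i where i: "v n \<in> B i" "w n \<notin> B i" using B(3)[OF \<open>open S\<close>] by blast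
    have "h v (prod_encode (n, i)) = h w (prod_encode (n, i))" using h by simp
    then show False using i by (simp add: h_def)
  qed
  then show ?thesis unfolding card_of_nat_exp using card_of_ordLeq by blast
qed

lemma (in Metric_space) Lindelof_countable_dense:
  assumes C: "C \<subseteq> M" and L: "Lindelof_space (subtopology mtopology C)"
  shows "\<exists>D\<subseteq>C. countable D \<and> C \<subseteq> mtopology closure_of D"
proof -
  have "\<exists>K. countable K \<and> K \<subseteq> C \<and> C \<subseteq> (\<Union>y\<in>K. mball y (1 / real (Suc n)))" for n
  proof -
    let ?\<U> = "(\<lambda>y. mball y (1 / real (Suc n))) ` C"
    have "(\<forall>U\<in>?\<U>. openin mtopology U) \<and> C \<subseteq> \<Union>?\<U>" using C by auto
    then have "\<exists>\<V>. countable \<V> \<and> \<V> \<subseteq> ?\<U> \<and> C \<subseteq> \<Union>\<V>"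
      using L Lindelof_space_subtopology_subset[of C mtopology] C by (simp only: topspace_mtopology) blast
    then show ?thesis by (metis countable_subset_image)
  qed
  then obtain K where K: "\<And>n. countable (K n) \<and> K n \<subseteq> C \<and> C \<subseteq> (\<Union>y\<in>K n. mball y (1 / real (Suc n)))"
    by metis
  have "C \<subseteq> mtopology closure_of (\<Union>n. K n)"
    unfolding metric_closure_of
  proof (intro subsetI CollectI conjI allI impI)
    fix x assume x: "x \<in> C"
    then show "x \<in> M" using C by blast
    fix r :: real assume r: "r > 0"
    obtain n where n: "1 / real (Suc n) < r" using r nat_approx_posE by blast
    obtain y where y: "y \<in> K n" "x \<in> mball y (1 / real (Suc n))" using K[of n] x by blast
    then have "y \<in> mball x r" using n by (auto simp: commute)
    then show "\<exists>y\<in>\<Union>n. K n. y \<in> mball x r" using y by blast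
  qed
  then show ?thesis using K by (intro exI[of _ "\<Union>n. K n"]) auto
qed

context Lindelof_partition
begin

lemma ex_countable_dense:
  assumes "C \<in> I"
  shows "\<exists>D\<subseteq>C. countable D \<and> C \<subseteq> X closure_of D"
proof -
  obtain M d where Md: "Metric_space M d" "X = Metric_space.mtopology M d"
    using metrizable unfolding metrizable_space_def by blast
  have "C \<subseteq> M" using openin_subset[OF open_member[OF assms]] Md Metric_space.topspace_mtopology by metis
  then show ?thesis
    using Metric_space.Lindelof_countable_dense[OF Md(1)] Lindelof_member[OF assms] Md(2) by metis
qed

text \<open>The cardinal \<open>Q\<close> will be \<open>|I|\<close> for infinite \<open>I\<close>
  and \<open>natLeq\<close> for finite \<open>I\<close>, that is, the Lindelof number in both
  cases.\<close>

lemma card_of_CP_le: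
  assumes Q: "|I| \<le>o Q" "Cinfinite Q"
  shows "|CP Lindelof_property X :: ('a \<Rightarrow> 'k::{real_normed_field,euclidean_space}) set| \<le>o Q ^c natLeq"
proof -
  let ?A = "CP Lindelof_property X :: ('a \<Rightarrow> 'k) set"
  obtain D where D: "\<And>C. C \<in> I \<Longrightarrow> D C \<subseteq> C \<and> countable (D C) \<and> C \<subseteq> X closure_of (D C)"
    using ex_countable_dense by metis
  define \<D> where "\<D> = (\<Union>C\<in>I. D C)"
  have natQ: "natLeq \<le>o Q" using Q(2) natLeq_ordLeq_cinfinite by blast
  have "|D C| \<le>o Q" if "C \<in> I" for C
    using D[OF that] natQ countable_card_le_natLeq ordLeq_transitive by blast
  then have cE: "|\<D>| \<le>o Q" unfolding \<D>_def using Q by (intro UNION_Cinfinite_bound ballI)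
  have dense: "X closure_of \<D> = topspace X"
  proof (rule antisym[OF closure_of_subset_topspace])
    show "topspace X \<subseteq> X closure_of \<D>"
      unfolding Union_members[symmetric]
    proof (rule Union_least)
      fix C assume C: "C \<in> I"
      have "X closure_of (D C) \<subseteq> X closure_of \<D>" unfolding \<D>_def using C by (intro closure_of_mono) blast
      then show "C \<subseteq> X closure_of \<D>" using D[OF C] by blast
    qed
  qed
  then have "\<D> \<noteq> {}" using nonempty closure_of_empty by metis
  have "\<exists>s :: nat \<Rightarrow> 'a. range s \<subseteq> \<D> \<and> {x \<in> \<D>. f x \<noteq> 0} \<subseteq> range s" if f: "f \<in> ?A" for f
  proof -
    obtain J where J: "f \<in> Cb X" "J \<subseteq> I" "countable J" "Coz X f \<subseteq> \<Union>J" using f by (rule CP_E)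
    have "{x \<in> \<D>. f x \<noteq> 0} \<subseteq> (\<Union>C\<in>J. D C)"
    proof
      fix x assume x: "x \<in> {x \<in> \<D>. f x \<noteq> 0}"
      then obtain C where C: "C \<in> I" "x \<in> D C" unfolding \<D>_def by blast
      have "x \<in> topspace X" using x CbD(3)[OF J(1)] by blast
      then obtain C' where C': "C' \<in> J" "x \<in> C'" using x J(4) by (auto simp: Coz_def)
      have "x \<in> C" using C D by blast
      then have "C = C'" using same_member C(1) C' J(2) by blast
      then show "x \<in> (\<Union>C\<in>J. D C)" using C C' by blast
    qed
    then have cn: "countable {x \<in> \<D>. f x \<noteq> 0}"
      using J(2,3) D by (meson countable_UN countable_subset subsetD)
    \<comment> \<open>The extra point keeps the enumerated set nonempty when \<open>f\<close> is
      zero.\<close>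
    obtain a where "a \<in> \<D>" using \<open>\<D> \<noteq> {}\<close> by blast
    let ?s = "from_nat_into (insert a {x \<in> \<D>. f x \<noteq> 0})"
    have "range ?s = insert a {x \<in> \<D>. f x \<noteq> 0}" using cn by (intro range_from_nat_into) auto
    then show ?thesis using \<open>a \<in> \<D>\<close> by (intro exI[of _ ?s]) auto
  qed
  then obtain s :: "('a \<Rightarrow> 'k) \<Rightarrow> nat \<Rightarrow> 'a" where s: "\<And>f. f \<in> ?A \<Longrightarrow> range (s f) \<subseteq> \<D> \<and> {x \<in> \<D>. f x \<noteq> 0} \<subseteq> range (s f)"
    by metis
  let ?P = "{s :: nat \<Rightarrow> 'a. range s \<subseteq> \<D>} \<times> (UNIV :: (nat \<Rightarrow> 'k) set)"
  \<comment> \<open>Functions with the same sequence and the same values agree on its range; at the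
    other points of \<open>\<D>\<close> both vanish, and \<open>\<D>\<close> is dense.\<close>
  have "inj_on (\<lambda>f. (s f, f \<circ> s f)) ?A"
  proof (rule inj_onI)
    fix f g assume fg: "f \<in> ?A" "g \<in> ?A" "(s f, f \<circ> s f) = (s g, g \<circ> s g)"
    then have eq: "s f = s g" "f (s g n) = g (s g n)" for n by (auto simp: fun_eq_iff)
    have fgb: "f \<in> Cb X" "g \<in> Cb X" using fg by (auto simp: CP_def)
    have onE: "f x = g x" if x: "x \<in> \<D>" for x
    proof (cases "x \<in> range (s g)")
      case True
      then show ?thesis using eq by auto
    next
      case False
      have "{x \<in> \<D>. f x \<noteq> 0} \<subseteq> range (s g)" "{x \<in> \<D>. g x \<noteq> 0} \<subseteq> range (s g)"
        using s[OF fg(1)] s[OF fg(2)] unfolding eq(1) by blast+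
      then have "f x = 0" "g x = 0" using x False by blast+
      then show ?thesis by simp
    qed
    have "closedin X {x \<in> topspace X. f x = g x}"
      by (rule closedin_continuous_maps_eq[OF _ CbD(1)[OF fgb(1)] CbD(1)[OF fgb(2)]]) simp
    moreover have "\<D> \<subseteq> topspace X" unfolding \<D>_def using D Union_members by blast
    ultimately have "X closure_of \<D> \<subseteq> {x \<in> topspace X. f x = g x}"
      using onE by (intro closure_of_minimal) auto
    then have "f x = g x" for x
      using dense CbD(3)[OF fgb(1)] CbD(3)[OF fgb(2)] by (cases "x \<in> topspace X") auto
    then show "f = g" by (rule ext)
  qed
  moreover have "(\<lambda>f. (s f, f \<circ> s f)) ` ?A \<subseteq> ?P" using s by blast
  ultimately have "|?A| \<le>o |?P|" using card_of_ordLeq by blast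
  also have "|?P| \<le>o Q ^c natLeq"
  proof -
    have 1: "|{s :: nat \<Rightarrow> 'a. range s \<subseteq> \<D>}| \<le>o Q ^c natLeq"
      using cexp_mono1[OF cE natLeq_Card_order] unfolding card_of_exp_nat .
    have 2: "|UNIV :: (nat \<Rightarrow> 'k) set| \<le>o Q ^c natLeq"
      using card_of_scalar_sequences cexp_mono1[OF natQ natLeq_Card_order] ordLeq_transitive by blast
    have "Cinfinite (Q ^c natLeq)"
      using Q(2) natLeq_Cinfinite by (intro Cinfinite_cexp ctwo_ordLeq_Cinfinite)
    then show ?thesis
      using card_of_Times_ordLeq_infinite_Field[OF _ 1 2] unfolding cinfinite_def by blast
  qed
  finally show ?thesis .
qed

text \<open>The branches of the tree of finite sequences in \<open>I\<close>, transported to \<open>I\<close>, form an almost disjoint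
  family, and the indicator functions of almost disjoint infinite sets are linearly independent.\<close>

lemma ex_large_independent_indicators:
  assumes inf: "infinite I"
  shows "\<exists>U \<subseteq> (CP Lindelof_property X :: ('a \<Rightarrow> 'k::real_normed_field) set).
           funspace.independent U \<and> infinite U \<and> |I| ^c natLeq \<le>o |U|"
proof -
  obtain g where g: "inj_on g (lists I)" "g ` lists I \<subseteq> I"
    using card_of_lists_infinite[OF inf] unfolding card_of_ordLeq[symmetric] by blast
  define S where "S = {s :: nat \<Rightarrow> 'a set. range s \<subseteq> I}"
  define br where "br s = range (\<lambda>n. g (map s [0..<n]))" for s
  define w :: "(nat \<Rightarrow> 'a set) \<Rightarrow> 'a \<Rightarrow> 'k" where "w s = ind (br s)" for s
  have l: "map s [0..<n] \<in> lists I" if "s \<in> S" for s n using that by (auto simp: S_def image_subset_iff)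
  have brI: "br s \<subseteq> I" if "s \<in> S" for s unfolding br_def using g(2) l[OF that] by blast
  have brc: "countable (br s)" for s unfolding br_def by simp
  have bri: "infinite (br s)" if "s \<in> S" for s
  proof -
    have "inj (\<lambda>n. g (map s [0..<n]))"
    proof (rule injI)
      fix m n assume "g (map s [0..<m]) = g (map s [0..<n])"
      then have "map s [0..<m] = map s [0..<n]" using inj_onD[OF g(1)] l[OF that] by blast
      then have "length (map s [0..<m]) = length (map s [0..<n])" by (rule arg_cong)
      then show "m = n" by simp
    qed
    then show ?thesis unfolding br_def by (rule range_inj_infinite)
  qed
  have brad: "finite (br s \<inter> br t)" if st: "s \<in> S" "t \<in> S" "s \<noteq> t" for s t
  proof -
    \<comment> \<open>A prefix of length greater than \<open>k\<close> records entry
      \<open>k\<close>, so a common node has length at most \<open>k\<close>.\<close>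
    obtain k where k: "s k \<noteq> t k" using st(3) by blast
    have "br s \<inter> br t \<subseteq> (\<lambda>n. g (map s [0..<n])) ` {..k}"
    proof
      fix C assume "C \<in> br s \<inter> br t"
      then obtain m n where mn: "C = g (map s [0..<m])" "C = g (map t [0..<n])" unfolding br_def by blast
      then have eq: "map s [0..<m] = map t [0..<n]" using inj_onD[OF g(1)] l st by metis
      then have "length (map s [0..<m]) = length (map t [0..<n])" by (rule arg_cong)
      then have "m = n" by simp
      have "m \<le> k"
      proof (rule ccontr)
        assume "\<not> m \<le> k"
        then have "map s [0..<m] ! k = s k" "map t [0..<n] ! k = t k" using \<open>m = n\<close> by auto
        then show False using eq k by simp
      qed
      then show "C \<in> (\<lambda>n. g (map s [0..<n])) ` {..k}" using mn(1) by blast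
    qed
    then show ?thesis using finite_subset by blast
  qed
  have *: "\<forall>s\<in>F. c s = 0" if F: "finite F" "F \<subseteq> S" and z: "\<And>x. (\<Sum>s\<in>F. c s * w s x) = 0" for F c
  proof
    fix s assume s: "s \<in> F"
    \<comment> \<open>The other branches remove finitely many members from the infinite
      \<open>br s\<close>. At a point of a remaining member the linear relation reduces to
      \<open>c s = 0\<close>.\<close>
    have "finite (\<Union>t\<in>F - {s}. br s \<inter> br t)" using F s brad by (intro finite_UN_I) auto
    then have "infinite (br s - (\<Union>t\<in>F - {s}. br s \<inter> br t))" using bri F s by (meson Diff_infinite_finite subsetD)
    then obtain C where C: "C \<in> br s" "C \<notin> (\<Union>t\<in>F - {s}. br s \<inter> br t)"
      using infinite_imp_nonempty by blast
    then have CI: "C \<in> I" using brI s F by blast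
    then obtain x where x: "x \<in> C" using nonempty_member by blast
    have "w t x = (if t = s then 1 else 0)" if "t \<in> F" for t
    proof -
      have "x \<in> \<Union>(br t) \<longleftrightarrow> C \<in> br t"
        using x CI brI[of t] that F(2) same_member[OF CI _ x] by blast
      then show ?thesis using C that unfolding w_def ind_def by auto
    qed
    then have "(\<Sum>t\<in>F. c t * w t x) = (\<Sum>t\<in>F. if t = s then c s else 0)" by (intro sum.cong) auto
    also have "\<dots> = c s" using F(1) s by simp
    finally show "c s = 0" using z by simp
  qed
  have inj: "inj_on w S" and indep: "funspace.independent (w ` S)"
    using independent_family[of S w] * by blast+
  have "|w ` S| =o |S|" using inj by (meson card_of_ordIsoI inj_on_imp_bij_betw ordIso_symmetric)
  then have le: "|I| ^c natLeq \<le>o |w ` S|"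
    unfolding card_of_exp_nat S_def[symmetric] using ordIso_symmetric ordIso_iff_ordLeq by blast
  have "\<not> finite (w ` S)"
  proof
    assume "finite (w ` S)"
    then have "finite S" using inj finite_imageD by blast
    moreover have "inj_on (\<lambda>C (n :: nat). C) I" by (auto simp: inj_on_def fun_eq_iff)
    moreover have "(\<lambda>C (n :: nat). C) ` I \<subseteq> S" by (auto simp: S_def)
    ultimately show False using inf by (meson finite_imageD finite_subset)
  qed
  moreover have "w ` S \<subseteq> CP Lindelof_property X"
    unfolding w_def using ind_in_CP brI brc by blast
  ultimately show ?thesis using indep le by blast
qed

text \<open>As \<open>I\<close> is countable, every function in \<open>Cb X\<close> belongs to the
  algebra. Points converging to the non-isolated \<open>p\<close> separate the powers of the
  distance from \<open>p\<close> by their decay.\<close>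

lemma ex_large_independent_powers:
  assumes cI: "countable I" and p: "p \<in> topspace X" "\<not> openin X {p}"
  shows "\<exists>U \<subseteq> (CP Lindelof_property X :: ('a \<Rightarrow> 'k::real_normed_field) set).
           funspace.independent U \<and> infinite U \<and> natLeq ^c natLeq \<le>o |U|"
proof -
  obtain M d where Md: "Metric_space M d" "X = Metric_space.mtopology M d"
    using metrizable unfolding metrizable_space_def by blast
  then interpret Metric_space M d by simp
  have tM: "topspace X = M" using Md by simp
  have pM: "p \<in> M" using p tM by simp
  have "\<exists>x. x \<in> M \<and> x \<noteq> p \<and> d p x < 1 / real (Suc n)" for n
  proof (rule ccontr)
    assume "\<not> ?thesis"
    then have "mball p (1 / real (Suc n)) = {p}" using pM by auto
    then show False using p(2) openin_mball[of p "1 / real (Suc n)"] Md(2) by simp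
  qed
  then obtain x where x: "\<And>n. x n \<in> M \<and> x n \<noteq> p \<and> d p (x n) < 1 / real (Suc n)" by metis
  \<comment> \<open>Truncation at 1 keeps the powers bounded; positive exponents keep them
    continuous at \<open>p\<close>, where \<open>g\<close> is 0.\<close>
  define g where "g y = min 1 (d p y)" for y
  define w :: "real \<Rightarrow> 'a \<Rightarrow> 'k" where "w s y = (if y \<in> M then of_real (g y powr s) else 0)" for s y
  have g1: "d p (x n) \<le> 1" for n
    using x[of n] by (smt (verit) divide_le_eq_1_pos of_nat_0_less_iff of_nat_Suc of_nat_0_le_iff)
  have gx: "g (x n) = d p (x n)" for n unfolding g_def using g1[of n] by simp
  have pos: "g (x n) > 0" for n unfolding gx using x[of n] pM mdist_pos_less by auto
  have lim: "(\<lambda>n. g (x n)) \<longlonglongrightarrow> 0"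
  proof (rule tendsto_sandwich[of "\<lambda>_. 0" _ _ "\<lambda>n. 1 / real (Suc n)"])
    show "\<forall>\<^sub>F n in sequentially. g (x n) \<le> 1 / real (Suc n)" unfolding gx using x by (simp add: less_imp_le)
    show "(\<lambda>n. 1 / real (Suc n)) \<longlonglongrightarrow> 0" using LIMSEQ_inverse_real_of_nat by (simp add: inverse_eq_divide)
    show "\<forall>\<^sub>F n in sequentially. 0 \<le> g (x n)" using less_imp_le[OF pos] by simp
  qed simp
  have *: "\<forall>s\<in>F. c s = 0" if F: "finite F" "F \<subseteq> {0<..<1}" and z: "\<And>y. (\<Sum>s\<in>F. c s * w s y) = 0" for F c
  proof (rule powr_independent[OF F(1) pos lim])
    fix n show "(\<Sum>s\<in>F. c s * of_real (g (x n) powr s)) = 0" using z[of "x n"] x[of n] by (simp add: w_def)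
  qed
  have inj: "inj_on w {0<..<1}" and indep: "funspace.independent (w ` {0<..<1})"
    using independent_family[of "{0<..<1}" w] * by blast+
  have iso: "|w ` {0<..<1}| =o |{0<..<1::real}|"
    using inj by (meson card_of_ordIsoI inj_on_imp_bij_betw ordIso_symmetric)
  have le: "natLeq ^c natLeq \<le>o |w ` {0<..<1}|"
    using nat_exp_le_real_interval ordIso_symmetric[OF iso] by (rule ordLeq_ordIso_trans)
  have "infinite (w ` {0<..<1})" using inj finite_imageD[of w "{0<..<1}"] infinite_Ioo[of 0 "1::real"] by auto
  moreover have "w s \<in> CP Lindelof_property X" if s: "s \<in> {0<..<1}" for s
  proof (rule CP_I[of _ I])
    have "continuous_map X euclidean (d p)"
    proof -
      have "continuous_map mtopology euclidean (\<lambda>y. d p y)"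
        using continuous_map_mdist[of mtopology "metric (M, d)" "\<lambda>_. p" "\<lambda>y. y"] pM by simp
      then show ?thesis using Md(2) by simp
    qed
    then have gc: "continuous_map X euclidean g"
      unfolding g_def by (auto simp: continuous_map_atin limitin_canonical_iff intro!: tendsto_intros)
    have "continuous_map X euclidean (\<lambda>y. of_real (g y powr s) :: 'k)"
      unfolding continuous_map_atin limitin_canonical_iff
    proof (intro ballI tendsto_of_real)
      fix y assume "y \<in> topspace X"
      then have gy: "(g \<longlongrightarrow> g y) (atin X y)" using gc unfolding continuous_map_atin limitin_canonical_iff by blast
      show "((\<lambda>y. g y powr s) \<longlongrightarrow> g y powr s) (atin X y)"
      proof (rule tendsto_powr'[OF gy tendsto_const])
        have "0 \<le> g z" for z by (simp add: g_def)
        then show "g y \<noteq> 0 \<or> 0 < s \<and> (\<forall>\<^sub>F z in atin X y. 0 \<le> g z)" using s by simp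
      qed
    qed
    then have "continuous_map X euclidean (w s)" by (rule continuous_map_eq) (simp add: w_def tM)
    moreover have "norm (w s y) \<le> 1" for y
    proof -
      have "0 \<le> g y" "g y \<le> 1" by (auto simp: g_def)
      then have "g y powr s \<le> 1" using s by (intro powr_le1) auto
      then show ?thesis by (simp add: w_def)
    qed
    then have "bounded (w s ` topspace X)" unfolding bounded_iff by blast
    ultimately show "w s \<in> Cb X" by (simp add: Cb_def w_def tM)
  qed (use cI Coz_subset[of X "w s"] Union_members in auto)
  ultimately show ?thesis using indep le by blast
qed

lemma Hamel_dim_CP_basis:
  obtains B :: "('a \<Rightarrow> 'k::real_normed_field) set"
  where "is_Hamel_basis (CP Lindelof_property X) B" "Hamel_dim (CP Lindelof_property X :: ('a \<Rightarrow> 'k) set) = |B|"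
  using someI_ex[OF ex_Hamel_basis[OF subspace_CP]] unfolding Hamel_dim_def by blast

lemma card_of_independent_le_Hamel_dim:
  fixes U :: "('a \<Rightarrow> 'k::real_normed_field) set"
  assumes "U \<subseteq> CP Lindelof_property X" "funspace.independent U" "infinite U"
  shows "|U| \<le>o Hamel_dim (CP Lindelof_property X :: ('a \<Rightarrow> 'k) set)"
proof -
  obtain B :: "('a \<Rightarrow> 'k) set" where B: "is_Hamel_basis (CP Lindelof_property X) B"
    "Hamel_dim (CP Lindelof_property X :: ('a \<Rightarrow> 'k) set) = |B|" by (rule Hamel_dim_CP_basis)
  show ?thesis
    unfolding B(2) using assms B(1) by (intro card_of_independent_le_spanning) (auto simp: is_Hamel_basis_def)
qed

lemma Hamel_dim_le_card_of:
  "Hamel_dim (CP Lindelof_property X :: ('a \<Rightarrow> 'k::real_normed_field) set) \<le>o |CP Lindelof_property X :: ('a \<Rightarrow> 'k) set|"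
proof -
  obtain B :: "('a \<Rightarrow> 'k) set" where B: "is_Hamel_basis (CP Lindelof_property X) B"
    "Hamel_dim (CP Lindelof_property X :: ('a \<Rightarrow> 'k) set) = |B|" by (rule Hamel_dim_CP_basis)
  show ?thesis unfolding B(2) using B(1) by (intro card_of_mono1) (simp add: is_Hamel_basis_def)
qed

text \<open>The cover \<open>I\<close> has no proper subcover, which gives the lower bound; for the
  upper bound, countably many sets of a cover suffice on each member.\<close>

lemma Lindelof_number_infinite:
  assumes inf: "infinite I"
  shows "Lindelof_number X =o |I|"
proof -
  define r where "r = (SOME r. is_min_cover_card X r)"
  have "is_min_cover_card X r" unfolding r_def using ex_min_cover_card by (rule someI_ex)
  then have r: "Card_order r" "covers_reduce_to X r" "\<And>s. Card_order s \<Longrightarrow> covers_reduce_to X s \<Longrightarrow> r \<le>o s"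
    unfolding is_min_cover_card_def by auto
  have natI: "natLeq \<le>o |I|" using inf infinite_iff_natLeq_ordLeq by blast
  have "covers_reduce_to X |I|"
    unfolding covers_reduce_to_def
  proof (intro allI impI, elim conjE)
    fix \<U> assume U: "\<forall>U\<in>\<U>. openin X U" "\<Union>\<U> = topspace X"
    have "\<exists>\<V>. countable \<V> \<and> \<V> \<subseteq> \<U> \<and> C \<subseteq> \<Union>\<V>" if C: "C \<in> I" for C
    proof -
      have "C \<subseteq> topspace X" using C Union_members by blast
      then show ?thesis
        using Lindelof_member[OF C] U Lindelof_space_subtopology_subset[of C X] by metis
    qed
    then obtain V where V: "\<And>C. C \<in> I \<Longrightarrow> countable (V C) \<and> V C \<subseteq> \<U> \<and> C \<subseteq> \<Union>(V C)" by metis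
    have "|V C| \<le>o |I|" if "C \<in> I" for C
    proof -
      have "|V C| \<le>o natLeq" using V[OF that] by (simp only: countable_card_le_natLeq)
      then show ?thesis using natI by (rule ordLeq_transitive)
    qed
    then have "|\<Union>C\<in>I. V C| \<le>o |I|"
      using inf card_of_mono1[OF subset_refl, of I] by (intro card_of_UNION_ordLeq_infinite ballI) auto
    moreover have "(\<Union>C\<in>I. V C) \<subseteq> \<U>" using V by blast
    moreover have "\<Union>(\<Union>C\<in>I. V C) = topspace X"
    proof
      show "\<Union>(\<Union>C\<in>I. V C) \<subseteq> topspace X" using V U(2) by blast
      show "topspace X \<subseteq> \<Union>(\<Union>C\<in>I. V C)" 
      proof
        fix x assume "x \<in> topspace X"
        then obtain C where "C \<in> I" "x \<in> C" using Union_members by auto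
        then show "x \<in> \<Union>(\<Union>C\<in>I. V C)" using V[of C] by blast
      qed
    qed
    ultimately show "\<exists>\<V>\<subseteq>\<U>. \<Union>\<V> = topspace X \<and> |\<V>| \<le>o |I|" by blast
  qed
  then have 1: "r \<le>o |I|" using r(3) card_of_Card_order by blast
  obtain \<V> where V: "\<V> \<subseteq> I" "\<Union>\<V> = topspace X" "|\<V>| \<le>o r"
    using r(2) open_member Union_members unfolding covers_reduce_to_def by metis
  have "I \<subseteq> \<V>"
  proof
    fix C assume C: "C \<in> I"
    then obtain x where x: "x \<in> C" using nonempty_member by blast
    then obtain C' where "C' \<in> \<V>" "x \<in> C'" using V(2) C Union_members by blast
    then show "C \<in> \<V>" using same_member[OF C _ x] V(1) by blast
  qed
  then have "r =o |I|" using V 1 ordIso_iff_ordLeq by (metis subset_antisym)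
  then have "r +c natLeq =o |I| +c natLeq" by (rule csum_cong1)
  also have "|I| +c natLeq =o |I|"
    using natI inf by (intro csum_absorb1) (auto simp: cinfinite_def Field_card_of card_of_card_order_on)
  finally show ?thesis unfolding Lindelof_number_def r_def .
qed

lemma Lindelof_number_countable:
  assumes cI: "countable I" and inf: "infinite (topspace X)"
  shows "Lindelof_number X =o natLeq"
proof -
  define r where "r = (SOME r. is_min_cover_card X r)"
  have "is_min_cover_card X r" unfolding r_def using ex_min_cover_card by (rule someI_ex)
  then have r: "\<And>s. Card_order s \<Longrightarrow> covers_reduce_to X s \<Longrightarrow> r \<le>o s"
    unfolding is_min_cover_card_def by auto
  obtain N where N: "countable N" "infinite N" "N \<subseteq> topspace X"
    using inf by (meson infinite_countable_subset')
  \<comment> \<open>Minimality is tested against cardinals on \<open>'a set\<close>, so the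
    countable infinite cardinal has to be realised there, by singletons.\<close>
  let ?N = "(\<lambda>x. {x}) ` N"
  have Ni: "infinite ?N" using N(2) by (auto dest!: finite_imageD simp: inj_on_def)
  then have le: "natLeq \<le>o |?N|" using infinite_iff_natLeq_ordLeq by blast
  have "covers_reduce_to X |?N|"
    unfolding covers_reduce_to_def
  proof (intro allI impI, elim conjE)
    fix \<U> assume U: "\<forall>U\<in>\<U>. openin X U" "\<Union>\<U> = topspace X"
    have "Lindelof_space X" using cI by (simp add: Lindelof_iff_countable)
    then obtain \<V> where V: "countable \<V>" "\<V> \<subseteq> \<U>" "\<Union>\<V> = topspace X"
      using U by (metis Lindelof_spaceD)
    have "|\<V>| \<le>o natLeq" using V(1) by (simp only: countable_card_le_natLeq)
    then have "|\<V>| \<le>o |?N|" using le by (rule ordLeq_transitive)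
    then show "\<exists>\<V>\<subseteq>\<U>. \<Union>\<V> = topspace X \<and> |\<V>| \<le>o |?N|" using V by blast
  qed
  then have "r \<le>o |?N|" using r card_of_Card_order by blast
  moreover have "|?N| \<le>o natLeq" using N(1) countable_card_le_natLeq by blast
  ultimately have "r \<le>o natLeq" by (rule ordLeq_transitive)
  then show ?thesis
    unfolding Lindelof_number_def r_def[symmetric] by (intro csum_absorb2 natLeq_Cinfinite)
qed

lemma Hamel_dim_CP:
  assumes inf: "infinite (topspace X)"
  shows "Hamel_dim (CP Lindelof_property X :: ('a \<Rightarrow> 'k::{real_normed_field,euclidean_space}) set)
           =o Lindelof_number X ^c natLeq"
proof -
  let ?A = "CP Lindelof_property X :: ('a \<Rightarrow> 'k) set"
  \<comment> \<open>\<open>Q\<close> has a type of its own, since it is used both for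
    \<open>|I|\<close> and for \<open>natLeq\<close>.\<close>
  have main: "Hamel_dim ?A =o Lindelof_number X ^c natLeq"
    if iso: "Lindelof_number X =o Q" and Q: "|I| \<le>o Q" "Cinfinite Q"
      and U: "\<exists>U\<subseteq>?A. funspace.independent U \<and> infinite U \<and> Q ^c natLeq \<le>o |U|" for Q :: "'q rel"
  proof -
    have "Q ^c natLeq \<le>o Hamel_dim ?A"
      using U card_of_independent_le_Hamel_dim ordLeq_transitive by blast
    moreover have "Hamel_dim ?A \<le>o Q ^c natLeq"
      using Hamel_dim_le_card_of card_of_CP_le[OF Q] by (rule ordLeq_transitive)
    ultimately have "Hamel_dim ?A =o Q ^c natLeq" using ordIso_iff_ordLeq by blast
    moreover have "Q ^c natLeq =o Lindelof_number X ^c natLeq"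
      using ordIso_symmetric[OF iso] natLeq_Card_order by (rule cexp_cong1)
    ultimately show ?thesis by (rule ordIso_transitive)
  qed
  show ?thesis
  proof (cases "finite I")
    case False
    have "Cinfinite |I|" using False by (simp add: cinfinite_def Field_card_of card_of_card_order_on)
    moreover have "|I| \<le>o |I|" by (rule card_of_mono1) simp
    ultimately show ?thesis
      using main[OF Lindelof_number_infinite[OF False]] ex_large_independent_indicators[OF False] by blast
  next
    case True
    then have cI: "countable I" by (rule countable_finite)
    have "\<exists>U\<subseteq>?A. funspace.independent U \<and> infinite U \<and> natLeq ^c natLeq \<le>o |U|"
    proof (cases "\<forall>p\<in>topspace X. openin X {p}")
      case True
      \<comment> \<open>If all points are isolated, the singletons form an infinite partition of the
        same space with the same algebra, and the indicators of branches become available although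
        \<open>I\<close> is finite.\<close>
      interpret S: Lindelof_partition X "(\<lambda>p. {p}) ` topspace X"
      proof
        fix C assume "C \<in> (\<lambda>p. {p}) ` topspace X"
        then show "openin X C" "C \<noteq> {}" "Lindelof_space (subtopology X C)"
          using True by (auto intro: countable_imp_Lindelof_space)
      qed (use metrizable nonempty in \<open>auto simp: disjoint_def simp del: topspace_discrete_topology\<close>)
      have i: "infinite ((\<lambda>p. {p}) ` topspace X)" using inf by (auto dest!: finite_imageD simp: inj_on_def)
      then have "natLeq \<le>o |(\<lambda>p. {p}) ` topspace X|" using infinite_iff_natLeq_ordLeq by blast
      then have "natLeq ^c natLeq \<le>o |(\<lambda>p. {p}) ` topspace X| ^c natLeq"
        using natLeq_Card_order by (rule cexp_mono1)
      then show ?thesis using S.ex_large_independent_indicators[OF i] ordLeq_transitive by blast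
    next
      case False
      then show ?thesis using ex_large_independent_powers[OF cI] by blast
    qed
    moreover have "|I| \<le>o natLeq" using cI countable_card_le_natLeq by blast
    ultimately show ?thesis
      using main[OF Lindelof_number_countable[OF cI inf] _ natLeq_Cinfinite] by blast
  qed
qed

end

context Lindelof_partition
begin

lemma homeomorphic_space_Y:
  assumes iso: "isometrically_isomorphic X (CP Lindelof_property X :: ('a \<Rightarrow> 'k::{real_normed_field,euclidean_space}) set) Z (Cc Z)"
    and Z: "locally_compact_space Z" "Hausdorff_space Z"
  shows "Z homeomorphic_space Y"
proof -
  have "isometrically_isomorphic Z (Cc Z) X (CP Lindelof_property X :: ('a \<Rightarrow> 'k) set)"
    using iso subspace_CP mult_CP by (rule isometrically_isomorphic_sym)
  then have "isometrically_isomorphic Z (Cc Z) Y (Cc Y :: (_ \<Rightarrow> 'k) set)"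
    using isometrically_isomorphic_CP by (rule isometrically_isomorphic_trans)
  with Z locally_compact_Y Hausdorff_Y show ?thesis
    by (rule isometrically_isomorphic_Cc_imp_homeomorphic)
qed

end

theorem theorem4p6:
  fixes X :: "'a topology"
  assumes "topspace X \<noteq> {}"
    and "metrizable_space X"
    and "locally_with Lindelof_property X"
  shows
    "let A = (CP Lindelof_property X :: ('a \<Rightarrow> 'k::{real_normed_field, euclidean_space}) set);
         Y = lambda_P TYPE('k) Lindelof_property X
     in
       Banach_subalgebra_Cb X A \<and>
       \<comment> \<open>existence of the representing space\<close>
       topspace Y \<noteq> {} \<and> locally_compact_space Y \<and> Hausdorff_space Y \<and>
       isometrically_isomorphic X A Y (Cc Y) \<and>
       \<comment> \<open>uniqueness\<close>
       (\<forall>Z :: 'c topology.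
          topspace Z \<noteq> {} \<and> locally_compact_space Z \<and> Hausdorff_space Z \<and>
          isometrically_isomorphic X A Z (Cc Z) \<longrightarrow> Z homeomorphic_space Y) \<and>
       \<comment> \<open>(1)\<close>
       A = {f \<in> Cb X. Lindelof_property (subtopology X (Supp X f))} \<and>
       \<comment> \<open>(2)\<close>
       C0 X \<subseteq> A \<and> (\<not> Lindelof_property X \<longrightarrow> C0 X \<subset> A) \<and>
       \<comment> \<open>(3)\<close>
       (Cc Y :: ((('a \<Rightarrow> real) \<Rightarrow> real) \<Rightarrow> 'k) set) = C0 Y \<and>
       \<comment> \<open>(4)\<close>
       countably_compact_space Y \<and>
       \<comment> \<open>(5)\<close>
       (\<not> Lindelof_property X \<longrightarrow> \<not> normal_space Y) \<and>
       \<comment> \<open>(6); a nonempty finite space has finite-dimensional function space, so it is excluded\<close>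
       (infinite (topspace X) \<longrightarrow> Hamel_dim A =o Lindelof_number X ^c natLeq)"
proof -
  obtain I where "\<forall>C\<in>I. openin X C \<and> C \<noteq> {} \<and> Lindelof_space (subtopology X C)" "disjoint I" "\<Union>I = topspace X"
    using locally_Lindelof_metrizable_partition[OF assms(2,3)] by blast
  then interpret Lindelof_partition X I
    using assms(1,2) by unfold_locales auto
  have Y: "lambda_P TYPE('k) Lindelof_property X = Y"
    unfolding lambda_eq Y_def ..
  have "\<not> normal_space Y" if "\<not> Lindelof_property X"
    using that not_normal_Y unfolding Lindelof_property_iff' Lindelof_iff_countable by blast
  then show ?thesis
    unfolding Let_def Y
    by (intro conjI allI impI Banach_subalgebra_CP Y_nonempty locally_compact_Y Hausdorff_Y
        isometrically_isomorphic_CP CP_eq_Lindelof_support C0_subset_CP C0_psubset_CP Cc_eq_C0_Y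
        countably_compact_Y Hamel_dim_CP) (auto intro: homeomorphic_space_Y)
qed

end
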